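(* Let $s\ge 1$, let $\mathcal{C}=(C_1,\ldots,C_s)$ be an $s$-tuple of centrally symmetric convex bodies in $\mathbb{R}^n$ and let $K$ be a centrally symmetric convex body in $\mathbb{R}^n$, with $\mathrm{vol}_n(C_j)=\mathrm{vol}_n(K)=1$ for all $1\le j\le s$. Then, for any $\mathbf{t}=(t_1,\ldots,t_s)\in\mathbb{R}^s$, $$\|\mathbf{t}\|_{\mathcal{C},K}\ \ge\ \frac{n}{e(n+1)}\,\|\mathbf{t}\|_2 .$$
   Context: A convex body in $\mathbb{R}^n$ is a compact convex set with non-empty interior; it is centrally symmetric if $-C=C$. For a centrally symmetric convex body $K$, $\|x\|_K=\inf\{r>0: x\in rK\}$. $\|\cdot\|_2$ is the Euclidean norm. For bodies $C_j$ in $\mathbb{R}^n$, $$\|\mathbf{t}\|_{\mathcal{C},K}=\frac{1}{\prod_{j=1}^s\mathrm{vol}_n(C_j)}\int_{C_1}\cdots\int_{C_s}\Big\|\sum_{j=1}^s t_jx_j\Big\|_K\,dx_1\cdots dx_s .$$ *)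

theory Defs
  imports "HOL-Analysis.Analysis"
begin

definition convex_body :: "'a::euclidean_space set \<Rightarrow> bool" where
  "convex_body C \<longleftrightarrow> compact C \<and> convex C \<and> interior C \<noteq> {}"

definition centrally_symmetric :: "'a::real_vector set \<Rightarrow> bool" where
  "centrally_symmetric C \<longleftrightarrow> uminus ` C = C"

definition body_norm :: "'a::real_vector set \<Rightarrow> 'a \<Rightarrow> real" where
  "body_norm K x = Inf {r. r > 0 \<and> x \<in> (\<lambda>y. r *\<^sub>R y) ` K}"

(* The s-fold integral over C_1, ..., C_s is the integral over the Cartesian product of the C_j
   with respect to the product of s copies of Lebesgue measure; lborel suffices, as convex
   bodies are Borel sets. The tuple is indexed by the finite type 's, of cardinality s >= 1. *)
definition multi_integral_norm ::
    "('s::finite \<Rightarrow> 'a::euclidean_space set) \<Rightarrow> 'a set \<Rightarrow> real ^ 's \<Rightarrow> real" where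
  "multi_integral_norm C K t =
     1 / (\<Prod>j\<in>UNIV. measure lborel (C j)) *
     (LINT x : (\<Pi>\<^sub>E j\<in>UNIV. C j) | (\<Pi>\<^sub>M j\<in>UNIV. lborel).
        body_norm K (\<Sum>j\<in>UNIV. (t $ j) *\<^sub>R x j))"

end

theory Submission
  imports Defs "HOL-Probability.Probability"
begin

text \<open>
  Let \<open>X = \<Sum>j. t\<^sub>j U\<^sub>j\<close> with independent \<open>U\<^sub>j\<close> distributed uniformly on the bodies
  \<open>C\<^sub>j\<close>, so that the quantity to be estimated is the expectation of \<open>\<parallel>X\<parallel>\<^sub>K\<close>. The proof compares
  the two sides through the differential entropy \<open>h(X) = - \<integral> f ln f\<close>, where \<open>f\<close> is the density
  of \<open>X\<close>.

  Each \<open>U\<^sub>j\<close> has entropy \<open>0\<close> because \<open>C\<^sub>j\<close> has volume \<open>1\<close>. The entropy power inequality, in the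
  linear form \<open>h(aX + bY) \<ge> a\<^sup>2 h(X) + b\<^sup>2 h(Y)\<close> for \<open>a\<^sup>2 + b\<^sup>2 = 1\<close>, then shows that \<open>X / |t|\<close>
  has nonnegative entropy (\<open>law_of_weighted_sum\<close>). On the other hand a random vector \<open>Z\<close> with small
  \<open>E \<parallel>Z\<parallel>\<^sub>K\<close> has small entropy: Gibbs' inequality against the density proportional to
  \<open>exp (- \<kappa> \<parallel>z\<parallel>\<^sub>K)\<close>, whose total mass is \<open>n! / \<kappa>\<^sup>n\<close> since \<open>K\<close> has volume \<open>1\<close>, gives
  \<open>h(Z) \<le> \<kappa> E \<parallel>Z\<parallel>\<^sub>K + ln (n! / \<kappa>\<^sup>n)\<close>. With \<open>h(Z) \<ge> 0\<close> and \<open>\<kappa> = e (n + 1)\<close> this is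
  \<open>E \<parallel>Z\<parallel>\<^sub>K \<ge> n / (e (n + 1))\<close> (\<open>expected_body_norm_ge\<close>).

  The entropy power inequality is proved by transport in dimension one and by the chain rule for
  entropy in higher dimensions. In dimension one, let \<open>T\<^sub>1\<close>, \<open>T\<^sub>2\<close> be the increasing maps that carry
  the standard Gaussian measure to the laws of \<open>X\<close> and \<open>Y\<close>. Then \<open>aX + bY\<close> is represented as
  \<open>a T\<^sub>1(p) + b T\<^sub>2(q)\<close> with independent Gaussian variables \<open>p\<close>, \<open>q\<close>. After the rotation
  \<open>y = ap + bq\<close>, \<open>w = - bp + aq\<close> this is, for each fixed \<open>w\<close>, an increasing function of \<open>y\<close> with
  derivative \<open>a\<^sup>2 T\<^sub>1' + b\<^sup>2 T\<^sub>2'\<close>, and concavity of the logarithm bounds the logarithm of that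
  derivative below by \<open>a\<^sup>2 ln T\<^sub>1' + b\<^sup>2 ln T\<^sub>2'\<close>, which is what the entropies of \<open>X\<close> and \<open>Y\<close>
  are made of (\<open>entropy_inequality_1d_continuous\<close>). For the passage to higher dimensions the
  inequality is put into a dual form: an arbitrary test function \<open>g\<close> replaces the density of
  \<open>aX + bY\<close>, and the functions need not have mass one. In this form it is inherited by product
  measures, one coordinate at a time (\<open>entropy_inequality_pair\<close>).
\<close>

section \<open>Monotone transport of the Gaussian measure\<close>

text \<open>The substitution rule on compact intervals extends to the whole line by monotone convergence.\<close>

lemma nn_integral_increasing_substitution:
  fixes T D :: "real \<Rightarrow> real" and \<psi> :: "real \<Rightarrow> ennreal"
  assumes \<psi> [measurable]: "\<psi> \<in> borel_measurable borel"
    and T: "\<And>p. (T has_real_derivative D p) (at p)"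
    and D: "continuous_on UNIV D" "\<And>p. D p > 0"
  shows "(\<integral>\<^sup>+x. \<psi> x * indicator (range T) x \<partial>lborel) = (\<integral>\<^sup>+p. \<psi> (T p) * ennreal (D p) \<partial>lborel)"
proof -
  have mono: "T x \<le> T y" if "x \<le> y" for x y
    using DERIV_nonneg_imp_nondecreasing[OF that] T D(2) by (meson less_imp_le)
  have cont: "continuous_on S T" for S
    by (meson DERIV_continuous_on T has_field_derivative_at_within)
  have [measurable]: "D \<in> borel_measurable borel" "T \<in> borel_measurable borel"
    using D(1) cont by (auto intro: borel_measurable_continuous_onI)
  define I where "I n = {- real n .. real n}" for n
  define J where "J n = {T (- real n) .. T (real n)}" for n
  have I: "eventually (\<lambda>n. p \<in> I n) sequentially" for p
  proof -
    have "eventually (\<lambda>n. \<bar>p\<bar> \<le> real n) sequentially"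
      using eventually_ge_at_top[of "nat \<lceil>\<bar>p\<bar>\<rceil>"] by eventually_elim linarith
    then show ?thesis by eventually_elim (auto simp: I_def)
  qed
  have IJ: "x \<in> range T" if "x \<in> J n" for x n
    using IVT'[of T "- real n" x "real n"] that cont by (auto simp: J_def)
  have TJ: "T p \<in> J n" if "p \<in> I n" for p n
    using that by (auto simp: I_def J_def intro!: mono)
  have Imono: "I m \<subseteq> I n" "J m \<subseteq> J n" if "m \<le> n" for m n
    using that mono[of "- real n" "- real m"] mono[of "real m" "real n"]
    by (auto simp: I_def J_def)
  have 1: "(\<lambda>n. \<integral>\<^sup>+x. \<psi> x * indicator (J n) x \<partial>lborel) \<longlonglongrightarrow> (\<integral>\<^sup>+x. \<psi> x * indicator (range T) x \<partial>lborel)"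
  proof (rule nn_integral_LIMSEQ)
    show "incseq (\<lambda>n x. \<psi> x * indicator (J n) x)"
      using Imono(2) by (auto simp: incseq_def le_fun_def indicator_def)
    show "(\<lambda>x. \<psi> x * indicator (J n) x) \<in> borel_measurable lborel" for n
      by (simp add: J_def)
    show "(\<lambda>n. \<psi> x * indicator (J n) x) \<longlonglongrightarrow> \<psi> x * indicator (range T) x" for x
    proof (cases "x \<in> range T")
      case True
      then obtain p where p: "x = T p" by auto
      have "eventually (\<lambda>n. \<psi> x * indicator (J n) x = \<psi> x * indicator (range T) x) sequentially"
        using I[of p] by eventually_elim (use TJ p in auto)
      then show ?thesis by (rule tendsto_eventually)
    next
      case False
      then have "x \<notin> J n" for n using IJ by blast
      with False show ?thesis by simp
    qed
  qed
  have 2: "(\<lambda>n. \<integral>\<^sup>+p. \<psi> (T p) * ennreal (D p) * indicator (I n) p \<partial>lborel) \<longlonglongrightarrow> (\<integral>\<^sup>+p. \<psi> (T p) * ennreal (D p) \<partial>lborel)"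
  proof (rule nn_integral_LIMSEQ)
    show "incseq (\<lambda>n p. \<psi> (T p) * ennreal (D p) * indicator (I n) p)"
      using Imono(1) by (auto simp: incseq_def le_fun_def indicator_def)
    show "(\<lambda>p. \<psi> (T p) * ennreal (D p) * indicator (I n) p) \<in> borel_measurable lborel" for n
      by (simp add: I_def)
    show "(\<lambda>n. \<psi> (T p) * ennreal (D p) * indicator (I n) p) \<longlonglongrightarrow> \<psi> (T p) * ennreal (D p)" for p
    proof -
      have "eventually (\<lambda>n. \<psi> (T p) * ennreal (D p) * indicator (I n) p = \<psi> (T p) * ennreal (D p)) sequentially"
        using I[of p] by eventually_elim auto
      then show ?thesis by (rule tendsto_eventually)
    qed
  qed
  have "(\<integral>\<^sup>+x. \<psi> x * indicator (J n) x \<partial>lborel) = (\<integral>\<^sup>+p. \<psi> (T p) * ennreal (D p) * indicator (I n) p \<partial>lborel)" if "n \<ge> 1" for n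
    unfolding I_def J_def
    by (rule nn_integral_substitution_aux[OF \<psi>])
       (use that T D in \<open>auto intro: continuous_on_subset less_imp_le\<close>)
  then have "eventually (\<lambda>n. (\<integral>\<^sup>+x. \<psi> x * indicator (J n) x \<partial>lborel) = (\<integral>\<^sup>+p. \<psi> (T p) * ennreal (D p) * indicator (I n) p \<partial>lborel)) sequentially"
    by (metis (mono_tags, lifting) eventually_at_top_linorderI)
  with 1 have "(\<lambda>n. \<integral>\<^sup>+p. \<psi> (T p) * ennreal (D p) * indicator (I n) p \<partial>lborel) \<longlonglongrightarrow> (\<integral>\<^sup>+x. \<psi> x * indicator (range T) x \<partial>lborel)"
    by (simp add: tendsto_cong)
  with 2 show ?thesis by (simp add: LIMSEQ_unique)
qed

text \<open>With \<open>\<Phi>\<close> and \<open>F\<close> the distribution functions of the Gaussian measure and of \<open>f\<close>, the map is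
  \<open>T = F\<^sup>-\<^sup>1 \<circ> \<Phi>\<close>. Continuity and positivity of \<open>f\<close> make \<open>F\<close> a diffeomorphism, so that \<open>T\<close> is
  differentiable everywhere.\<close>

lemma gaussian_transport:
  fixes f :: "real \<Rightarrow> real"
  assumes R: "R > 0" and f: "continuous_on {-R..R} f" "\<And>x. x \<in> {-R..R} \<Longrightarrow> f x > 0"
    and mass: "integral {-R..R} f = 1"
  obtains T where "range T = {-R<..<R}"
    "\<And>p. (T has_real_derivative std_normal_density p / f (T p)) (at p)"
proof -
  define N where "N = density lborel (\<lambda>x. ennreal (std_normal_density x))"
  interpret N: prob_space N
    unfolding N_def by (rule prob_space_normal_density) simp
  interpret N: real_distribution N
    by standard (auto simp: N_def)
  define \<Phi> where "\<Phi> x = cdf N x" for x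
  have cont_g: "continuous_on S std_normal_density" for S
    unfolding std_normal_density_def by (intro continuous_intros) auto
  have step: "\<Phi> y = \<Phi> x + integral {x..y} std_normal_density" if "x \<le> y" for x y
  proof -
    have sub: "{x<..y} = {..y} - {..x}" by auto
    have "\<Phi> y - \<Phi> x = measure N {x<..y}"
      using that unfolding \<Phi>_def cdf_def sub
      by (subst N.finite_measure_Diff) auto
    also have "\<dots> = measure N {x..y}"
    proof -
      have "AE t in N. t \<noteq> x"
        unfolding N_def by (subst AE_density) (auto intro: AE_lborel_singleton[THEN AE_mp])
      then show ?thesis by (intro N.finite_measure_eq_AE) auto
    qed
    also have "\<dots> = (LINT t:{x..y}|lborel. std_normal_density t)"
      unfolding N_def set_lebesgue_integral_def
      by (subst measure_def, subst emeasure_density)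
         (auto simp: integral_eq_nn_integral ennreal_indicator ennreal_mult'' mult.commute)
    also have "\<dots> = integral {x..y} std_normal_density"
      by (intro set_borel_integral_eq_integral borel_integrable_atLeastAtMost' cont_g)
    finally show ?thesis by simp
  qed
  have \<Phi>_deriv: "(\<Phi> has_real_derivative std_normal_density x) (at x)" for x
  proof -
    have "((\<lambda>y. integral {x-1..y} std_normal_density) has_real_derivative std_normal_density x) (at x within {x-1..x+1})"
      by (rule integral_has_real_derivative[OF cont_g]) auto
    then have "((\<lambda>y. integral {x-1..y} std_normal_density) has_real_derivative std_normal_density x) (at x)"
      by (simp add: at_within_Icc_at)
    then have "((\<lambda>y. \<Phi> (x-1) + integral {x-1..y} std_normal_density) has_real_derivative 0 + std_normal_density x) (at x)"
      by (intro DERIV_add) auto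
    moreover have "eventually (\<lambda>y. \<Phi> (x-1) + integral {x-1..y} std_normal_density = \<Phi> y) (nhds x)"
    proof -
      have "eventually (\<lambda>y. y \<in> {x-1<..}) (nhds x)"
        by (rule eventually_nhds_in_open) auto
      then show ?thesis by eventually_elim (simp add: step[of "x-1", symmetric] less_imp_le)
    qed
    ultimately show ?thesis by (simp cong: DERIV_cong_ev)
  qed
  have \<Phi>_mono: "\<Phi> x < \<Phi> y" if "x < y" for x y
    by (rule DERIV_pos_imp_increasing[OF that]) (meson \<Phi>_deriv normal_density_pos zero_less_one)
  have \<Phi>_cont: "continuous_on S \<Phi>" for S
    by (meson DERIV_continuous_on \<Phi>_deriv has_field_derivative_at_within)
  have \<Phi>01: "0 < \<Phi> x" "\<Phi> x < 1" for x
    using \<Phi>_mono[of "x - 1" x] \<Phi>_mono[of x "x + 1"] N.cdf_nonneg[of "x-1"] N.cdf_bounded_prob[of "x+1"]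
    unfolding \<Phi>_def by linarith+
  have \<Phi>_surj: "\<exists>p. \<Phi> p = y" if y: "0 < y" "y < 1" for y
  proof -
    have top: "(\<Phi> \<longlongrightarrow> 1) at_top" and bot: "(\<Phi> \<longlongrightarrow> 0) at_bot"
      using N.cdf_lim_at_top_prob N.cdf_lim_at_bot unfolding \<Phi>_def[abs_def] by simp_all
    obtain v where v: "y < \<Phi> v" 
      using eventually_happens'[OF trivial_limit_at_top_linorder order_tendstoD(1)[OF top y(2)]] ..
    obtain u where u: "\<Phi> u < y"
      using eventually_happens'[OF trivial_limit_at_bot_linorder order_tendstoD(2)[OF bot y(1)]] ..
    have "u \<le> v"
    proof (rule ccontr)
      assume "\<not> u \<le> v"
      then have "\<Phi> v < \<Phi> u" by (intro \<Phi>_mono) simp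
      then show False using u v by linarith
    qed
    then obtain p where "\<Phi> p = y" 
      using IVT'[of \<Phi> u y v, OF less_imp_le[OF u] less_imp_le[OF v] _ \<Phi>_cont] by blast
    then show ?thesis by blast
  qed
  define F where "F x = integral {-R..x} f" for x
  have F_deriv0: "(F has_real_derivative f x) (at x within {-R..R})" if "x \<in> {-R..R}" for x
    unfolding F_def[abs_def] by (rule integral_has_real_derivative[OF f(1) that])
  have F_deriv: "(F has_real_derivative f x) (at x)" if "x \<in> {-R<..<R}" for x
    using F_deriv0[of x] that by (simp add: at_within_Icc_at)
  have F_cont: "continuous_on {-R..R} F"
    using F_deriv0 by (rule DERIV_continuous_on)
  have F0: "F (-R) = 0" and F1: "F R = 1"
    using mass by (auto simp: F_def)
  have F_mono: "F x < F y" if "x < y" "x \<in> {-R..R}" "y \<in> {-R..R}" for x y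
  proof (rule DERIV_pos_imp_increasing_open[OF that(1)])
    show "\<exists>l. (F has_real_derivative l) (at z) \<and> 0 < l" if "x < z" "z < y" for z
      using that \<open>x \<in> {-R..R}\<close> \<open>y \<in> {-R..R}\<close> by (intro exI[of _ "f z"] conjI F_deriv f(2)) auto
    show "continuous_on {x..y} F"
      by (rule continuous_on_subset[OF F_cont]) (use that in auto)
  qed
  have "\<exists>x\<in>{-R<..<R}. F x = \<Phi> p" for p
  proof -
    obtain x where x: "-R \<le> x" "x \<le> R" "F x = \<Phi> p"
      using IVT'[of F "-R" "\<Phi> p" R] F_cont F0 F1 \<Phi>01[of p] R by auto
    then have "x \<noteq> -R" "x \<noteq> R" using F0 F1 \<Phi>01[of p] by auto
    with x show ?thesis by force
  qed
  then obtain T where T: "\<And>p. T p \<in> {-R<..<R}" "\<And>p. F (T p) = \<Phi> p"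
    by metis
  have F_inj: "x = y" if "F x = F y" "x \<in> {-R<..<R}" "y \<in> {-R<..<R}" for x y
    using F_mono[of x y] F_mono[of y x] that by (cases x y rule: linorder_cases) auto
  have "range T = {-R<..<R}"
  proof safe
    fix x assume x: "x \<in> {-R<..<R}"
    then have "0 < F x" "F x < 1"
      using F_mono[of "-R" x] F_mono[of x R] F0 F1 by auto
    then obtain p where "\<Phi> p = F x" using \<Phi>_surj by blast
    then have "x = T p" using F_inj[of "T p" x] T x by metis
    then show "x \<in> range T" by blast
  qed (use T in auto)
  moreover have "(T has_real_derivative std_normal_density p / f (T p)) (at p)" for p
  proof -
    \<comment> \<open>\<open>G\<close> inverts \<open>F\<close> on \<open>(0, 1)\<close>, where \<open>\<Phi>\<close> takes its values, so that \<open>T = G \<circ> \<Phi>\<close>.\<close>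
    define G where "G y = (THE x. x \<in> {-R<..<R} \<and> F x = y)" for y
    have G: "G (F x) = x" if "x \<in> {-R<..<R}" for x
      unfolding G_def using that F_inj by (intro the_equality) auto
    have "(G has_real_derivative inverse (f (T p))) (at (F (T p)))"
      unfolding has_field_derivative_def
    proof (rule has_derivative_inverse_strong[where S="{-R<..<R}" and f=F and x="T p" and f'="(*) (f (T p))"])
      show "(F has_derivative (*) (f (T p))) (at (T p))" "T p \<in> {-R<..<R}"
        using F_deriv[OF T(1)] T(1) by (auto simp: has_field_derivative_def)
      show "(*) (f (T p)) \<circ> (*) (inverse (f (T p))) = id"
        using f(2)[of "T p"] T(1)[of p] by (auto simp: fun_eq_iff)
      show "continuous_on {-R<..<R} F" by (rule continuous_on_subset[OF F_cont]) auto
    qed (use G in auto)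
    then have "((\<lambda>q. G (\<Phi> q)) has_real_derivative inverse (f (T p)) * std_normal_density p) (at p)"
      using DERIV_chain2[OF _ \<Phi>_deriv] T by simp
    moreover have "(\<lambda>q. G (\<Phi> q)) = T" using G[OF T(1)] T(2) by (simp add: fun_eq_iff)
    ultimately show ?thesis by (simp add: field_simps)
  qed
  ultimately show ?thesis using that by blast
qed

section \<open>Lebesgue measure on a cube\<close>

definition cube :: "real \<Rightarrow> 'a::euclidean_space set" where
  "cube R = cbox (- (R *\<^sub>R One)) (R *\<^sub>R One)"

text \<open>Cutting Lebesgue measure down to a cube makes it finite. Bounded measurable functions are then
  integrable, and Fubini's theorem applies to them freely.\<close>

definition cube_measure :: "real \<Rightarrow> 'a::euclidean_space measure" where
  "cube_measure R = density lborel (indicator (cube R))"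

lemma cube_real: "cube R = {-R..R::real}"
  by (simp add: cube_def)

lemma mem_cube: "x \<in> cube R \<longleftrightarrow> (\<forall>i\<in>Basis. \<bar>x \<bullet> i\<bar> \<le> R)"
  by (auto simp: cube_def mem_box abs_le_iff)

lemma borel_cube [measurable]: "cube R \<in> sets borel"
  by (simp add: cube_def)

lemma sets_cube_measure [simp, measurable_cong]: "sets (cube_measure R) = sets borel"
  by (simp add: cube_measure_def)

lemma space_cube_measure [simp]: "space (cube_measure R) = UNIV"
  by (simp add: cube_measure_def)

lemma emeasure_cube_measure_space: "emeasure (cube_measure R) (UNIV :: 'a::euclidean_space set) = emeasure lborel (cube R :: 'a set)"
  by (simp add: cube_measure_def emeasure_density)

lemma finite_cube_measure: "finite_measure (cube_measure R)"
  by standard (simp add: emeasure_cube_measure_space cube_def emeasure_lborel_cbox_eq)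

lemma integral_cube_measure:
  fixes h :: "'a::euclidean_space \<Rightarrow> real"
  assumes [measurable]: "h \<in> borel_measurable borel"
  shows "(\<integral>x. h x \<partial>cube_measure R) = (\<integral>x. indicator (cube R) x * h x \<partial>lborel)"
  unfolding cube_measure_def ennreal_indicator[symmetric]
  by (subst integral_density) auto

lemma nn_integral_cube_measure:
  assumes [measurable]: "h \<in> borel_measurable borel"
  shows "(\<integral>\<^sup>+x. h x \<partial>cube_measure R) = (\<integral>\<^sup>+x. h x * indicator (cube R) x \<partial>lborel)"
  unfolding cube_measure_def
  by (subst nn_integral_density) (auto simp: mult.commute)

section \<open>The entropy inequality on the line\<close>

text \<open>Two substitutions in a single variable, with Fubini's theorem in between, make up the rotation:
  \<open>p\<close> is replaced by \<open>w = - bp + aq\<close> for fixed \<open>q\<close>, and then \<open>q\<close> by \<open>y = ap + bq\<close> for fixed \<open>w\<close>.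
  These are affine substitutions of slopes \<open>- 1 / b\<close> and \<open>b\<close>.\<close>

lemma nn_integral_rotation:
  fixes a b :: real
  assumes [measurable]: "(\<lambda>(p, q). H p q) \<in> borel_measurable (borel \<Otimes>\<^sub>M borel)"
    and ab: "a\<^sup>2 + b\<^sup>2 = 1" "b \<noteq> 0"
  shows "(\<integral>\<^sup>+p. \<integral>\<^sup>+q. H p q \<partial>lborel \<partial>lborel) = (\<integral>\<^sup>+w. \<integral>\<^sup>+y. H (a*y - b*w) (b*y + a*w) \<partial>lborel \<partial>lborel)"
proof -
  have "(\<integral>\<^sup>+p. \<integral>\<^sup>+q. H p q \<partial>lborel \<partial>lborel) = (\<integral>\<^sup>+q. \<integral>\<^sup>+p. H p q \<partial>lborel \<partial>lborel)"
    by (rule lborel_pair.Fubini') simp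
  also have "\<dots> = (\<integral>\<^sup>+q. \<integral>\<^sup>+w. ennreal \<bar>-1/b\<bar> * H (a*q/b + (-1/b)*w) q \<partial>lborel \<partial>lborel)"
  proof (rule nn_integral_cong)
    fix q :: real
    show "(\<integral>\<^sup>+p. H p q \<partial>lborel) = (\<integral>\<^sup>+w. ennreal \<bar>-1/b\<bar> * H (a*q/b + (-1/b)*w) q \<partial>lborel)"
      using ab by (subst nn_integral_real_affine[of _ "-1/b" "a*q/b"]) (auto simp: nn_integral_cmult)
  qed
  also have "\<dots> = (\<integral>\<^sup>+w. \<integral>\<^sup>+q. ennreal \<bar>-1/b\<bar> * H (a*q/b + (-1/b)*w) q \<partial>lborel \<partial>lborel)"
    by (rule lborel_pair.Fubini') simp
  also have "\<dots> = (\<integral>\<^sup>+w. \<integral>\<^sup>+y. H (a*y - b*w) (b*y + a*w) \<partial>lborel \<partial>lborel)"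
  proof (rule nn_integral_cong)
    fix w :: real
    have "a * (a*w + b*y) / b + (-1/b)*w = a*y - b*w" for y
    proof -
      have "a * (a*w + b*y) - w = b * (a*y) + (a\<^sup>2 - 1) * w" by (simp add: algebra_simps power2_eq_square)
      also have "a\<^sup>2 - 1 = - b\<^sup>2" using ab by simp
      also have "b * (a*y) + - b\<^sup>2 * w = b * (a*y - b*w)" by (simp add: algebra_simps power2_eq_square)
      finally have "(a * (a*w + b*y) - w) / b = a*y - b*w" using ab(2) by simp
      then show ?thesis by (simp add: diff_divide_distrib)
    qed
    then show "(\<integral>\<^sup>+q. ennreal \<bar>-1/b\<bar> * H (a*q/b + (-1/b)*w) q \<partial>lborel) = (\<integral>\<^sup>+y. H (a*y - b*w) (b*y + a*w) \<partial>lborel)"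
      using ab by (subst nn_integral_real_affine[of _ b "a*w"])
         (auto simp: nn_integral_cmult mult.assoc[symmetric] ennreal_mult''[symmetric] add.commute)
  qed
  finally show ?thesis .
qed

text \<open>The Gaussian measure is carried by \<open>T\<close> to the measure with density \<open>f\<close> on \<open>[- R, R]\<close>: this is
  the substitution rule, because \<open>f (T p) T' p\<close> is the Gaussian density. The endpoints, which \<open>T\<close>
  does not reach, form a null set.\<close>

lemma gaussian_transport_integral:
  fixes f T h :: "real \<Rightarrow> real"
  assumes R: "R > 0" and f: "continuous_on UNIV f" "\<And>x. f x > 0"
    and T: "range T = {-R<..<R}" "\<And>p. (T has_real_derivative std_normal_density p / f (T p)) (at p)"
    and h [measurable]: "h \<in> borel_measurable borel"
  shows "(\<integral>p. h (T p) \<partial>std_normal_distribution) = (\<integral>x. f x * h x \<partial>cube_measure R)"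
proof -
  have [measurable]: "f \<in> borel_measurable borel"
    using f(1) by (rule borel_measurable_continuous_onI)
  have cT: "continuous_on UNIV T"
    by (meson DERIV_continuous_on T(2) has_field_derivative_at_within)
  then have [measurable]: "T \<in> borel_measurable borel"
    by (rule borel_measurable_continuous_onI)
  have cD: "continuous_on UNIV (\<lambda>p. std_normal_density p / f (T p))"
    unfolding std_normal_density_def using f(2)
    by (intro continuous_intros continuous_on_compose2[OF f(1) cT]) (auto simp: less_imp_neq[symmetric])
  have "distr std_normal_distribution borel T = density lborel (\<lambda>x. ennreal (f x * indicator (cube R) x))"
  proof (rule measure_eqI)
    fix A assume "A \<in> sets (distr std_normal_distribution borel T)"
    then have [measurable]: "A \<in> sets borel" by simp
    have "emeasure (distr std_normal_distribution borel T) A = (\<integral>\<^sup>+p. ennreal (std_normal_density p) * indicator A (T p) \<partial>lborel)"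
    proof -
      have "T -` A \<in> sets borel" using measurable_sets_borel[of T borel A] by simp
      then show ?thesis
        by (simp add: emeasure_distr emeasure_density) (simp add: indicator_def)
    qed
    also have "\<dots> = (\<integral>\<^sup>+p. ennreal (f (T p)) * indicator A (T p) * ennreal (std_normal_density p / f (T p)) \<partial>lborel)"
    proof (intro nn_integral_cong)
      fix p
      have "std_normal_density p = f (T p) * (std_normal_density p / f (T p))"
        using f(2)[of "T p"] by simp
      then have "ennreal (std_normal_density p) = ennreal (f (T p)) * ennreal (std_normal_density p / f (T p))"
        using f(2)[of "T p"] by (metis ennreal_mult' less_imp_le)
      then show "ennreal (std_normal_density p) * indicator A (T p) = ennreal (f (T p)) * indicator A (T p) * ennreal (std_normal_density p / f (T p))"
        by (simp add: mult_ac)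
    qed
    also have "\<dots> = (\<integral>\<^sup>+x. ennreal (f x) * indicator A x * indicator (range T) x \<partial>lborel)"
      by (rule nn_integral_increasing_substitution[symmetric, OF _ T(2) cD]) (auto simp: f(2) normal_density_pos)
    also have "\<dots> = (\<integral>\<^sup>+x. ennreal (f x * indicator (cube R) x) * indicator A x \<partial>lborel)"
    proof (rule nn_integral_cong_AE)
      have "AE x in lborel. x \<noteq> R \<and> x \<noteq> -R"
        using AE_lborel_singleton[of R] AE_lborel_singleton[of "-R"] by eventually_elim auto
      then show "AE x in lborel. ennreal (f x) * indicator A x * indicator (range T) x = ennreal (f x * indicator (cube R) x) * indicator A x"
        by eventually_elim (auto simp: T(1) cube_real indicator_def)
    qed
    finally show "emeasure (distr std_normal_distribution borel T) A = emeasure (density lborel (\<lambda>x. ennreal (f x * indicator (cube R) x))) A"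
      by (simp add: emeasure_density)
  qed simp
  then have "(\<integral>x. h x \<partial>density lborel (\<lambda>x. ennreal (f x * indicator (cube R) x))) = (\<integral>x. h x \<partial>distr std_normal_distribution borel T)"
    by simp
  also have "\<dots> = (\<integral>p. h (T p) \<partial>std_normal_distribution)"
    by (rule integral_distr) auto
  finally have "(\<integral>p. h (T p) \<partial>std_normal_distribution) = (\<integral>x. h x \<partial>density lborel (\<lambda>x. ennreal (f x * indicator (cube R) x)))"
    by simp
  also have "\<dots> = (\<integral>x. f x * indicator (cube R) x * h x \<partial>lborel)"
    using f(2) by (subst integral_density) (auto simp: less_imp_le)
  also have "\<dots> = (\<integral>x. f x * h x \<partial>cube_measure R)"
    by (subst integral_cube_measure) (auto simp: mult_ac)
  finally show ?thesis .
qed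

lemma ln_concave_two_point:
  fixes x y \<alpha> \<beta> :: real
  assumes "x > 0" "y > 0" "\<alpha> \<ge> 0" "\<beta> \<ge> 0" "\<alpha> + \<beta> = 1"
  shows "\<alpha> * ln x + \<beta> * ln y \<le> ln (\<alpha> * x + \<beta> * y)"
proof -
  have \<alpha>: "\<alpha> = 1 - \<beta>" and "\<beta> \<le> 1" using assms by auto
  then show ?thesis
    unfolding \<alpha> using concave_onD[OF ln_concave, of \<beta> x y] assms by simp
qed

text \<open>Let \<open>\<gamma>\<close> be the Gaussian density, \<open>X = a T\<^sub>1(p) + b T\<^sub>2(q)\<close> the transported sum and
  \<open>J = a\<^sup>2 T\<^sub>1'(p) + b\<^sup>2 T\<^sub>2'(q)\<close> its derivative along the direction \<open>(a, b)\<close>. The function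
  \<open>h = g(X) J / \<gamma>(ap + bq)\<close> has Gaussian expectation at most \<open>c = \<integral> g\<close>: rotating the plane turns
  \<open>\<gamma>(p) \<gamma>(q) h\<close> into \<open>\<gamma>(w) g(X) J\<close>, whose integral in the direction of \<open>y\<close> is a substitution
  along an increasing curve inside \<open>[- 2R, 2R]\<close>. Jensen's inequality, used in the pointwise form
  \<open>ln h \<le> h / c - 1 + ln c\<close>, and concavity of \<open>ln\<close> give the claim after integration. The Gaussian
  factors leave only \<open>ln \<gamma>(ap + bq) - a\<^sup>2 ln \<gamma>(p) - b\<^sup>2 ln \<gamma>(q) = - a b p q\<close>, which has
  expectation \<open>0\<close>.\<close>

proposition entropy_inequality_1d_continuous:
  fixes f1 f2 g :: "real \<Rightarrow> real" and a b R \<epsilon> B :: real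
  assumes R: "R > 0" and ab: "a\<^sup>2 + b\<^sup>2 = 1" "b \<noteq> 0"
    and f1: "continuous_on UNIV f1" "\<And>x. f1 x > 0" "(\<integral>x. f1 x \<partial>cube_measure R) = 1"
    and f2: "continuous_on UNIV f2" "\<And>x. f2 x > 0" "(\<integral>x. f2 x \<partial>cube_measure R) = 1"
    and g [measurable]: "g \<in> borel_measurable borel" and g_bounds: "\<epsilon> > 0" "\<And>x. \<epsilon> \<le> g x" "\<And>x. g x \<le> B"
  shows "(\<integral>x. \<integral>y. f1 x * f2 y * ln (g (a * x + b * y)) \<partial>cube_measure R \<partial>cube_measure R)
    \<le> ln (\<integral>z. g z \<partial>cube_measure (2 * R))
       + a\<^sup>2 * (\<integral>x. f1 x * ln (f1 x) \<partial>cube_measure R) + b\<^sup>2 * (\<integral>x. f2 x * ln (f2 x) \<partial>cube_measure R)"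
proof -
  define N where "N = std_normal_distribution"
  interpret N: prob_space N unfolding N_def by (rule prob_space_normal_density) simp
  interpret NN: pair_prob_space N N ..
  interpret C: finite_measure "cube_measure (2 * R) :: real measure" by (rule finite_cube_measure)
  have sN [measurable_cong, simp]: "sets N = sets borel" and [simp]: "space N = UNIV" by (simp_all add: N_def)
  define \<gamma> where "\<gamma> = std_normal_density"
  have \<gamma>_pos: "\<gamma> x > 0" for x by (simp add: \<gamma>_def normal_density_pos)
  have [measurable]: "\<gamma> \<in> borel_measurable borel" by (simp add: \<gamma>_def)
  have ln_\<gamma>: "ln (\<gamma> x) = - ln (sqrt (2 * pi)) - x\<^sup>2 / 2" for x
    by (simp add: \<gamma>_def std_normal_density_def ln_mult ln_div)
  have \<gamma>_mult: "\<gamma> p * \<gamma> q = \<gamma> (a * p + b * q) * \<gamma> (- b * p + a * q)" for p q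
  proof -
    have "(a * p + b * q)\<^sup>2 + (- b * p + a * q)\<^sup>2 = (a\<^sup>2 + b\<^sup>2) * p\<^sup>2 + (a\<^sup>2 + b\<^sup>2) * q\<^sup>2"
      by (simp add: algebra_simps power2_eq_square)
    then have "ln (\<gamma> p) + ln (\<gamma> q) = ln (\<gamma> (a * p + b * q)) + ln (\<gamma> (- b * p + a * q))"
      unfolding ln_\<gamma> using ab by simp
    then show ?thesis
      using \<gamma>_pos by (metis ln_inj_iff ln_mult_pos mult_pos_pos)
  qed
  have mass: "integral {-R..R} f = 1" if "continuous_on UNIV f" "(\<integral>x. f x \<partial>cube_measure R) = 1" for f :: "real \<Rightarrow> real"
  proof -
    have [measurable]: "f \<in> borel_measurable borel"
      using that(1) by (rule borel_measurable_continuous_onI)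
    have "(LINT x:{-R..R}|lborel. f x) = integral {-R..R} f"
      by (intro set_borel_integral_eq_integral borel_integrable_atLeastAtMost' continuous_on_subset[OF that(1)]) auto
    then show ?thesis using that(2) by (simp add: integral_cube_measure set_lebesgue_integral_def cube_real)
  qed
  obtain T1 where T1: "range T1 = {-R<..<R}" "\<And>p. (T1 has_real_derivative \<gamma> p / f1 (T1 p)) (at p)"
    using gaussian_transport[OF R continuous_on_subset[OF f1(1) subset_UNIV] f1(2) mass[OF f1(1,3)]] unfolding \<gamma>_def by blast
  obtain T2 where T2: "range T2 = {-R<..<R}" "\<And>p. (T2 has_real_derivative \<gamma> p / f2 (T2 p)) (at p)"
    using gaussian_transport[OF R continuous_on_subset[OF f2(1) subset_UNIV] f2(2) mass[OF f2(1,3)]] unfolding \<gamma>_def by blast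
  have cT: "continuous_on S T1" "continuous_on S T2" for S
    by (meson DERIV_continuous_on T1(2) T2(2) has_field_derivative_at_within)+
  have [measurable]: "T1 \<in> borel_measurable borel" "T2 \<in> borel_measurable borel"
      "f1 \<in> borel_measurable borel" "f2 \<in> borel_measurable borel"
    using cT f1(1) f2(1) by (auto intro: borel_measurable_continuous_onI)
  have c\<gamma>: "continuous_on S \<gamma>" for S
    unfolding \<gamma>_def std_normal_density_def by (intro continuous_intros) auto
  define D1 where "D1 p = \<gamma> p / f1 (T1 p)" for p
  define D2 where "D2 p = \<gamma> p / f2 (T2 p)" for p
  have D_pos: "D1 p > 0" "D2 p > 0" for p by (simp_all add: D1_def D2_def \<gamma>_pos f1 f2)
  have cD: "continuous_on UNIV D1" "continuous_on UNIV D2"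
    unfolding D1_def[abs_def] D2_def[abs_def] using f1(2) f2(2)
    by (auto intro!: continuous_intros c\<gamma> continuous_on_compose2[OF f1(1) cT(1)] continuous_on_compose2[OF f2(1) cT(2)]
        simp: less_imp_neq[symmetric])
  then have [measurable]: "D1 \<in> borel_measurable borel" "D2 \<in> borel_measurable borel"
    by (auto intro: borel_measurable_continuous_onI)
  define J where "J p q = a\<^sup>2 * D1 p + b\<^sup>2 * D2 q" for p q
  have J_pos: "J p q > 0" for p q
    unfolding J_def using D_pos[of p] D_pos(2)[of q] ab by (intro add_nonneg_pos mult_pos_pos mult_nonneg_nonneg) auto
  define X where "X p q = a * T1 p + b * T2 q" for p q
  define h where "h p q = g (X p q) * J p q / \<gamma> (a * p + b * q)" for p q
  define c where "c = (\<integral>z. g z \<partial>cube_measure (2 * R))"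
  have g_pos: "g x > 0" for x using g_bounds(1) g_bounds(2)[of x] by linarith
  have int_g: "integrable (cube_measure (2 * R)) g"
    using g_pos g_bounds by (intro C.integrable_const_bound[of _ B]) (auto simp: less_imp_le)
  have c_pos: "c > 0"
  proof -
    have "0 < \<epsilon> * measure (cube_measure (2 * R)) (UNIV::real set)"
      using R g_bounds by (auto simp: measure_def emeasure_cube_measure_space cube_real)
    also have "\<dots> = (\<integral>z. \<epsilon> \<partial>(cube_measure (2 * R) :: real measure))" by simp
    also have "\<dots> \<le> c"
      unfolding c_def using int_g g_bounds by (intro integral_mono) auto
    finally show ?thesis .
  qed
  have h_pos: "h p q > 0" for p q by (simp add: h_def J_pos g_pos \<gamma>_pos)
  have [measurable]: "(\<lambda>(p, q). h p q) \<in> borel_measurable (borel \<Otimes>\<^sub>M borel)"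
    unfolding h_def X_def J_def by measurable

  \<comment> \<open>After the rotation, the inner integral is the substitution along an increasing curve.\<close>
  have inner: "(\<integral>\<^sup>+y. ennreal (g (X (a*y - b*w) (b*y + a*w)) * J (a*y - b*w) (b*y + a*w)) \<partial>lborel) \<le> ennreal c" for w
  proof -
    define Y where "Y y = X (a*y - b*w) (b*y + a*w)" for y
    define D where "D y = J (a*y - b*w) (b*y + a*w)" for y
    have Y: "(Y has_real_derivative D y) (at y)" for y
      unfolding Y_def[abs_def] X_def D_def J_def D1_def D2_def
      by (rule derivative_eq_intros DERIV_chain2[OF T1(2)] DERIV_chain2[OF T2(2)] refl | simp add: power2_eq_square mult_ac)+
    have cDw: "continuous_on UNIV D"
      unfolding D_def[abs_def] J_def 
      by (intro continuous_intros continuous_on_compose2[OF cD(1)] continuous_on_compose2[OF cD(2)]) auto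
    have Yr: "Y y \<in> cube (2 * R)" for y
    proof -
      have "T1 p \<in> {-R<..<R}" "T2 p \<in> {-R<..<R}" for p using T1(1) T2(1) by blast+
      then have "\<bar>T1 p\<bar> \<le> R" "\<bar>T2 p\<bar> \<le> R" for p by (simp_all add: abs_le_iff minus_le_iff less_imp_le)
      moreover have "a\<^sup>2 \<le> 1" "b\<^sup>2 \<le> 1" using ab(1) zero_le_power2[of a] zero_le_power2[of b] by linarith+
      then have "\<bar>a\<bar> \<le> 1" "\<bar>b\<bar> \<le> 1" by (simp_all add: abs_square_le_1)
      ultimately have "\<bar>a * T1 p\<bar> \<le> 1 * R" "\<bar>b * T2 q\<bar> \<le> 1 * R" for p q
        unfolding abs_mult by (intro mult_mono; simp)+
      then have "\<bar>a * T1 p + b * T2 q\<bar> \<le> 2 * R" for p q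
        by (intro order_trans[OF abs_triangle_ineq]) (metis add_mono mult_1 mult_2)
      then show ?thesis unfolding Y_def X_def cube_real atLeastAtMost_iff abs_le_iff by (metis minus_le_iff)
    qed
    have "(\<integral>\<^sup>+y. ennreal (g (Y y)) * ennreal (D y) \<partial>lborel) = (\<integral>\<^sup>+x. ennreal (g x) * indicator (range Y) x \<partial>lborel)"
      by (rule nn_integral_increasing_substitution[symmetric, OF _ Y cDw]) (auto simp: D_def J_pos)
    also have "\<dots> \<le> (\<integral>\<^sup>+x. ennreal (g x) * indicator (cube (2 * R)) x \<partial>lborel)"
      using Yr by (intro nn_integral_mono) (auto split: split_indicator)
    also have "\<dots> = (\<integral>\<^sup>+x. ennreal (g x) \<partial>cube_measure (2 * R))"
      by (simp add: nn_integral_cube_measure)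
    also have "\<dots> = ennreal c"
      unfolding c_def using int_g g_pos by (intro nn_integral_eq_integral) (auto simp: less_imp_le)
    finally show ?thesis
      using J_pos g_pos by (simp add: Y_def D_def ennreal_mult less_imp_le)
  qed
  have "(\<integral>\<^sup>+z. ennreal (case_prod h z) \<partial>(N \<Otimes>\<^sub>M N)) = (\<integral>\<^sup>+p. \<integral>\<^sup>+q. ennreal (h p q) \<partial>N \<partial>N)"
    by (subst N.nn_integral_fst[symmetric]) auto
  also have "\<dots> = (\<integral>\<^sup>+p. \<integral>\<^sup>+q. ennreal (\<gamma> p) * (ennreal (\<gamma> q) * ennreal (h p q)) \<partial>lborel \<partial>lborel)"
    unfolding N_def \<gamma>_def[symmetric]
    by (simp add: nn_integral_density nn_integral_cmult)
  also have "\<dots> = (\<integral>\<^sup>+p. \<integral>\<^sup>+q. ennreal (\<gamma> (- b * p + a * q) * (g (X p q) * J p q)) \<partial>lborel \<partial>lborel)"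
  proof (intro nn_integral_cong)
    fix p q
    have "\<gamma> p * (\<gamma> q * h p q) = \<gamma> (- b * p + a * q) * (g (X p q) * J p q)"
      using \<gamma>_pos[of "a * p + b * q"] unfolding mult.assoc[symmetric] \<gamma>_mult[of p q] by (simp add: h_def)
    then show "ennreal (\<gamma> p) * (ennreal (\<gamma> q) * ennreal (h p q)) = ennreal (\<gamma> (- b * p + a * q) * (g (X p q) * J p q))"
      using \<gamma>_pos h_pos by (simp add: ennreal_mult[symmetric] less_imp_le)
  qed
  also have "\<dots> = (\<integral>\<^sup>+w. \<integral>\<^sup>+y. ennreal (\<gamma> w * (g (X (a*y - b*w) (b*y + a*w)) * J (a*y - b*w) (b*y + a*w))) \<partial>lborel \<partial>lborel)"
  proof -
    have "- b * (a*y - b*w) + a * (b*y + a*w) = (a\<^sup>2 + b\<^sup>2) * w" for y w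
      by (simp add: algebra_simps power2_eq_square)
    then show ?thesis using ab
      by (subst nn_integral_rotation[OF _ ab]) (auto simp: X_def J_def)
  qed
  also have "\<dots> = (\<integral>\<^sup>+w. ennreal (\<gamma> w) * (\<integral>\<^sup>+y. ennreal (g (X (a*y - b*w) (b*y + a*w)) * J (a*y - b*w) (b*y + a*w)) \<partial>lborel) \<partial>lborel)"
    using \<gamma>_pos g_pos J_pos 
    by (simp add: ennreal_mult less_imp_le X_def J_def) (simp add: nn_integral_cmult)
  also have "\<dots> \<le> (\<integral>\<^sup>+w. ennreal (\<gamma> w) * ennreal c \<partial>lborel)"
    by (intro nn_integral_mono mult_left_mono inner) simp
  also have "\<dots> = ennreal c * emeasure N (space N)"
    unfolding N_def by (subst emeasure_density) (auto simp: nn_integral_cmult \<gamma>_def mult.commute)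
  also have "\<dots> = ennreal c" using N.emeasure_space_1 by simp
  finally have h_le: "(\<integral>\<^sup>+z. ennreal (case_prod h z) \<partial>(N \<Otimes>\<^sub>M N)) \<le> ennreal c" .
  have int_h: "integrable (N \<Otimes>\<^sub>M N) (case_prod h)"
  proof (rule integrableI_nonneg)
    show "(\<integral>\<^sup>+z. ennreal (case_prod h z) \<partial>(N \<Otimes>\<^sub>M N)) < \<infinity>"
      using le_less_trans[OF h_le ennreal_less_top] by simp
  qed (use h_pos in \<open>auto simp: less_imp_le\<close>)
  have h_le': "(\<integral>p. \<integral>q. h p q \<partial>N \<partial>N) \<le> c"
  proof -
    have "(\<integral>p. \<integral>q. h p q \<partial>N \<partial>N) = (\<integral>z. case_prod h z \<partial>(N \<Otimes>\<^sub>M N))"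
      using NN.integral_fst'[OF int_h] by simp
    also have "\<dots> \<le> c"
      using h_le h_pos c_pos nn_integral_eq_integral[OF int_h] by (simp add: less_imp_le split_beta')
    finally show ?thesis .
  qed

  \<comment> \<open>Jensen's inequality and concavity of the logarithm, before integration.\<close>
  have key: "ln (g (X p q)) \<le> h p q / c - 1 + ln c - a * b * p * q + a\<^sup>2 * ln (f1 (T1 p)) + b\<^sup>2 * ln (f2 (T2 q))" for p q
  proof -
    have "a\<^sup>2 * ln (D1 p) + b\<^sup>2 * ln (D2 q) \<le> ln (J p q)"
      unfolding J_def using D_pos ab by (intro ln_concave_two_point) auto
    then have J: "a\<^sup>2 * (ln (\<gamma> p) - ln (f1 (T1 p))) + b\<^sup>2 * (ln (\<gamma> q) - ln (f2 (T2 q))) \<le> ln (J p q)"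
      using \<gamma>_pos f1(2) f2(2) by (simp add: D1_def D2_def ln_div less_imp_neq[symmetric])
    have "ln (h p q / c) \<le> h p q / c - 1"
      using h_pos c_pos by (intro ln_le_minus_one) simp
    moreover have "ln (h p q / c) = ln (g (X p q)) + ln (J p q) - ln (\<gamma> (a * p + b * q)) - ln c"
      using g_pos[of "X p q"] J_pos[of p q] \<gamma>_pos[of "a * p + b * q"] c_pos by (simp add: h_def ln_div ln_mult_pos)
    moreover have "ln (\<gamma> (a * p + b * q)) - a\<^sup>2 * ln (\<gamma> p) - b\<^sup>2 * ln (\<gamma> q) = - (a * b * p * q)"
    proof -
      have "ln (\<gamma> (a * p + b * q)) - a\<^sup>2 * ln (\<gamma> p) - b\<^sup>2 * ln (\<gamma> q)
        = (a\<^sup>2 + b\<^sup>2 - 1) * ln (sqrt (2 * pi)) - (a * b * p * q)"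
        unfolding ln_\<gamma> by (simp add: field_simps power2_eq_square)
      then show ?thesis using ab by simp
    qed
    ultimately show ?thesis using J by (simp add: algebra_simps)
  qed
  have bound: "\<exists>M. \<forall>x\<in>{-R..R}. \<bar>ln (f x)\<bar> \<le> M" if "continuous_on UNIV f" "\<And>x. f x > 0" for f :: "real \<Rightarrow> real"
  proof -
    have "continuous_on {-R..R} (\<lambda>x. ln (f x))"
      using that(2) by (intro continuous_intros continuous_on_subset[OF that(1)]) (auto simp: less_imp_neq[symmetric])
    then have "bounded ((\<lambda>x. ln (f x)) ` {-R..R})"
      by (intro compact_imp_bounded compact_continuous_image) auto
    then show ?thesis by (auto simp: bounded_iff)
  qed
  have T_mem: "T1 p \<in> {-R..R}" "T2 p \<in> {-R..R}" for p
    using T1(1) T2(1) by (metis greaterThanLessThan_subseteq_atLeastAtMost_iff order_refl rangeI subset_iff)+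
  obtain M1 where M1: "\<And>p. \<bar>ln (f1 (T1 p))\<bar> \<le> M1" using bound[OF f1(1,2)] T_mem by blast
  obtain M2 where M2: "\<And>p. \<bar>ln (f2 (T2 p))\<bar> \<le> M2" using bound[OF f2(1,2)] T_mem by blast
  have int1: "integrable N (\<lambda>p. ln (f1 (T1 p)))" and int2: "integrable N (\<lambda>p. ln (f2 (T2 p)))"
    by (intro N.integrable_const_bound[of _ M1], use M1 in auto)
       (intro N.integrable_const_bound[of _ M2], use M2 in auto)
  have id0: "integrable N (\<lambda>q. q)" "(\<integral>q. q \<partial>N) = 0"
    unfolding N_def using std_normal_moment_odd[of 0]
    by (auto simp: integrable_density integral_density has_bochner_integral_iff)
  define M where "M = \<bar>ln \<epsilon>\<bar> + \<bar>ln B\<bar>"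
  have ln_g: "\<bar>ln (g x)\<bar> \<le> M" for x
  proof -
    have "ln \<epsilon> \<le> ln (g x)" "ln (g x) \<le> ln B"
      using g_bounds(1) g_bounds(2,3)[of x] g_pos[of x] by auto
    then show ?thesis by (simp add: M_def)
  qed
  have int_lng: "integrable (N \<Otimes>\<^sub>M N) (\<lambda>z. ln (g (X (fst z) (snd z))))"
    using ln_g by (intro NN.P.integrable_const_bound[of _ M]) (auto simp: X_def)
  \<comment> \<open>Integrating first in \<open>q\<close> removes the term \<open>a b p q\<close>, since \<open>q\<close> has mean zero.\<close>
  have "(\<integral>p. \<integral>q. ln (g (X p q)) \<partial>N \<partial>N) \<le> (\<integral>p. (\<integral>q. h p q \<partial>N) / c - 1 + ln c + a\<^sup>2 * ln (f1 (T1 p)) + b\<^sup>2 * (\<integral>q. ln (f2 (T2 q)) \<partial>N) \<partial>N)"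
  proof (rule integral_mono_AE)
    show "integrable N (\<lambda>p. \<integral>q. ln (g (X p q)) \<partial>N)"
      using NN.integrable_fst'[OF int_lng] by simp
    show "integrable N (\<lambda>p. (\<integral>q. h p q \<partial>N) / c - 1 + ln c + a\<^sup>2 * ln (f1 (T1 p)) + b\<^sup>2 * (\<integral>q. ln (f2 (T2 q)) \<partial>N))"
      using NN.integrable_fst'[OF int_h] int1 by (simp del: integral_density)
    have "AE p in N. integrable N (\<lambda>q. h p q)"
      using NN.AE_integrable_fst'[OF int_h] by simp
    then show "AE p in N. (\<integral>q. ln (g (X p q)) \<partial>N) \<le> (\<integral>q. h p q \<partial>N) / c - 1 + ln c + a\<^sup>2 * ln (f1 (T1 p)) + b\<^sup>2 * (\<integral>q. ln (f2 (T2 q)) \<partial>N)"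
    proof eventually_elim
      case (elim p)
      have "(\<integral>q. ln (g (X p q)) \<partial>N) \<le> (\<integral>q. h p q / c - 1 + ln c - a * b * p * q + a\<^sup>2 * ln (f1 (T1 p)) + b\<^sup>2 * ln (f2 (T2 q)) \<partial>N)"
      proof (rule integral_mono)
        show "integrable N (\<lambda>q. ln (g (X p q)))"
          using ln_g by (intro N.integrable_const_bound[of _ M]) (simp_all add: X_def)
        show "integrable N (\<lambda>q. h p q / c - 1 + ln c - a * b * p * q + a\<^sup>2 * ln (f1 (T1 p)) + b\<^sup>2 * ln (f2 (T2 q)))"
          by (intro Bochner_Integration.integrable_add Bochner_Integration.integrable_diff integrable_mult_right integrable_divide elim id0 int2 N.integrable_const)
      qed (rule key)
      also have "\<dots> = (\<integral>q. h p q \<partial>N) / c - 1 + ln c + a\<^sup>2 * ln (f1 (T1 p)) + b\<^sup>2 * (\<integral>q. ln (f2 (T2 q)) \<partial>N)"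
        using elim id0 int2 N.prob_space by simp
      finally show ?case .
    qed
  qed
  also have "\<dots> = (\<integral>p. \<integral>q. h p q \<partial>N \<partial>N) / c - 1 + ln c + a\<^sup>2 * (\<integral>p. ln (f1 (T1 p)) \<partial>N) + b\<^sup>2 * (\<integral>q. ln (f2 (T2 q)) \<partial>N)"
    using NN.integrable_fst'[OF int_h] int1 N.prob_space by simp
  also have "\<dots> \<le> ln c + a\<^sup>2 * (\<integral>p. ln (f1 (T1 p)) \<partial>N) + b\<^sup>2 * (\<integral>q. ln (f2 (T2 q)) \<partial>N)"
    using h_le' c_pos by simp
  finally have main: "(\<integral>p. \<integral>q. ln (g (X p q)) \<partial>N \<partial>N) \<le> ln c + a\<^sup>2 * (\<integral>p. ln (f1 (T1 p)) \<partial>N) + b\<^sup>2 * (\<integral>q. ln (f2 (T2 q)) \<partial>N)" .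

  note tr1 = gaussian_transport_integral[OF R f1(1,2) T1[unfolded \<gamma>_def], folded N_def]
  note tr2 = gaussian_transport_integral[OF R f2(1,2) T2[unfolded \<gamma>_def], folded N_def]
  have "(\<integral>x. \<integral>y. f1 x * f2 y * ln (g (a * x + b * y)) \<partial>cube_measure R \<partial>cube_measure R)
    = (\<integral>x. f1 x * (\<integral>y. f2 y * ln (g (a * x + b * y)) \<partial>cube_measure R) \<partial>cube_measure R)"
    by (simp add: mult.assoc)
  also have "\<dots> = (\<integral>x. f1 x * (\<integral>q. ln (g (a * x + b * T2 q)) \<partial>N) \<partial>cube_measure R)"
  proof -
    have "(\<integral>y. f2 y * ln (g (a * x + b * y)) \<partial>cube_measure R) = (\<integral>q. ln (g (a * x + b * T2 q)) \<partial>N)" for x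
      by (rule tr2[symmetric]) simp
    then show ?thesis by (simp only:)
  qed
  also have "\<dots> = (\<integral>p. \<integral>q. ln (g (X p q)) \<partial>N \<partial>N)"
    unfolding X_def by (rule tr1[symmetric]) simp
  finally have lhs: "(\<integral>x. \<integral>y. f1 x * f2 y * ln (g (a * x + b * y)) \<partial>cube_measure R \<partial>cube_measure R) = (\<integral>p. \<integral>q. ln (g (X p q)) \<partial>N \<partial>N)" .
  have ent1: "(\<integral>p. ln (f1 (T1 p)) \<partial>N) = (\<integral>x. f1 x * ln (f1 x) \<partial>cube_measure R)"
    by (rule tr1) simp
  have ent2: "(\<integral>p. ln (f2 (T2 p)) \<partial>N) = (\<integral>x. f2 x * ln (f2 x) \<partial>cube_measure R)"
    by (rule tr2) simp
  show ?thesis unfolding lhs using main unfolding ent1 ent2 c_def .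
qed

section \<open>Bounded measurable functions and their entropy\<close>

lemma abs_x_ln_x_le:
  fixes x :: real
  assumes "0 \<le> x"
  shows "\<bar>x * ln x\<bar> \<le> 1 + x\<^sup>2"
proof (cases "x = 0")
  case False
  then have x: "x > 0" using assms by simp
  have "ln (1 / x) \<le> 1 / x - 1" using x by (intro ln_le_minus_one) simp
  then have "x * ln (1 / x) \<le> x * (1 / x - 1)" using x by (intro mult_left_mono) auto
  then have 1: "- (x * ln x) \<le> 1 - x" using x by (simp add: ln_div algebra_simps)
  have "x * ln x \<le> x * (x - 1)" using x by (intro mult_left_mono ln_le_minus_one) auto
  then have 2: "x * ln x \<le> x\<^sup>2 - x" by (simp add: algebra_simps power2_eq_square)
  have "x\<^sup>2 \<ge> 0" by simp
  with 1 2 x show ?thesis unfolding abs_le_iff by linarith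
qed simp

lemma continuous_on_x_ln_x: "continuous_on {0..} (\<lambda>x::real. x * ln x)"
  unfolding continuous_on_def
proof safe
  fix x :: real assume "x \<ge> 0"
  show "((\<lambda>x. x * ln x) \<longlongrightarrow> x * ln x) (at x within {0..})"
  proof (cases "x = 0")
    case False
    then show ?thesis by (intro tendsto_intros) auto
  next
    case True
    \<comment> \<open>At \<open>0\<close>: \<open>x ln x = 2 \<surd>x (\<surd>x ln \<surd>x)\<close>, and the bracket is bounded near \<open>0\<close>.\<close>
    have "((\<lambda>x. 2 * sqrt x * (1 + x)) \<longlongrightarrow> 2 * sqrt 0 * (1 + 0)) (at 0 within {0..})"
      by (intro tendsto_intros)
    then have lim: "((\<lambda>x. 2 * sqrt x * (1 + x)) \<longlongrightarrow> 0) (at 0 within {0..})" by simp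
    have "\<forall>\<^sub>F y in at 0 within {0..}. norm (y * ln y) \<le> 2 * sqrt y * (1 + y)"
      unfolding eventually_at_filter
    proof (intro always_eventually allI impI)
      fix y :: real assume "y \<noteq> 0" "y \<in> {0..}"
      then have y: "y > 0" by simp
      have "y * ln y = 2 * sqrt y * (sqrt y * ln (sqrt y))"
        using y by (simp add: ln_sqrt mult.assoc[symmetric])
      also have "norm \<dots> = 2 * sqrt y * \<bar>sqrt y * ln (sqrt y)\<bar>"
        using y by (simp add: abs_mult)
      also have "\<dots> \<le> 2 * sqrt y * (1 + (sqrt y)\<^sup>2)"
        using y by (intro mult_left_mono abs_x_ln_x_le) auto
      finally show "norm (y * ln y) \<le> 2 * sqrt y * (1 + y)" using y by simp
    qed
    then have "((\<lambda>x::real. x * ln x) \<longlongrightarrow> 0) (at 0 within {0..})"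
      using lim by (rule Lim_null_comparison)
    then show ?thesis using True by simp
  qed
qed

lemma tendsto_x_ln_x:
  fixes u :: "nat \<Rightarrow> real"
  assumes "u \<longlonglongrightarrow> x" "\<And>n. u n \<ge> 0"
  shows "(\<lambda>n. u n * ln (u n)) \<longlonglongrightarrow> x * ln x"
proof -
  have "x \<ge> 0" using assms by (meson LIMSEQ_le_const)
  then show ?thesis
    using continuous_on_tendsto_compose[OF continuous_on_x_ln_x assms(1)] assms(2) by simp
qed

definition bounded_measurable :: "'a measure \<Rightarrow> ('a \<Rightarrow> real) \<Rightarrow> bool" where
  "bounded_measurable M f \<longleftrightarrow> f \<in> borel_measurable M \<and> (\<exists>B. \<forall>x\<in>space M. \<bar>f x\<bar> \<le> B)"

lemma bounded_measurableD [dest]: "bounded_measurable M f \<Longrightarrow> f \<in> borel_measurable M"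
  by (simp add: bounded_measurable_def)

lemma bounded_measurable_integrable:
  assumes "finite_measure M" "bounded_measurable M f"
  shows "integrable M f"
proof -
  interpret finite_measure M by fact
  obtain B where "\<And>x. x \<in> space M \<Longrightarrow> \<bar>f x\<bar> \<le> B" using assms(2) by (auto simp: bounded_measurable_def)
  then show ?thesis using assms(2) by (intro integrable_const_bound[of _ B]) auto
qed

lemma bounded_measurable_const: "bounded_measurable M (\<lambda>_. c)"
  by (auto simp: bounded_measurable_def)

lemma bounded_measurable_add:
  assumes "bounded_measurable M f" "bounded_measurable M g"
  shows "bounded_measurable M (\<lambda>x. f x + g x)"
proof -
  obtain A B where "\<And>x. x \<in> space M \<Longrightarrow> \<bar>f x\<bar> \<le> A" "\<And>x. x \<in> space M \<Longrightarrow> \<bar>g x\<bar> \<le> B"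
    using assms by (auto simp: bounded_measurable_def)
  then have "\<forall>x\<in>space M. \<bar>f x + g x\<bar> \<le> A + B" by (meson abs_triangle_ineq add_mono order_trans)
  then show ?thesis using assms unfolding bounded_measurable_def by auto
qed

lemma bounded_measurable_mult:
  assumes "bounded_measurable M f" "bounded_measurable M g"
  shows "bounded_measurable M (\<lambda>x. f x * g x)"
proof -
  obtain A B where "\<And>x. x \<in> space M \<Longrightarrow> \<bar>f x\<bar> \<le> A" "\<And>x. x \<in> space M \<Longrightarrow> \<bar>g x\<bar> \<le> B"
    using assms by (auto simp: bounded_measurable_def)
  then have "\<forall>x\<in>space M. \<bar>f x * g x\<bar> \<le> A * B" unfolding abs_mult by (meson abs_ge_zero mult_mono order_trans)
  then show ?thesis using assms unfolding bounded_measurable_def by auto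
qed

lemma bounded_measurable_diff:
  assumes "bounded_measurable M f" "bounded_measurable M g"
  shows "bounded_measurable M (\<lambda>x. f x - g x)"
  using bounded_measurable_add[OF assms(1) bounded_measurable_mult[OF bounded_measurable_const[of _ "-1"] assms(2)]]
  by simp

lemma bounded_measurable_x_ln_x:
  assumes "bounded_measurable M f" "\<And>x. x \<in> space M \<Longrightarrow> f x \<ge> 0"
  shows "bounded_measurable M (\<lambda>x. f x * ln (f x))"
proof -
  obtain B where B: "\<And>x. x \<in> space M \<Longrightarrow> \<bar>f x\<bar> \<le> B" using assms(1) by (auto simp: bounded_measurable_def)
  have "\<bar>f x * ln (f x)\<bar> \<le> 1 + B\<^sup>2" if "x \<in> space M" for x
    using abs_x_ln_x_le[OF assms(2)[OF that]] power_mono[OF B[OF that], of 2] by simp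
  then show ?thesis using assms(1) unfolding bounded_measurable_def by auto
qed

lemma bounded_measurable_ln:
  assumes "bounded_measurable M f" "\<epsilon> > 0" "\<And>x. x \<in> space M \<Longrightarrow> f x \<ge> \<epsilon>"
  shows "bounded_measurable M (\<lambda>x. ln (f x))"
proof -
  obtain B where B: "\<And>x. x \<in> space M \<Longrightarrow> \<bar>f x\<bar> \<le> B" using assms(1) by (auto simp: bounded_measurable_def)
  have "\<bar>ln (f x)\<bar> \<le> \<bar>ln \<epsilon>\<bar> + \<bar>ln B\<bar>" if "x \<in> space M" for x
  proof -
    have "ln \<epsilon> \<le> ln (f x)" "ln (f x) \<le> ln B"
      using assms(2) assms(3)[OF that] B[OF that] by auto
    then show ?thesis by simp
  qed
  then show ?thesis using assms(1) unfolding bounded_measurable_def by auto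
qed

lemma bounded_measurable_compose:
  assumes "bounded_measurable N f" "X \<in> measurable M N"
  shows "bounded_measurable M (\<lambda>x. f (X x))"
proof -
  obtain B where B: "\<And>x. x \<in> space N \<Longrightarrow> \<bar>f x\<bar> \<le> B" using assms(1) by (auto simp: bounded_measurable_def)
  have [measurable]: "f \<in> borel_measurable N" "X \<in> measurable M N" using assms by auto
  show ?thesis unfolding bounded_measurable_def
    using B measurable_space[OF assms(2)] by (intro conjI exI[of _ B]) auto
qed

lemma bounded_measurable_integral:
  assumes N: "finite_measure N" and f: "bounded_measurable (M \<Otimes>\<^sub>M N) (\<lambda>z. f (fst z) (snd z))"
  shows "bounded_measurable M (\<lambda>x. \<integral>y. f x y \<partial>N)"
proof -
  interpret N: finite_measure N by fact
  obtain B where B: "\<And>z. z \<in> space (M \<Otimes>\<^sub>M N) \<Longrightarrow> \<bar>f (fst z) (snd z)\<bar> \<le> B" using f by (auto simp: bounded_measurable_def)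
  have [measurable]: "(\<lambda>z. f (fst z) (snd z)) \<in> borel_measurable (M \<Otimes>\<^sub>M N)" using f by auto
  have 1: "(\<lambda>x. \<integral>y. f x y \<partial>N) \<in> borel_measurable M" by measurable
  have "\<bar>\<integral>y. f x y \<partial>N\<bar> \<le> \<bar>B\<bar> * measure N (space N)" if "x \<in> space M" for x
  proof -
    have "\<bar>\<integral>y. f x y \<partial>N\<bar> \<le> (\<integral>y. \<bar>B\<bar> \<partial>N)"
    proof (cases "integrable N (f x)")
      case True
      have "\<bar>\<integral>y. f x y \<partial>N\<bar> \<le> (\<integral>y. \<bar>f x y\<bar> \<partial>N)" by (rule integral_abs_bound)
      also have "\<dots> \<le> (\<integral>y. \<bar>B\<bar> \<partial>N)"
        using True that B by (intro integral_mono) (force simp: space_pair_measure)+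
      finally show ?thesis .
    qed (simp add: not_integrable_integral_eq)
    then show ?thesis by (simp add: mult.commute)
  qed
  with 1 show ?thesis unfolding bounded_measurable_def by blast
qed

text \<open>For a probability density this is the negative of the differential entropy. The second term makes
  the expression homogeneous of degree one, so that conditional densities can be replaced by the
  restrictions of \<open>f\<close> to the fibres, without dividing by their masses.\<close>

definition functional_entropy :: "'a measure \<Rightarrow> ('a \<Rightarrow> real) \<Rightarrow> real" where
  "functional_entropy M f = (\<integral>x. f x * ln (f x) \<partial>M) - (\<integral>x. f x \<partial>M) * ln (\<integral>x. f x \<partial>M)"

text \<open>If \<open>f1\<close> and \<open>f2\<close> are the densities of independent \<open>X\<close> and \<open>Y\<close>, then formally, for \<open>g\<close> equal to the
  density of \<open>L X Y\<close> this is the linear form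
  \<open>h (L X Y) \<ge> a\<^sup>2 h(X) + b\<^sup>2 h(Y)\<close> of the entropy power inequality. An
  arbitrary \<open>g\<close> is needed for the inequality to be applied on fibres: the restriction of the density of
  a sum to a fibre is not the density of a sum of fibres. The positive lower bound on \<open>g\<close> keeps \<open>ln g\<close> bounded.\<close>

definition entropy_inequality :: "'a measure \<Rightarrow> 'b measure \<Rightarrow> ('a \<Rightarrow> 'a \<Rightarrow> 'b) \<Rightarrow> real \<Rightarrow> real \<Rightarrow> bool" where
  "entropy_inequality M N L a b \<longleftrightarrow> (\<forall>f1 f2 g \<epsilon>.
     bounded_measurable M f1 \<longrightarrow> (\<forall>x\<in>space M. 0 \<le> f1 x) \<longrightarrow>
     bounded_measurable M f2 \<longrightarrow> (\<forall>x\<in>space M. 0 \<le> f2 x) \<longrightarrow>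
     bounded_measurable N g \<longrightarrow> 0 < \<epsilon> \<longrightarrow> (\<forall>z\<in>space N. \<epsilon> \<le> g z) \<longrightarrow>
     (\<integral>x. \<integral>y. f1 x * f2 y * ln (g (L x y)) \<partial>M \<partial>M)
       \<le> (\<integral>x. f1 x \<partial>M) * (\<integral>x. f2 x \<partial>M) * ln (\<integral>z. g z \<partial>N)
         + a\<^sup>2 * (\<integral>x. f2 x \<partial>M) * functional_entropy M f1
         + b\<^sup>2 * (\<integral>x. f1 x \<partial>M) * functional_entropy M f2)"

lemma entropy_inequalityD:
  assumes "entropy_inequality M N L a b"
    and "bounded_measurable M f1" "\<And>x. x \<in> space M \<Longrightarrow> 0 \<le> f1 x"
    and "bounded_measurable M f2" "\<And>x. x \<in> space M \<Longrightarrow> 0 \<le> f2 x"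
    and "bounded_measurable N g" "0 < \<epsilon>" "\<And>z. z \<in> space N \<Longrightarrow> \<epsilon> \<le> g z"
  shows "(\<integral>x. \<integral>y. f1 x * f2 y * ln (g (L x y)) \<partial>M \<partial>M)
       \<le> (\<integral>x. f1 x \<partial>M) * (\<integral>x. f2 x \<partial>M) * ln (\<integral>z. g z \<partial>N)
         + a\<^sup>2 * (\<integral>x. f2 x \<partial>M) * functional_entropy M f1
         + b\<^sup>2 * (\<integral>x. f1 x \<partial>M) * functional_entropy M f2"
  using assms unfolding entropy_inequality_def by blast

section \<open>From continuous to measurable densities on the line\<close>

text \<open>A Lebesgue measurable function is almost everywhere a limit of continuous functions. Truncating the
  approximants to \<open>[1 / (n + 1), B + 1]\<close> keeps the limit and makes them positive and bounded.\<close>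

lemma positive_continuous_approximation:
  fixes f :: "'a::euclidean_space \<Rightarrow> real"
  assumes f: "f \<in> borel_measurable borel" "\<And>x. 0 \<le> f x" "\<And>x. f x \<le> B"
  obtains F where "\<And>n::nat. continuous_on UNIV (F n)" "\<And>n x. 0 < F n x" "\<And>n x. F n x \<le> B + 1"
    "AE x in lborel. (\<lambda>n. F n x) \<longlonglongrightarrow> f x"
proof -
  have B: "B \<ge> 0" using f(2,3) order_trans by blast
  have "f \<in> borel_measurable lebesgue" using f(1) by (simp add: measurable_completion)
  then have "f measurable_on UNIV"
    using f(2) by (rule lebesgue_measurable_imp_measurable_on_nnreal_UNIV)
  then obtain Z G where Z: "negligible Z" and G: "\<And>n::nat. continuous_on UNIV (G n)"
    and lim: "\<And>x. x \<notin> Z \<Longrightarrow> (\<lambda>n. G n x) \<longlonglongrightarrow> f x"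
    unfolding measurable_on_def by auto
  define F where "F n x = max (inverse (real (Suc n))) (min (B + 1) (G n x))" for n x
  show thesis
  proof
    show "continuous_on UNIV (F n)" for n
      unfolding F_def[abs_def] by (intro continuous_intros G)
    show "0 < F n x" for n x by (simp add: F_def less_max_iff_disj)
    have "inverse (real (Suc n)) \<le> 1" for n by (simp add: field_simps)
    then have "inverse (real (Suc n)) \<le> B + 1" for n using B by (metis add_increasing)
    then show "F n x \<le> B + 1" for n x unfolding F_def by (intro max.boundedI min.cobounded1)
    have "AE x in lebesgue. x \<notin> Z"
      using Z by (simp add: AE_not_in negligible_iff_null_sets)
    then have "AE x in lborel. x \<notin> Z" by (simp add: AE_completion_iff)
    then show "AE x in lborel. (\<lambda>n. F n x) \<longlonglongrightarrow> f x"
    proof eventually_elim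
      case (elim x)
      have "(\<lambda>n. F n x) \<longlonglongrightarrow> max 0 (min (B + 1) (f x))"
        unfolding F_def by (intro tendsto_intros lim LIMSEQ_inverse_real_of_nat elim)
      moreover have "max 0 (min (B + 1) (f x)) = f x" using f(2,3)[of x] by (auto simp: max_def min_def)
      ultimately show ?case by simp
    qed
  qed
qed

lemma measurable_cube_measure: "measurable (cube_measure R) N = measurable borel N"
  by (rule measurable_cong_sets) auto

lemma cube_measure_integral_pos:
  fixes f :: "'a::euclidean_space \<Rightarrow> real"
  assumes R: "R > 0" and f: "integrable (cube_measure R) f" "\<And>x. f x > 0"
  shows "(\<integral>x. f x \<partial>cube_measure R) > 0"
proof -
  have "emeasure lborel (cube R :: 'a set) \<noteq> 0"
  proof -
    have "0 < (\<Prod>b\<in>Basis. (R *\<^sub>R One + R *\<^sub>R One) \<bullet> (b::'a))"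
      using R by (intro prod_pos) (simp add: inner_simps)
    then show ?thesis
      unfolding cube_def emeasure_lborel_cbox_eq using R by (auto simp: inner_simps)
  qed
  then have "emeasure (cube_measure R) (UNIV :: 'a set) \<noteq> 0" by (simp add: emeasure_cube_measure_space)
  moreover have "{x \<in> space (cube_measure R). f x \<noteq> 0} = (UNIV :: 'a set)" using f(2) by (auto simp: less_imp_neq[symmetric])
  ultimately have "\<not> (AE x in cube_measure R. f x = 0)"
    using f by (subst AE_iff_measurable[OF _ refl]) (auto simp: less_imp_neq[symmetric])
  then have "(\<integral>x. f x \<partial>cube_measure R) \<noteq> 0"
    using integral_nonneg_eq_0_iff_AE[OF f(1)] f(2) by (simp add: less_imp_le)
  moreover have "(\<integral>x. f x \<partial>cube_measure R) \<ge> 0" using f(2) by (intro Bochner_Integration.integral_nonneg) (simp add: less_imp_le)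
  ultimately show ?thesis by simp
qed

text \<open>Both sides are homogeneous of degree one in each of \<open>f1\<close> and \<open>f2\<close>, so this follows by dividing
  each function by its integral.\<close>

lemma entropy_inequality_1d_continuous_unnormalized:
  fixes f1 f2 g :: "real \<Rightarrow> real"
  assumes R: "R > 0" and ab: "a\<^sup>2 + b\<^sup>2 = 1" "b \<noteq> 0"
    and f1: "continuous_on UNIV f1" "\<And>x. f1 x > 0" "\<And>x. f1 x \<le> B1"
    and f2: "continuous_on UNIV f2" "\<And>x. f2 x > 0" "\<And>x. f2 x \<le> B2"
    and g: "bounded_measurable borel g" "\<epsilon> > 0" "\<And>x. \<epsilon> \<le> g x"
  shows "(\<integral>x. \<integral>y. f1 x * f2 y * ln (g (a * x + b * y)) \<partial>cube_measure R \<partial>cube_measure R)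
       \<le> (\<integral>x. f1 x \<partial>cube_measure R) * (\<integral>x. f2 x \<partial>cube_measure R) * ln (\<integral>z. g z \<partial>cube_measure (2 * R))
         + a\<^sup>2 * (\<integral>x. f2 x \<partial>cube_measure R) * functional_entropy (cube_measure R) f1
         + b\<^sup>2 * (\<integral>x. f1 x \<partial>cube_measure R) * functional_entropy (cube_measure R) f2"
proof -
  let ?Q = "cube_measure R :: real measure"
  note fin = finite_cube_measure[of R]
  define m where "m f = (\<integral>x. f x \<partial>?Q)" for f :: "real \<Rightarrow> real"
  define E where "E f = (\<integral>x. f x * ln (f x) \<partial>?Q)" for f :: "real \<Rightarrow> real"
  have bm: "bounded_measurable ?Q f" if "continuous_on UNIV f" "\<And>x. f x > 0" "\<And>x. f x \<le> B" for f B
    using that(1) that(2,3) unfolding bounded_measurable_def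
    by (intro conjI exI[of _ B]) (auto simp: measurable_cube_measure borel_measurable_continuous_onI abs_of_pos)
  have normalized: "(\<integral>x. f x / m f * ln (f x / m f) \<partial>?Q) = E f / m f - ln (m f)" "m f > 0" "(\<integral>x. f x / m f \<partial>?Q) = 1"
    if f: "continuous_on UNIV f" "\<And>x. f x > 0" "\<And>x. f x \<le> B" for f B
  proof -
    note b = bm[OF f]
    have i1: "integrable ?Q f" using bounded_measurable_integrable[OF fin b] .
    have i2: "integrable ?Q (\<lambda>x. f x * ln (f x))"
      using f by (intro bounded_measurable_integrable[OF fin] bounded_measurable_x_ln_x b) (simp add: less_imp_le)
    show m: "m f > 0" unfolding m_def using R i1 f(2) by (rule cube_measure_integral_pos)
    have "f x / m f * ln (f x / m f) = (f x * ln (f x)) / m f - f x * (ln (m f) / m f)" for x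
      using m f(2)[of x] by (simp add: ln_div field_simps)
    then have "(\<integral>x. f x / m f * ln (f x / m f) \<partial>?Q) = (\<integral>x. (f x * ln (f x)) / m f - f x * (ln (m f) / m f) \<partial>?Q)"
      by simp
    also have "\<dots> = E f / m f - m f * (ln (m f) / m f)"
      using i1 i2 by (simp add: E_def m_def)
    finally show "(\<integral>x. f x / m f * ln (f x / m f) \<partial>?Q) = E f / m f - ln (m f)" using m by simp
    show "(\<integral>x. f x / m f \<partial>?Q) = 1" using m by (simp add: m_def)
  qed
  note n1 = normalized[OF f1] and n2 = normalized[OF f2]
  obtain B where B: "\<And>x. g x \<le> B" using g(1) by (auto simp: bounded_measurable_def abs_le_iff)
  have "(\<integral>x. \<integral>y. f1 x / m f1 * (f2 y / m f2) * ln (g (a * x + b * y)) \<partial>?Q \<partial>?Q)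
    \<le> ln (\<integral>z. g z \<partial>cube_measure (2 * R)) + a\<^sup>2 * (E f1 / m f1 - ln (m f1)) + b\<^sup>2 * (E f2 / m f2 - ln (m f2))"
    unfolding n1(1)[symmetric] n2(1)[symmetric]
    by (rule entropy_inequality_1d_continuous[OF R ab _ _ n1(3) _ _ n2(3) _ g(2,3) B])
       (use n1(2) n2(2) f1 f2 g(1) in \<open>auto intro!: continuous_intros\<close>)
  also have "(\<integral>x. \<integral>y. f1 x / m f1 * (f2 y / m f2) * ln (g (a * x + b * y)) \<partial>?Q \<partial>?Q)
     = (\<integral>x. \<integral>y. f1 x * f2 y * ln (g (a * x + b * y)) \<partial>?Q \<partial>?Q) / (m f1 * m f2)"
  proof -
    have "f1 x / m f1 * (f2 y / m f2) * ln (g (a * x + b * y)) = f1 x * f2 y * ln (g (a * x + b * y)) / (m f1 * m f2)" for x y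
      by simp
    then show ?thesis by (simp del: times_divide_eq_left times_divide_eq_right)
  qed
  finally have "(\<integral>x. \<integral>y. f1 x * f2 y * ln (g (a * x + b * y)) \<partial>?Q \<partial>?Q)
    \<le> (ln (\<integral>z. g z \<partial>cube_measure (2 * R)) + a\<^sup>2 * (E f1 / m f1 - ln (m f1)) + b\<^sup>2 * (E f2 / m f2 - ln (m f2))) * (m f1 * m f2)"
    using n1(2) n2(2) by (simp add: pos_divide_le_eq)
  also have "\<dots> = m f1 * m f2 * ln (\<integral>z. g z \<partial>cube_measure (2 * R)) + a\<^sup>2 * m f2 * (E f1 - m f1 * ln (m f1)) + b\<^sup>2 * m f1 * (E f2 - m f2 * ln (m f2))"
    using n1(2) n2(2) by (simp add: field_simps)
  finally show ?thesis by (simp add: m_def E_def functional_entropy_def)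
qed

text \<open>Every term is continuous under bounded almost everywhere convergence of \<open>f1\<close> and \<open>f2\<close>, because
  \<open>x ln x\<close> is continuous up to \<open>x = 0\<close> and \<open>ln g\<close> is bounded.\<close>

proposition entropy_inequality_1d:
  assumes R: "R > 0" and ab: "a\<^sup>2 + b\<^sup>2 = 1" "b \<noteq> 0"
  shows "entropy_inequality (cube_measure R :: real measure) (cube_measure (2 * R)) (\<lambda>x y. a * x + b * y) a b"
  unfolding entropy_inequality_def
proof (intro allI impI)
  let ?Q = "cube_measure R :: real measure"
  fix f1 f2 g :: "real \<Rightarrow> real" and \<epsilon> :: real
  assume f1: "bounded_measurable ?Q f1" "\<forall>x\<in>space ?Q. 0 \<le> f1 x"
    and f2: "bounded_measurable ?Q f2" "\<forall>x\<in>space ?Q. 0 \<le> f2 x"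
    and g: "bounded_measurable (cube_measure (2 * R)) g" "0 < \<epsilon>" "\<forall>z\<in>space (cube_measure (2 * R)). \<epsilon> \<le> g z"
  interpret Q: finite_measure ?Q by (rule finite_cube_measure)
  have bm: "bounded_measurable borel f \<longleftrightarrow> bounded_measurable (cube_measure r) f" for r and f :: "real \<Rightarrow> real"
    by (simp add: bounded_measurable_def measurable_cube_measure)
  have AEQ: "AE x in ?Q. P x" if "AE x in lborel. P x" for P
    using that unfolding cube_measure_def by (subst AE_density) (auto intro: AE_mp)
  obtain B1 where B1: "\<And>x. f1 x \<le> B1" using f1(1) by (auto simp: bounded_measurable_def abs_le_iff)
  obtain B2 where B2: "\<And>x. f2 x \<le> B2" using f2(1) by (auto simp: bounded_measurable_def abs_le_iff)
  have [measurable]: "f1 \<in> borel_measurable borel" "f2 \<in> borel_measurable borel" "g \<in> borel_measurable borel"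
    using f1(1) f2(1) g(1) by (auto simp: bounded_measurable_def)
  have nn: "0 \<le> f1 x" "0 \<le> f2 x" for x using f1(2) f2(2) by auto
  obtain F1 where F1: "\<And>n::nat. continuous_on UNIV (F1 n)" "\<And>n x. 0 < F1 n x" "\<And>n x. F1 n x \<le> B1 + 1"
    and F1_lim: "AE x in lborel. (\<lambda>n. F1 n x) \<longlonglongrightarrow> f1 x"
    using positive_continuous_approximation[of f1 B1] nn B1 by auto
  obtain F2 where F2: "\<And>n::nat. continuous_on UNIV (F2 n)" "\<And>n x. 0 < F2 n x" "\<And>n x. F2 n x \<le> B2 + 1"
    and F2_lim: "AE x in lborel. (\<lambda>n. F2 n x) \<longlonglongrightarrow> f2 x"
    using positive_continuous_approximation[of f2 B2] nn B2 by auto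
  have [measurable]: "F1 n \<in> borel_measurable borel" "F2 n \<in> borel_measurable borel" for n
    using F1(1) F2(1) by (auto intro: borel_measurable_continuous_onI)
  have lim: "(\<lambda>n. \<integral>x. F n x \<partial>?Q) \<longlonglongrightarrow> (\<integral>x. f x \<partial>?Q)"
      "(\<lambda>n. functional_entropy ?Q (F n)) \<longlonglongrightarrow> functional_entropy ?Q f"
    if [measurable]: "\<And>n. F n \<in> borel_measurable borel" "f \<in> borel_measurable borel"
      and F: "\<And>n x. 0 < F n x" "\<And>n x. F n x \<le> B + 1" "AE x in lborel. (\<lambda>n. F n x) \<longlonglongrightarrow> f x" for F :: "nat \<Rightarrow> real \<Rightarrow> real" and f B
  proof -
    have F_abs: "\<bar>F n x\<bar> \<le> B + 1" for n x using F(1)[of n x] F(2)[of n x] by simp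
    show l1: "(\<lambda>n. \<integral>x. F n x \<partial>?Q) \<longlonglongrightarrow> (\<integral>x. f x \<partial>?Q)"
      by (rule integral_dominated_convergence[where w="\<lambda>_. B + 1"]) (use AEQ[OF F(3)] F_abs in auto)
    have "\<bar>F n x * ln (F n x)\<bar> \<le> 1 + (B + 1)\<^sup>2" for n x
      using abs_x_ln_x_le[of "F n x"] F(1)[of n x] power_mono[OF F_abs[of n x], of 2] by (simp add: less_imp_le)
    moreover have "AE x in ?Q. (\<lambda>n. F n x * ln (F n x)) \<longlonglongrightarrow> f x * ln (f x)"
      using AEQ[OF F(3)] by eventually_elim (intro tendsto_x_ln_x, use F(1) in \<open>auto intro: less_imp_le\<close>)
    ultimately have l2: "(\<lambda>n. \<integral>x. F n x * ln (F n x) \<partial>?Q) \<longlonglongrightarrow> (\<integral>x. f x * ln (f x) \<partial>?Q)"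
      by (intro integral_dominated_convergence[where w="\<lambda>_. 1 + (B + 1)\<^sup>2"]) auto
    show "(\<lambda>n. functional_entropy ?Q (F n)) \<longlonglongrightarrow> functional_entropy ?Q f"
      unfolding functional_entropy_def
      by (intro tendsto_diff l2 tendsto_x_ln_x l1 Bochner_Integration.integral_nonneg) (use F(1) in \<open>auto intro: less_imp_le\<close>)
  qed
  note lim1 = lim[OF _ _ F1(2,3) F1_lim] and lim2 = lim[OF _ _ F2(2,3) F2_lim]
  have "bounded_measurable (cube_measure (2 * R)) (\<lambda>x. ln (g x))"
    using g by (intro bounded_measurable_ln) auto
  then obtain M where M: "\<And>x. \<bar>ln (g x)\<bar> \<le> M" by (auto simp: bounded_measurable_def)
  define K where "K n x = (\<integral>y. F2 n y * ln (g (a * x + b * y)) \<partial>?Q)" for n x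
  define k where "k x = (\<integral>y. f2 y * ln (g (a * x + b * y)) \<partial>?Q)" for x
  have F2M: "\<bar>F2 n y * ln (g z)\<bar> \<le> (B2 + 1) * M" for n y z
    unfolding abs_mult using F2(2)[of n y] F2(3)[of n y] M[of z] by (intro mult_mono) auto
  have K_lim: "(\<lambda>n. K n x) \<longlonglongrightarrow> k x" for x
    unfolding K_def k_def
  proof (rule integral_dominated_convergence[where w="\<lambda>_. (B2 + 1) * M"])
    show "AE y in ?Q. (\<lambda>n. F2 n y * ln (g (a * x + b * y))) \<longlonglongrightarrow> f2 y * ln (g (a * x + b * y))"
      using AEQ[OF F2_lim] by eventually_elim (intro tendsto_intros)
    show "AE y in ?Q. norm (F2 n y * ln (g (a * x + b * y))) \<le> (B2 + 1) * M" for n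
      using F2M by simp
  qed auto
  have K_bound: "\<bar>K n x\<bar> \<le> (B2 + 1) * M * measure ?Q UNIV" for n x
  proof -
    have "\<bar>K n x\<bar> \<le> (\<integral>y. \<bar>F2 n y * ln (g (a * x + b * y))\<bar> \<partial>?Q)"
      unfolding K_def by (rule integral_abs_bound)
    also have "\<dots> \<le> (\<integral>y. (B2 + 1) * M \<partial>?Q)"
    proof (rule integral_mono)
      show "integrable ?Q (\<lambda>y. \<bar>F2 n y * ln (g (a * x + b * y))\<bar>)"
        using F2M by (intro Q.integrable_const_bound[of _ "(B2 + 1) * M"]) auto
    qed (use F2M in auto)
    finally show ?thesis by (simp add: mult_ac)
  qed
  have [measurable]: "K n \<in> borel_measurable borel" "k \<in> borel_measurable borel" for n
    unfolding K_def[abs_def] k_def[abs_def] by measurable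
  have "(\<lambda>n. \<integral>x. F1 n x * K n x \<partial>?Q) \<longlonglongrightarrow> (\<integral>x. f1 x * k x \<partial>?Q)"
  proof (rule integral_dominated_convergence[where w="\<lambda>_. (B1 + 1) * ((B2 + 1) * M * measure ?Q UNIV)"])
    show "AE x in ?Q. (\<lambda>n. F1 n x * K n x) \<longlonglongrightarrow> f1 x * k x"
      using AEQ[OF F1_lim] by eventually_elim (intro tendsto_intros K_lim)
    show "AE x in ?Q. norm (F1 n x * K n x) \<le> (B1 + 1) * ((B2 + 1) * M * measure ?Q UNIV)" for n
      using F1(2)[of n] F1(3)[of n] K_bound[of n] unfolding real_norm_def abs_mult
      by (intro AE_I2 mult_mono) (auto simp: less_imp_le intro: order_trans[OF less_imp_le])
  qed auto
  then have lhs: "(\<lambda>n. \<integral>x. \<integral>y. F1 n x * F2 n y * ln (g (a * x + b * y)) \<partial>?Q \<partial>?Q) \<longlonglongrightarrow> (\<integral>x. \<integral>y. f1 x * f2 y * ln (g (a * x + b * y)) \<partial>?Q \<partial>?Q)"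
    by (simp add: K_def k_def mult.assoc)
  show "(\<integral>x. \<integral>y. f1 x * f2 y * ln (g (a * x + b * y)) \<partial>?Q \<partial>?Q)
       \<le> (\<integral>x. f1 x \<partial>?Q) * (\<integral>x. f2 x \<partial>?Q) * ln (\<integral>z. g z \<partial>cube_measure (2 * R))
         + a\<^sup>2 * (\<integral>x. f2 x \<partial>?Q) * functional_entropy ?Q f1
         + b\<^sup>2 * (\<integral>x. f1 x \<partial>?Q) * functional_entropy ?Q f2"
  proof (rule LIMSEQ_le[OF lhs])
    show "(\<lambda>n. (\<integral>x. F1 n x \<partial>?Q) * (\<integral>x. F2 n x \<partial>?Q) * ln (\<integral>z. g z \<partial>cube_measure (2 * R))
         + a\<^sup>2 * (\<integral>x. F2 n x \<partial>?Q) * functional_entropy ?Q (F1 n)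
         + b\<^sup>2 * (\<integral>x. F1 n x \<partial>?Q) * functional_entropy ?Q (F2 n))
      \<longlonglongrightarrow> (\<integral>x. f1 x \<partial>?Q) * (\<integral>x. f2 x \<partial>?Q) * ln (\<integral>z. g z \<partial>cube_measure (2 * R))
         + a\<^sup>2 * (\<integral>x. f2 x \<partial>?Q) * functional_entropy ?Q f1
         + b\<^sup>2 * (\<integral>x. f1 x \<partial>?Q) * functional_entropy ?Q f2"
      by (intro tendsto_intros lim1 lim2) auto
  qed (use entropy_inequality_1d_continuous_unnormalized[OF R ab F1 F2] g bm in auto)
qed

section \<open>Tensorization\<close>

lemma bounded_measurable_fst: "bounded_measurable M f \<Longrightarrow> bounded_measurable (M \<Otimes>\<^sub>M N) (\<lambda>z. f (fst z))"
  by (erule bounded_measurable_compose) simp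

lemma bounded_measurable_snd: "bounded_measurable N f \<Longrightarrow> bounded_measurable (M \<Otimes>\<^sub>M N) (\<lambda>z. f (snd z))"
  by (erule bounded_measurable_compose) simp

lemma bounded_measurable_section:
  assumes "bounded_measurable (M \<Otimes>\<^sub>M N) f" "x \<in> space M"
  shows "bounded_measurable N (\<lambda>y. f (x, y))"
  using assms(1) by (rule bounded_measurable_compose) (use assms(2) in simp)

lemma bounded_measurable_Fubini:
  assumes M: "finite_measure M" and N: "finite_measure N"
    and f: "bounded_measurable (M \<Otimes>\<^sub>M N) f"
  shows "(\<integral>z. f z \<partial>(M \<Otimes>\<^sub>M N)) = (\<integral>x. \<integral>y. f (x, y) \<partial>N \<partial>M)"
    and "(\<integral>y. \<integral>x. f (x, y) \<partial>M \<partial>N) = (\<integral>x. \<integral>y. f (x, y) \<partial>N \<partial>M)"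
proof -
  interpret M: finite_measure M by fact
  interpret N: finite_measure N by fact
  interpret P: pair_sigma_finite M N ..
  have "integrable (M \<Otimes>\<^sub>M N) f"
    by (rule bounded_measurable_integrable[OF finite_measure_pair_measure f]) fact+
  then show "(\<integral>z. f z \<partial>(M \<Otimes>\<^sub>M N)) = (\<integral>x. \<integral>y. f (x, y) \<partial>N \<partial>M)"
    and "(\<integral>y. \<integral>x. f (x, y) \<partial>M \<partial>N) = (\<integral>x. \<integral>y. f (x, y) \<partial>N \<partial>M)"
    using P.integral_fst'[of f] P.Fubini_integral[of "\<lambda>x y. f (x, y)"] by auto
qed

text \<open>This is the chain rule for entropy. For fixed first coordinates \<open>v\<close>, \<open>v'\<close> the inequality on the
  second factor applies to the fibres of \<open>f1\<close>, \<open>f2\<close> and \<open>g\<close>. Its right-hand side involves the fibre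
  integrals \<open>F1\<close>, \<open>F2\<close> and \<open>G\<close>, to which the inequality on the first factor applies. The terms
  \<open>\<integral> F1 ln F1\<close> and \<open>\<integral> F2 ln F2\<close> then occur once with each sign and cancel.\<close>

proposition entropy_inequality_pair:
  assumes fin: "finite_measure M1" "finite_measure M2" "finite_measure N1" "finite_measure N2"
    and N2: "emeasure N2 (space N2) \<noteq> 0"
    and L1 [measurable]: "(\<lambda>z. L1 (fst z) (snd z)) \<in> M1 \<Otimes>\<^sub>M M1 \<rightarrow>\<^sub>M N1"
    and L2 [measurable]: "(\<lambda>z. L2 (fst z) (snd z)) \<in> M2 \<Otimes>\<^sub>M M2 \<rightarrow>\<^sub>M N2"
    and E1: "entropy_inequality M1 N1 L1 a b" and E2: "entropy_inequality M2 N2 L2 a b"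
  shows "entropy_inequality (M1 \<Otimes>\<^sub>M M2) (N1 \<Otimes>\<^sub>M N2) (\<lambda>x y. (L1 (fst x) (fst y), L2 (snd x) (snd y))) a b"
  unfolding entropy_inequality_def
proof (intro allI impI)
  fix f1 f2 g and \<epsilon> :: real
  let ?M = "M1 \<Otimes>\<^sub>M M2" and ?N = "N1 \<Otimes>\<^sub>M N2"
  assume f1: "bounded_measurable ?M f1" "\<forall>x\<in>space ?M. 0 \<le> f1 x"
    and f2: "bounded_measurable ?M f2" "\<forall>x\<in>space ?M. 0 \<le> f2 x"
    and g: "bounded_measurable ?N g" "0 < \<epsilon>" "\<forall>z\<in>space ?N. \<epsilon> \<le> g z"
  interpret N2: finite_measure N2 by fact
  interpret M1: finite_measure M1 by fact
  interpret M2: finite_measure M2 by fact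
  have finM: "finite_measure ?M" using fin by (intro finite_measure_pair_measure)
  have [measurable]: "f1 \<in> borel_measurable ?M" "f2 \<in> borel_measurable ?M" "g \<in> borel_measurable ?N"
    using f1 f2 g by auto
  define F1 where "F1 v = (\<integral>y. f1 (v, y) \<partial>M2)" for v
  define F2 where "F2 v = (\<integral>y. f2 (v, y) \<partial>M2)" for v
  define G where "G V = (\<integral>Y. g (V, Y) \<partial>N2)" for V
  define e1 where "e1 v = (\<integral>y. f1 (v, y) * ln (f1 (v, y)) \<partial>M2)" for v
  define e2 where "e2 v = (\<integral>y. f2 (v, y) * ln (f2 (v, y)) \<partial>M2)" for v
  define m1 where "m1 = (\<integral>x. f1 x \<partial>?M)"
  define m2 where "m2 = (\<integral>x. f2 x \<partial>?M)"
  have nn: "0 \<le> f1 (v, y)" "0 \<le> f2 (v, y)" if "v \<in> space M1" "y \<in> space M2" for v y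
    using f1(2) f2(2) that by (auto simp: space_pair_measure)
  have gpos: "\<epsilon> \<le> g (V, Y)" if "V \<in> space N1" "Y \<in> space N2" for V Y
    using g(3) that by (auto simp: space_pair_measure)
  have L1s: "L1 v v' \<in> space N1" if "v \<in> space M1" "v' \<in> space M1" for v v'
    using measurable_space[OF L1, of "(v, v')"] that by (simp add: space_pair_measure)
  have bF1: "bounded_measurable M1 F1" and bF2: "bounded_measurable M1 F2"
    unfolding F1_def[abs_def] F2_def[abs_def] using f1(1) f2(1) fin by (auto intro!: bounded_measurable_integral)
  have bG: "bounded_measurable N1 G"
    unfolding G_def[abs_def] using g(1) fin by (auto intro!: bounded_measurable_integral)
  have bxl1: "bounded_measurable ?M (\<lambda>x. f1 x * ln (f1 x))" and bxl2: "bounded_measurable ?M (\<lambda>x. f2 x * ln (f2 x))"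
    using f1 f2 by (auto intro!: bounded_measurable_x_ln_x)
  have be1: "bounded_measurable M1 e1" and be2: "bounded_measurable M1 e2"
    unfolding e1_def[abs_def] e2_def[abs_def] using bxl1 bxl2 fin by (auto intro!: bounded_measurable_integral)
  have F_nn: "0 \<le> F1 v" "0 \<le> F2 v" if "v \<in> space M1" for v
    unfolding F1_def F2_def using nn that by (auto intro!: Bochner_Integration.integral_nonneg)
  define \<delta> where "\<delta> = \<epsilon> * measure N2 (space N2)"
  have \<delta>: "\<delta> > 0" using N2 g(2) by (simp add: \<delta>_def measure_def enn2real_positive_iff less_top[symmetric] zero_less_iff_neq_zero)
  have G_ge: "\<delta> \<le> G V" if "V \<in> space N1" for V
  proof -
    have "\<delta> = (\<integral>Y. \<epsilon> \<partial>N2)" by (simp add: \<delta>_def)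
    also have "\<dots> \<le> G V"
      unfolding G_def using that gpos
      by (intro integral_mono bounded_measurable_integrable[OF fin(4)] bounded_measurable_section[OF g(1)] bounded_measurable_const) auto
    finally show ?thesis .
  qed
  have m1: "m1 = (\<integral>v. F1 v \<partial>M1)" and m2: "m2 = (\<integral>v. F2 v \<partial>M1)"
    unfolding m1_def m2_def F1_def F2_def using f1(1) f2(1) fin by (auto intro!: bounded_measurable_Fubini(1))
  have ent1: "functional_entropy ?M f1 = (\<integral>v. e1 v \<partial>M1) - m1 * ln m1" and ent2: "functional_entropy ?M f2 = (\<integral>v. e2 v \<partial>M1) - m2 * ln m2"
    unfolding functional_entropy_def m1_def m2_def e1_def e2_def
    using bounded_measurable_Fubini(1)[OF fin(1,2) bxl1] bounded_measurable_Fubini(1)[OF fin(1,2) bxl2] by simp_all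
  have bxF1: "bounded_measurable M1 (\<lambda>v. F1 v * ln (F1 v))" and bxF2: "bounded_measurable M1 (\<lambda>v. F2 v * ln (F2 v))"
    using bF1 bF2 F_nn by (auto intro!: bounded_measurable_x_ln_x)
  define d1 where "d1 v = e1 v - F1 v * ln (F1 v)" for v
  define d2 where "d2 v = e2 v - F2 v * ln (F2 v)" for v
  have bd1: "bounded_measurable M1 d1" and bd2: "bounded_measurable M1 d2"
    unfolding d1_def[abs_def] d2_def[abs_def] by (intro bounded_measurable_diff be1 be2 bxF1 bxF2)+
  have int_d: "(\<integral>v. d1 v \<partial>M1) = (\<integral>v. e1 v \<partial>M1) - (\<integral>v. F1 v * ln (F1 v) \<partial>M1)"
      "(\<integral>v. d2 v \<partial>M1) = (\<integral>v. e2 v \<partial>M1) - (\<integral>v. F2 v * ln (F2 v) \<partial>M1)"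
    unfolding d1_def d2_def
    by (intro Bochner_Integration.integral_diff bounded_measurable_integrable[OF fin(1)] be1 be2 bxF1 bxF2)+

  define \<Psi> where "\<Psi> v v' = (\<integral>y. \<integral>y'. f1 (v, y) * f2 (v', y') * ln (g (L1 v v', L2 y y')) \<partial>M2 \<partial>M2)" for v v'
  have inner: "\<Psi> v v' \<le> F1 v * F2 v' * ln (G (L1 v v'))
      + a\<^sup>2 * (F2 v' * d1 v) + b\<^sup>2 * (F1 v * d2 v')"
    if v: "v \<in> space M1" "v' \<in> space M1" for v v'
  proof -
    have "\<Psi> v v' \<le> (\<integral>y. f1 (v, y) \<partial>M2) * (\<integral>y. f2 (v', y) \<partial>M2) * ln (\<integral>Y. g (L1 v v', Y) \<partial>N2)
         + a\<^sup>2 * (\<integral>y. f2 (v', y) \<partial>M2) * functional_entropy M2 (\<lambda>y. f1 (v, y))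
         + b\<^sup>2 * (\<integral>y. f1 (v, y) \<partial>M2) * functional_entropy M2 (\<lambda>y. f2 (v', y))"
      unfolding \<Psi>_def
      by (rule entropy_inequalityD[OF E2]) (use v f1(1) f2(1) g(1,2) nn gpos L1s in \<open>auto intro: bounded_measurable_section\<close>)
    then show ?thesis
      by (simp add: F1_def F2_def G_def functional_entropy_def d1_def d2_def e1_def e2_def mult.assoc)
  qed
  have bL: "bounded_measurable (?M \<Otimes>\<^sub>M ?M) (\<lambda>z. f1 (fst z) * f2 (snd z) * ln (g (L1 (fst (fst z)) (fst (snd z)), L2 (snd (fst z)) (snd (snd z)))))"
  proof (intro bounded_measurable_mult bounded_measurable_fst bounded_measurable_snd f1(1) f2(1))
    show "bounded_measurable (?M \<Otimes>\<^sub>M ?M) (\<lambda>z. ln (g (L1 (fst (fst z)) (fst (snd z)), L2 (snd (fst z)) (snd (snd z)))))"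
    proof (rule bounded_measurable_compose[of ?N "\<lambda>w. ln (g w)"])
      show "bounded_measurable ?N (\<lambda>w. ln (g w))" using g by (intro bounded_measurable_ln[OF g(1,2)]) auto
      show "(\<lambda>z. (L1 (fst (fst z)) (fst (snd z)), L2 (snd (fst z)) (snd (snd z)))) \<in> ?M \<Otimes>\<^sub>M ?M \<rightarrow>\<^sub>M ?N"
      proof (rule measurable_Pair)
        show "(\<lambda>z. L1 (fst (fst z)) (fst (snd z))) \<in> ?M \<Otimes>\<^sub>M ?M \<rightarrow>\<^sub>M N1"
          using measurable_compose[of "\<lambda>z. (fst (fst z), fst (snd z))" "?M \<Otimes>\<^sub>M ?M", OF _ L1] by simp
        show "(\<lambda>z. L2 (snd (fst z)) (snd (snd z))) \<in> ?M \<Otimes>\<^sub>M ?M \<rightarrow>\<^sub>M N2"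
          using measurable_compose[of "\<lambda>z. (snd (fst z), snd (snd z))" "?M \<Otimes>\<^sub>M ?M", OF _ L2] by simp
      qed
    qed
  qed
  define \<Phi> where "\<Phi> v y v' y' = f1 (v, y) * f2 (v', y') * ln (g (L1 v v', L2 y y'))" for v y v' y'
  have b\<Phi>: "bounded_measurable P (\<lambda>z. \<Phi> (A z) (B z) (C z) (D z))"
    if "A \<in> P \<rightarrow>\<^sub>M M1" "B \<in> P \<rightarrow>\<^sub>M M2" "C \<in> P \<rightarrow>\<^sub>M M1" "D \<in> P \<rightarrow>\<^sub>M M2" for P :: "'x measure" and A B C D
    using bounded_measurable_compose[OF bL, of "\<lambda>z. ((A z, B z), (C z, D z))" P] that by (simp add: \<Phi>_def)
  have b\<Phi>': "bounded_measurable P (\<lambda>z. \<integral>y'. \<Phi> (A z) (B z) (C z) y' \<partial>M2)"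
    if [measurable]: "A \<in> P \<rightarrow>\<^sub>M M1" "B \<in> P \<rightarrow>\<^sub>M M2" "C \<in> P \<rightarrow>\<^sub>M M1" for P :: "'y measure" and A B C
    by (rule bounded_measurable_integral[OF fin(2)]) (rule b\<Phi>; measurable)
  have b\<Psi>: "bounded_measurable (M1 \<Otimes>\<^sub>M M1) (\<lambda>z. \<Psi> (fst z) (snd z))"
    unfolding \<Psi>_def \<Phi>_def[symmetric]
    by (rule bounded_measurable_integral[OF fin(2)]) (rule b\<Phi>'; measurable)
  have bFG: "bounded_measurable (M1 \<Otimes>\<^sub>M M1) (\<lambda>z. F1 (fst z) * F2 (snd z) * ln (G (L1 (fst z) (snd z))))"
    by (intro bounded_measurable_mult bounded_measurable_fst[OF bF1] bounded_measurable_snd[OF bF2]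
        bounded_measurable_compose[OF bounded_measurable_ln[OF bG \<delta> G_ge] L1])
  have br: "bounded_measurable (M1 \<Otimes>\<^sub>M M1) (\<lambda>z. F1 (fst z) * F2 (snd z) * ln (G (L1 (fst z) (snd z)))
      + a\<^sup>2 * (F2 (snd z) * d1 (fst z)) + b\<^sup>2 * (F1 (fst z) * d2 (snd z)))"
    by (intro bounded_measurable_add[OF bounded_measurable_add[OF bFG]] bounded_measurable_mult bounded_measurable_const
        bounded_measurable_fst[OF bF1] bounded_measurable_snd[OF bF2] bounded_measurable_fst[OF bd1] bounded_measurable_snd[OF bd2])

  have "(\<integral>x. \<integral>y. f1 x * f2 y * ln (g (L1 (fst x) (fst y), L2 (snd x) (snd y))) \<partial>?M \<partial>?M)
     = (\<integral>v. \<integral>y. \<integral>x'. f1 (v, y) * f2 x' * ln (g (L1 v (fst x'), L2 y (snd x'))) \<partial>?M \<partial>M2 \<partial>M1)"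
    using bounded_measurable_Fubini(1)[OF fin(1,2) bounded_measurable_integral[OF finM bL]] by simp
  also have "\<dots> = (\<integral>v. \<integral>y. \<integral>v'. \<integral>y'. \<Phi> v y v' y' \<partial>M2 \<partial>M1 \<partial>M2 \<partial>M1)"
  proof (intro Bochner_Integration.integral_cong refl)
    fix v y assume vy: "v \<in> space M1" "y \<in> space M2"
    have "bounded_measurable ?M (\<lambda>x'. \<Phi> v y (fst x') (snd x'))"
      by (rule b\<Phi>) (use vy in auto)
    from bounded_measurable_Fubini(1)[OF fin(1,2) this]
    show "(\<integral>x'. f1 (v, y) * f2 x' * ln (g (L1 v (fst x'), L2 y (snd x'))) \<partial>?M) = (\<integral>v'. \<integral>y'. \<Phi> v y v' y' \<partial>M2 \<partial>M1)"
      by (simp add: \<Phi>_def)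
  qed
  also have "\<dots> = (\<integral>v. \<integral>v'. \<Psi> v v' \<partial>M1 \<partial>M1)"
  proof (intro Bochner_Integration.integral_cong refl)
    fix v assume v: "v \<in> space M1"
    have "bounded_measurable (M1 \<Otimes>\<^sub>M M2) (\<lambda>z. \<integral>y'. \<Phi> v (snd z) (fst z) y' \<partial>M2)"
      by (rule b\<Phi>') (use v in auto)
    from bounded_measurable_Fubini(2)[OF fin(1,2) this]
    show "(\<integral>y. \<integral>v'. \<integral>y'. \<Phi> v y v' y' \<partial>M2 \<partial>M1 \<partial>M2) = (\<integral>v'. \<Psi> v v' \<partial>M1)"
      by (simp add: \<Phi>_def \<Psi>_def)
  qed
  also have "\<dots> \<le> (\<integral>v. \<integral>v'. F1 v * F2 v' * ln (G (L1 v v'))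
      + a\<^sup>2 * (F2 v' * d1 v) + b\<^sup>2 * (F1 v * d2 v') \<partial>M1 \<partial>M1)"
    (is "_ \<le> (\<integral>v. \<integral>v'. ?r v v' \<partial>M1 \<partial>M1)")
    using b\<Psi> br
    by (intro integral_mono inner bounded_measurable_integrable[OF fin(1)] bounded_measurable_integral[OF fin(1)])
       (auto dest: bounded_measurable_section)
  also have "\<dots> = (\<integral>v. (\<integral>v'. F1 v * F2 v' * ln (G (L1 v v')) \<partial>M1)
      + a\<^sup>2 * (m2 * d1 v) + b\<^sup>2 * (F1 v * (\<integral>v'. d2 v' \<partial>M1)) \<partial>M1)"
  proof (intro Bochner_Integration.integral_cong refl)
    fix v assume v: "v \<in> space M1"
    have "integrable M1 (\<lambda>v'. F1 v * F2 v' * ln (G (L1 v v')))"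
      using bounded_measurable_section[OF bFG v] by (intro bounded_measurable_integrable[OF fin(1)]) simp
    then show "(\<integral>v'. ?r v v' \<partial>M1) = (\<integral>v'. F1 v * F2 v' * ln (G (L1 v v')) \<partial>M1)
      + a\<^sup>2 * (m2 * d1 v) + b\<^sup>2 * (F1 v * (\<integral>v'. d2 v' \<partial>M1))"
      using bounded_measurable_integrable[OF fin(1) bF2] bounded_measurable_integrable[OF fin(1) bd2]
      by (simp add: m2)
  qed
  also have "\<dots> = (\<integral>v. \<integral>v'. F1 v * F2 v' * ln (G (L1 v v')) \<partial>M1 \<partial>M1)
      + a\<^sup>2 * (m2 * (\<integral>v. d1 v \<partial>M1)) + b\<^sup>2 * (m1 * (\<integral>v'. d2 v' \<partial>M1))"
    using bounded_measurable_integrable[OF fin(1) bF1] bounded_measurable_integrable[OF fin(1) bd1]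
      bounded_measurable_integrable[OF fin(1) bounded_measurable_integral[OF fin(1) bFG]]
    by (simp add: m1)
  also have "(\<integral>v. \<integral>v'. F1 v * F2 v' * ln (G (L1 v v')) \<partial>M1 \<partial>M1)
     \<le> m1 * m2 * ln (\<integral>V. G V \<partial>N1) + a\<^sup>2 * m2 * functional_entropy M1 F1 + b\<^sup>2 * m1 * functional_entropy M1 F2"
    unfolding m1 m2 by (rule entropy_inequalityD[OF E1 bF1 _ bF2 _ bG \<delta>]) (use F_nn G_ge in auto)
  also have "(\<integral>V. G V \<partial>N1) = (\<integral>z. g z \<partial>?N)"
    unfolding G_def using bounded_measurable_Fubini(1)[OF fin(3,4) g(1)] by simp
  finally have "(\<integral>x. \<integral>y. f1 x * f2 y * ln (g (L1 (fst x) (fst y), L2 (snd x) (snd y))) \<partial>?M \<partial>?M)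
    \<le> m1 * m2 * ln (\<integral>z. g z \<partial>?N) + a\<^sup>2 * m2 * functional_entropy ?M f1 + b\<^sup>2 * m1 * functional_entropy ?M f2"
    unfolding ent1 ent2 int_d unfolding functional_entropy_def m1[symmetric] m2[symmetric] by (simp add: algebra_simps)
  then show "(\<integral>x. \<integral>y. f1 x * f2 y * ln (g (L1 (fst x) (fst y), L2 (snd x) (snd y))) \<partial>?M \<partial>?M)
       \<le> (\<integral>x. f1 x \<partial>?M) * (\<integral>x. f2 x \<partial>?M) * ln (\<integral>z. g z \<partial>?N)
         + a\<^sup>2 * (\<integral>x. f2 x \<partial>?M) * functional_entropy ?M f1 + b\<^sup>2 * (\<integral>x. f1 x \<partial>?M) * functional_entropy ?M f2"
    by (simp add: m1_def m2_def)
qed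

section \<open>The entropy inequality in Euclidean space\<close>

lemma functional_entropy_distr:
  assumes [measurable]: "X \<in> M \<rightarrow>\<^sub>M M'" "f \<in> borel_measurable M'"
  shows "functional_entropy (distr M M' X) f = functional_entropy M (\<lambda>x. f (X x))"
  by (simp add: functional_entropy_def integral_distr)

lemma entropy_inequality_distr:
  assumes M: "finite_measure M" and X [measurable]: "X \<in> M \<rightarrow>\<^sub>M M'" and Y [measurable]: "Y \<in> N \<rightarrow>\<^sub>M N'"
    and L' [measurable]: "(\<lambda>z. L' (fst z) (snd z)) \<in> M' \<Otimes>\<^sub>M M' \<rightarrow>\<^sub>M N'"
    and L: "\<And>x y. x \<in> space M \<Longrightarrow> y \<in> space M \<Longrightarrow> L' (X x) (X y) = Y (L x y)"
    and E: "entropy_inequality M N L a b"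
  shows "entropy_inequality (distr M M' X) (distr N N' Y) L' a b"
  unfolding entropy_inequality_def
proof (intro allI impI)
  fix f1 f2 g and \<epsilon> :: real
  let ?M = "distr M M' X" and ?N = "distr N N' Y"
  assume f1: "bounded_measurable ?M f1" "\<forall>x\<in>space ?M. 0 \<le> f1 x"
    and f2: "bounded_measurable ?M f2" "\<forall>x\<in>space ?M. 0 \<le> f2 x"
    and g: "bounded_measurable ?N g" "0 < \<epsilon>" "\<forall>z\<in>space ?N. \<epsilon> \<le> g z"
  interpret finite_measure M by fact
  have bm: "bounded_measurable M (\<lambda>x. f (X x))" if "bounded_measurable ?M f" for f
    using that by (rule bounded_measurable_compose) simp
  have bn: "bounded_measurable N (\<lambda>x. f (Y x))" if "bounded_measurable ?N f" for f
    using that by (rule bounded_measurable_compose) simp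
  have [measurable]: "f1 \<in> borel_measurable M'" "f2 \<in> borel_measurable M'" "g \<in> borel_measurable N'"
    using f1(1) f2(1) g(1) by (auto simp: bounded_measurable_def)
  have sX: "X x \<in> space M'" if "x \<in> space M" for x using measurable_space[OF X that] .
  have sY: "Y x \<in> space N'" if "x \<in> space N" for x using measurable_space[OF Y that] .
  have "(\<integral>x. \<integral>y. f1 x * f2 y * ln (g (L' x y)) \<partial>?M \<partial>?M) = (\<integral>x. \<integral>y. f1 x * f2 (X y) * ln (g (L' x (X y))) \<partial>M \<partial>?M)"
  proof (intro Bochner_Integration.integral_cong refl integral_distr X)
    fix x assume "x \<in> space ?M"
    then have [measurable]: "(\<lambda>y. L' x y) \<in> M' \<rightarrow>\<^sub>M N'"
      using measurable_compose[of "\<lambda>y. (x, y)" M' "M' \<Otimes>\<^sub>M M'", OF _ L'] by simp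
    show "(\<lambda>y. f1 x * f2 y * ln (g (L' x y))) \<in> borel_measurable M'" by measurable
  qed
  also have "\<dots> = (\<integral>x. \<integral>y. f1 (X x) * f2 (X y) * ln (g (L' (X x) (X y))) \<partial>M \<partial>M)"
  proof (rule integral_distr[OF X])
    have [measurable]: "(\<lambda>z. L' (fst z) (X (snd z))) \<in> M' \<Otimes>\<^sub>M M \<rightarrow>\<^sub>M N'"
      using measurable_compose[of "\<lambda>z. (fst z, X (snd z))" "M' \<Otimes>\<^sub>M M" "M' \<Otimes>\<^sub>M M'", OF _ L'] by simp
    show "(\<lambda>x. \<integral>y. f1 x * f2 (X y) * ln (g (L' x (X y))) \<partial>M) \<in> borel_measurable M'"
      by (rule borel_measurable_lebesgue_integral) (simp add: case_prod_beta')
  qed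
  also have "\<dots> = (\<integral>x. \<integral>y. f1 (X x) * f2 (X y) * ln (g (Y (L x y))) \<partial>M \<partial>M)"
    using L by (intro Bochner_Integration.integral_cong refl) auto
  also have "\<dots> \<le> (\<integral>x. f1 (X x) \<partial>M) * (\<integral>x. f2 (X x) \<partial>M) * ln (\<integral>z. g (Y z) \<partial>N)
         + a\<^sup>2 * (\<integral>x. f2 (X x) \<partial>M) * functional_entropy M (\<lambda>x. f1 (X x))
         + b\<^sup>2 * (\<integral>x. f1 (X x) \<partial>M) * functional_entropy M (\<lambda>x. f2 (X x))"
    by (rule entropy_inequalityD[OF E bm[OF f1(1)] _ bm[OF f2(1)] _ bn[OF g(1)] g(2)])
       (use f1(2) f2(2) g(3) sX sY in auto)
  finally show "(\<integral>x. \<integral>y. f1 x * f2 y * ln (g (L' x y)) \<partial>?M \<partial>?M)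
       \<le> (\<integral>x. f1 x \<partial>?M) * (\<integral>x. f2 x \<partial>?M) * ln (\<integral>z. g z \<partial>?N)
         + a\<^sup>2 * (\<integral>x. f2 x \<partial>?M) * functional_entropy ?M f1 + b\<^sup>2 * (\<integral>x. f1 x \<partial>?M) * functional_entropy ?M f2"
    by (simp add: functional_entropy_distr integral_distr)
qed

lemma (in product_sigma_finite) distr_PiM_insert:
  assumes I: "finite I" "i \<notin> I"
  shows "distr (PiM I M \<Otimes>\<^sub>M M i) (PiM (insert i I) M) (\<lambda>z. (fst z)(i := snd z)) = PiM (insert i I) M"
proof (rule measure_eqI)
  have upd [measurable]: "(\<lambda>z. (fst z)(i := snd z)) \<in> PiM I M \<Otimes>\<^sub>M M i \<rightarrow>\<^sub>M PiM (insert i I) M"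
    using measurable_add_dim[of i I M] by (simp add: case_prod_beta')
  fix A assume "A \<in> sets (distr (PiM I M \<Otimes>\<^sub>M M i) (PiM (insert i I) M) (\<lambda>z. (fst z)(i := snd z)))"
  then have [measurable]: "A \<in> sets (PiM (insert i I) M)" by simp
  have "emeasure (PiM (insert i I) M) A = (\<integral>\<^sup>+x. indicator A x \<partial>PiM (insert i I) M)" by simp
  also have "\<dots> = (\<integral>\<^sup>+x. \<integral>\<^sup>+y. indicator A (x(i := y)) \<partial>M i \<partial>PiM I M)"
    by (rule product_nn_integral_insert[OF I]) simp
  also have "\<dots> = (\<integral>\<^sup>+z. indicator A ((fst z)(i := snd z)) \<partial>(PiM I M \<Otimes>\<^sub>M M i))"
    by (subst sigma_finite_measure.nn_integral_fst[OF sigma_finite_measures, symmetric]) auto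
  also have "\<dots> = (\<integral>\<^sup>+x. indicator A x \<partial>distr (PiM I M \<Otimes>\<^sub>M M i) (PiM (insert i I) M) (\<lambda>z. (fst z)(i := snd z)))"
    by (subst nn_integral_distr) auto
  finally show "emeasure (distr (PiM I M \<Otimes>\<^sub>M M i) (PiM (insert i I) M) (\<lambda>z. (fst z)(i := snd z))) A = emeasure (PiM (insert i I) M) A"
    by simp
qed simp

text \<open>On a space with a single point both entropies vanish and the inequality is an equality.\<close>

lemma entropy_inequality_singleton_space:
  assumes "a\<^sup>2 + b\<^sup>2 = 1"
  shows "entropy_inequality (PiM {} Q) (PiM {} Q') (\<lambda>x y. \<lambda>i\<in>{}. L i x y) a b"
  unfolding entropy_inequality_def PiM_empty functional_entropy_def
  by (simp add: lebesgue_integral_count_space_finite)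

lemma finite_measure_PiM_cube:
  assumes "finite I"
  shows "finite_measure (PiM I (\<lambda>_. cube_measure R :: real measure))"
proof -
  interpret Q: finite_measure "cube_measure R :: real measure" by (rule finite_cube_measure)
  interpret product_sigma_finite "\<lambda>_. cube_measure R :: real measure" by standard
  show ?thesis
    by standard (use assms in \<open>simp add: space_PiM emeasure_PiM ennreal_prod_eq_top power_eq_top_ennreal Q.emeasure_finite[simplified]\<close>)
qed

lemma entropy_inequality_PiM:
  assumes R: "R > 0" and ab: "a\<^sup>2 + b\<^sup>2 = 1" "b \<noteq> 0" and I: "finite I"
  shows "entropy_inequality (PiM I (\<lambda>_. cube_measure R :: real measure)) (PiM I (\<lambda>_. cube_measure (2 * R)))
    (\<lambda>x y. \<lambda>i\<in>I. a * x i + b * y i) a b"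
  using I
proof induction
  case empty
  show ?case by (rule entropy_inequality_singleton_space[OF ab(1)])
next
  case (insert i I)
  let ?Q = "cube_measure R :: real measure" and ?Q' = "cube_measure (2 * R) :: real measure"
  interpret Q: finite_measure ?Q by (rule finite_cube_measure)
  interpret Q': finite_measure ?Q' by (rule finite_cube_measure)
  interpret P: product_sigma_finite "\<lambda>_. ?Q" by standard
  interpret P': product_sigma_finite "\<lambda>_. ?Q'" by standard
  have "emeasure ?Q' (space ?Q') \<noteq> 0" using R by (simp add: emeasure_cube_measure_space cube_real)
  then have "entropy_inequality (PiM I (\<lambda>_. ?Q) \<Otimes>\<^sub>M ?Q) (PiM I (\<lambda>_. ?Q') \<Otimes>\<^sub>M ?Q')
     (\<lambda>x y. ((\<lambda>i\<in>I. a * fst x i + b * fst y i), a * snd x + b * snd y)) a b"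
    by (intro entropy_inequality_pair[OF _ _ _ _ _ _ _ insert.IH entropy_inequality_1d[OF R ab]] finite_measure_PiM_cube insert.hyps
          Q.finite_measure_axioms Q'.finite_measure_axioms) measurable
  then have "entropy_inequality (distr (PiM I (\<lambda>_. ?Q) \<Otimes>\<^sub>M ?Q) (PiM (insert i I) (\<lambda>_. ?Q)) (\<lambda>z. (fst z)(i := snd z)))
     (distr (PiM I (\<lambda>_. ?Q') \<Otimes>\<^sub>M ?Q') (PiM (insert i I) (\<lambda>_. ?Q')) (\<lambda>z. (fst z)(i := snd z)))
     (\<lambda>x y. \<lambda>i\<in>insert i I. a * x i + b * y i) a b"
  proof (rule entropy_inequality_distr[rotated -1])
    show "finite_measure (PiM I (\<lambda>_. ?Q) \<Otimes>\<^sub>M ?Q)"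
      by (intro finite_measure_pair_measure finite_measure_PiM_cube insert.hyps Q.finite_measure_axioms)
    show "(\<lambda>z. (fst z)(i := snd z)) \<in> PiM I (\<lambda>_. ?Q) \<Otimes>\<^sub>M ?Q \<rightarrow>\<^sub>M PiM (insert i I) (\<lambda>_. ?Q)"
      using measurable_add_dim[of i I "\<lambda>_. ?Q"] by (simp add: case_prod_beta')
    show "(\<lambda>z. (fst z)(i := snd z)) \<in> PiM I (\<lambda>_. ?Q') \<Otimes>\<^sub>M ?Q' \<rightarrow>\<^sub>M PiM (insert i I) (\<lambda>_. ?Q')"
      using measurable_add_dim[of i I "\<lambda>_. ?Q'"] by (simp add: case_prod_beta')
    show "(\<lambda>z. \<lambda>i\<in>insert i I. a * fst z i + b * snd z i)
      \<in> PiM (insert i I) (\<lambda>_. ?Q) \<Otimes>\<^sub>M PiM (insert i I) (\<lambda>_. ?Q) \<rightarrow>\<^sub>M PiM (insert i I) (\<lambda>_. ?Q')"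
      by measurable
  qed (use insert.hyps in \<open>auto simp: fun_eq_iff restrict_def\<close>)
  then show ?case
    unfolding P.distr_PiM_insert[OF insert.hyps] P'.distr_PiM_insert[OF insert.hyps] .
qed

lemma prod_indicator:
  assumes "finite I"
  shows "(\<Prod>i\<in>I. indicator (A i) (x i) :: ennreal) = (if \<forall>i\<in>I. x i \<in> A i then 1 else 0)"
  using assms by induction auto

lemma cube_measure_eq_distr_PiM:
  "(cube_measure R :: 'a::euclidean_space measure)
    = distr (PiM Basis (\<lambda>_. cube_measure R)) borel (\<lambda>f. \<Sum>b\<in>Basis. f b *\<^sub>R b)"
proof -
  let ?P = "PiM (Basis :: 'a set) (\<lambda>_. lborel :: real measure)"
  let ?s = "\<lambda>f. \<Sum>b\<in>Basis. f b *\<^sub>R (b :: 'a)"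
  interpret Q: finite_measure "cube_measure R :: real measure" by (rule finite_cube_measure)
  interpret PQ: product_sigma_finite "\<lambda>_::'a. cube_measure R :: real measure" by standard
  interpret P: product_sigma_finite "\<lambda>_::'a. lborel :: real measure" by standard
  have "density ?P (\<lambda>f. indicator (cube R) (?s f)) = PiM Basis (\<lambda>_. cube_measure R)"
  proof (rule PQ.PiM_eqI)
    show "sets (density ?P (\<lambda>f. indicator (cube R) (?s f))) = sets (PiM Basis (\<lambda>_. cube_measure R))"
      by (simp cong: sets_PiM_cong)
    fix A :: "'a \<Rightarrow> real set" assume A: "\<And>b. b \<in> Basis \<Longrightarrow> A b \<in> sets (cube_measure R)"
    then have [measurable]: "b \<in> Basis \<Longrightarrow> A b \<in> sets borel" for b by simp
    have "emeasure (density ?P (\<lambda>f. indicator (cube R) (?s f))) (Pi\<^sub>E Basis A)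
      = (\<integral>\<^sup>+f. indicator (cube R) (?s f) * indicator (Pi\<^sub>E Basis A) f \<partial>?P)"
      by (rule emeasure_density) (auto intro!: sets_PiM_I_finite)
    also have "\<dots> = (\<integral>\<^sup>+f. (\<Prod>b\<in>Basis. indicator (cube R \<inter> A b) (f b)) \<partial>?P)"
    proof (rule nn_integral_cong)
      fix f assume "f \<in> space ?P"
      then have "f \<in> extensional Basis" by (auto simp: space_PiM PiE_def)
      then show "indicator (cube R) (?s f) * indicator (Pi\<^sub>E Basis A) f = (\<Prod>b\<in>Basis. indicator (cube R \<inter> A b) (f b) :: ennreal)"
        by (auto simp: prod_indicator mem_cube PiE_iff indicator_def)
    qed
    also have "\<dots> = (\<Prod>b\<in>Basis. \<integral>\<^sup>+x. indicator (cube R \<inter> A b) x \<partial>lborel)"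
      by (rule P.product_nn_integral_prod) auto
    also have "\<dots> = (\<Prod>b\<in>Basis. emeasure (cube_measure R) (A b))"
      by (intro prod.cong refl)
         (auto simp: cube_measure_def emeasure_density indicator_inter_arith[symmetric])
    finally show "emeasure (density ?P (\<lambda>f. indicator (cube R) (?s f))) (Pi\<^sub>E Basis A) = (\<Prod>b\<in>Basis. emeasure (cube_measure R) (A b))" .
  qed simp
  then show ?thesis
    unfolding cube_measure_def[where 'a='a] by (subst lborel_eq) (subst density_distr, auto)
qed

proposition entropy_inequality_euclidean:
  assumes R: "R > 0" and ab: "a\<^sup>2 + b\<^sup>2 = 1" "b \<noteq> 0"
  shows "entropy_inequality (cube_measure R :: 'a::euclidean_space measure) (cube_measure (2 * R)) (\<lambda>x y. a *\<^sub>R x + b *\<^sub>R y) a b"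
  unfolding cube_measure_eq_distr_PiM[where 'a='a]
proof (rule entropy_inequality_distr[OF _ _ _ _ _ entropy_inequality_PiM[OF R ab finite_Basis]])
  show "finite_measure (PiM (Basis::'a set) (\<lambda>_. cube_measure R :: real measure))"
    by (rule finite_measure_PiM_cube) simp
qed (auto simp: scaleR_sum_right sum.distrib[symmetric] algebra_simps)

section \<open>Weighted sums of independent vectors of nonnegative entropy\<close>

text \<open>Boundedness and the support in a cube keep all integrals finite; both persist under the linear
  combinations considered below, with a larger bound and a larger cube.\<close>

definition nonneg_entropy_density :: "real \<Rightarrow> ('a::euclidean_space \<Rightarrow> real) \<Rightarrow> bool" where
  "nonneg_entropy_density R f \<longleftrightarrow> bounded_measurable borel f \<and> (\<forall>x. 0 \<le> f x) \<and> (\<forall>x. x \<notin> cube R \<longrightarrow> f x = 0)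
     \<and> (\<integral>\<^sup>+x. ennreal (f x) \<partial>lborel) = 1 \<and> (\<integral>x. f x * ln (f x) \<partial>lborel) \<le> 0"

lemma cube_mono: "R \<le> R' \<Longrightarrow> cube R \<subseteq> cube R'"
  by (auto simp: mem_cube) (meson order_trans)

lemma nonneg_entropy_density_mono:
  "nonneg_entropy_density R f \<Longrightarrow> R \<le> R' \<Longrightarrow> nonneg_entropy_density R' f"
  unfolding nonneg_entropy_density_def using cube_mono by blast

lemma bounded_measurable_cube_measure: "bounded_measurable (cube_measure R) f \<longleftrightarrow> bounded_measurable borel f"
  by (simp add: bounded_measurable_def measurable_cube_measure)

lemma integral_cube_measure_eq_lborel:
  fixes h :: "'a::euclidean_space \<Rightarrow> real"
  assumes "h \<in> borel_measurable borel" "\<And>x. x \<notin> cube R \<Longrightarrow> h x = 0"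
  shows "(\<integral>x. h x \<partial>cube_measure R) = (\<integral>x. h x \<partial>lborel)"
  using assms by (subst integral_cube_measure) (auto intro!: Bochner_Integration.integral_cong simp: indicator_def)

lemma integrable_lborel_of_cube:
  fixes h :: "'a::euclidean_space \<Rightarrow> real"
  assumes h: "bounded_measurable borel h" "\<And>x. x \<notin> cube R \<Longrightarrow> h x = 0"
  shows "integrable lborel h"
proof -
  have [measurable]: "h \<in> borel_measurable borel" using h by auto
  have "integrable (cube_measure R) h"
    using h by (intro bounded_measurable_integrable finite_cube_measure) (simp add: bounded_measurable_cube_measure)
  then have "integrable lborel (\<lambda>x. indicator (cube R) x *\<^sub>R h x)"
    unfolding cube_measure_def ennreal_indicator[symmetric] by (subst (asm) integrable_density) auto
  moreover have "(\<lambda>x. indicator (cube R) x *\<^sub>R h x) = h" using h(2) by (auto simp: fun_eq_iff indicator_def)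
  ultimately show ?thesis by simp
qed

lemma nonneg_entropy_density_integral:
  fixes f :: "'a::euclidean_space \<Rightarrow> real"
  assumes "nonneg_entropy_density R f"
  shows "integrable lborel f" "(\<integral>x. f x \<partial>lborel) = 1"
proof -
  show i: "integrable lborel f" using assms integrable_lborel_of_cube unfolding nonneg_entropy_density_def by blast
  show "(\<integral>x. f x \<partial>lborel) = 1"
    using nn_integral_eq_integral[OF i] assms by (simp add: nonneg_entropy_density_def)
qed

lemma nn_integral_affine:
  fixes c :: real and t :: "'a::euclidean_space"
  assumes [measurable]: "f \<in> borel_measurable borel" and c: "c \<noteq> 0"
  shows "(\<integral>\<^sup>+x. f x \<partial>lborel) = ennreal (\<bar>c\<bar> ^ DIM('a)) * (\<integral>\<^sup>+x. f (t + c *\<^sub>R x) \<partial>lborel)"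
  by (subst lborel_affine[OF c, of t]) (simp add: nn_integral_density nn_integral_distr nn_integral_cmult)

text \<open>The density is the convolution \<open>z \<mapsto> |b|\<^sup>-\<^sup>n \<integral> f1(x) f2((z - a x) / b) dx\<close>. It is bounded by
  \<open>|b|\<^sup>-\<^sup>n sup f2\<close>.\<close>

lemma density_of_linear_combination:
  fixes f1 f2 :: "'a::euclidean_space \<Rightarrow> real"
  assumes f1: "bounded_measurable borel f1" "\<And>x. 0 \<le> f1 x" "\<And>x. x \<notin> cube R \<Longrightarrow> f1 x = 0" "(\<integral>\<^sup>+x. ennreal (f1 x) \<partial>lborel) = 1"
    and f2: "bounded_measurable borel f2" "\<And>x. 0 \<le> f2 x" "\<And>x. x \<notin> cube R \<Longrightarrow> f2 x = 0"
    and ab: "\<bar>a\<bar> \<le> 1" "\<bar>b\<bar> \<le> 1" "b \<noteq> 0"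
  obtains f where "bounded_measurable borel f" "\<And>x. 0 \<le> f x" "\<And>x. x \<notin> cube (2 * R) \<Longrightarrow> f x = 0"
    "\<And>\<phi>. \<phi> \<in> borel_measurable borel \<Longrightarrow>
      (\<integral>\<^sup>+x. \<integral>\<^sup>+y. ennreal (f1 x) * ennreal (f2 y) * \<phi> (a *\<^sub>R x + b *\<^sub>R y) \<partial>lborel \<partial>lborel) = (\<integral>\<^sup>+z. ennreal (f z) * \<phi> z \<partial>lborel)"
proof -
  have [measurable]: "f1 \<in> borel_measurable borel" "f2 \<in> borel_measurable borel" using f1(1) f2(1) by auto
  obtain B where B: "\<And>x. f2 x \<le> B" using f2(1) by (auto simp: bounded_measurable_def abs_le_iff)
  have B0: "B \<ge> 0" using B f2(2) order_trans by blast
  define c where "c = \<bar>1 / b\<bar> ^ DIM('a)"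
  have c: "c \<ge> 0" by (simp add: c_def)
  define y where "y x z = (- (a / b)) *\<^sub>R x + (1 / b) *\<^sub>R z" for x z :: 'a
  have [measurable]: "(\<lambda>w. y (fst w) (snd w)) \<in> borel_measurable (borel \<Otimes>\<^sub>M borel)"
    unfolding y_def by measurable
  have y_eq: "a *\<^sub>R x + b *\<^sub>R y x z = z" for x z
    using ab(3) by (simp add: y_def scaleR_diff_right)
  define fe where "fe z = ennreal c * (\<integral>\<^sup>+x. ennreal (f1 x) * ennreal (f2 (y x z)) \<partial>lborel)" for z
  have [measurable]: "(\<lambda>w. f2 (y (snd w) (fst w))) \<in> borel_measurable (borel \<Otimes>\<^sub>M borel)"
    by (simp add: y_def)
  have [measurable]: "fe \<in> borel_measurable borel" unfolding fe_def[abs_def] y_def by measurable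
  have fe_le: "fe z \<le> ennreal (c * B)" for z
  proof -
    have "(\<integral>\<^sup>+x. ennreal (f1 x) * ennreal (f2 (y x z)) \<partial>lborel) \<le> (\<integral>\<^sup>+x. ennreal (f1 x) * ennreal B \<partial>lborel)"
      using B by (intro nn_integral_mono mult_left_mono ennreal_leI) auto
    also have "\<dots> = ennreal B" using f1(4) by (simp add: nn_integral_multc)
    finally show ?thesis unfolding fe_def using c B0 by (simp add: ennreal_mult mult_left_mono)
  qed
  have fe_fin: "fe z < \<top>" for z using le_less_trans[OF fe_le ennreal_less_top] .
  define f where "f z = enn2real (fe z)" for z
  have f_fe: "ennreal (f z) = fe z" for z using fe_fin by (simp add: f_def)
  show thesis
  proof
    have "\<bar>f z\<bar> \<le> c * B" for z
      using fe_le[of z] c B0 by (simp add: f_def enn2real_leI)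
    then show "bounded_measurable borel f"
      unfolding bounded_measurable_def by (auto simp: f_def[abs_def])
    show "0 \<le> f x" for x by (simp add: f_def)
    fix z :: 'a assume z: "z \<notin> cube (2 * R)"
    have "f1 x = 0 \<or> f2 (y x z) = 0" for x
    proof (rule ccontr)
      assume "\<not> (f1 x = 0 \<or> f2 (y x z) = 0)"
      then have xy: "x \<in> cube R" "y x z \<in> cube R" using f1(3) f2(3) by blast+
      have "\<bar>z \<bullet> i\<bar> \<le> 2 * R" if i: "i \<in> Basis" for i
      proof -
        have "z \<bullet> i = a * (x \<bullet> i) + b * (y x z \<bullet> i)"
          using y_eq[of x z] by (metis inner_add_left inner_scaleR_left)
        moreover have "\<bar>a * (x \<bullet> i)\<bar> \<le> 1 * R" "\<bar>b * (y x z \<bullet> i)\<bar> \<le> 1 * R"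
          unfolding abs_mult using xy i ab by (intro mult_mono; auto simp: mem_cube)+
        ultimately show ?thesis by linarith
      qed
      then show False using z by (simp add: mem_cube)
    qed
    then have zero: "(\<lambda>x. ennreal (f1 x) * ennreal (f2 (y x z))) = (\<lambda>_. 0)"
      by (intro ext) (metis mult_zero_left mult_zero_right ennreal_0)
    show "f z = 0" unfolding f_def fe_def zero by simp
  next
    fix \<phi> :: "'a \<Rightarrow> ennreal" assume [measurable]: "\<phi> \<in> borel_measurable borel"
    have "(\<integral>\<^sup>+x. \<integral>\<^sup>+y. ennreal (f1 x) * ennreal (f2 y) * \<phi> (a *\<^sub>R x + b *\<^sub>R y) \<partial>lborel \<partial>lborel)
       = (\<integral>\<^sup>+x. \<integral>\<^sup>+z. ennreal c * (ennreal (f1 x) * ennreal (f2 (y x z)) * \<phi> z) \<partial>lborel \<partial>lborel)"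
    proof (rule nn_integral_cong)
      fix x :: 'a
      have "(\<integral>\<^sup>+y. ennreal (f1 x) * ennreal (f2 y) * \<phi> (a *\<^sub>R x + b *\<^sub>R y) \<partial>lborel)
        = ennreal c * (\<integral>\<^sup>+z. ennreal (f1 x) * ennreal (f2 (y x z)) * \<phi> (a *\<^sub>R x + b *\<^sub>R y x z) \<partial>lborel)"
        unfolding c_def y_def using ab(3) by (intro nn_integral_affine) auto
      then show "(\<integral>\<^sup>+y. ennreal (f1 x) * ennreal (f2 y) * \<phi> (a *\<^sub>R x + b *\<^sub>R y) \<partial>lborel)
        = (\<integral>\<^sup>+z. ennreal c * (ennreal (f1 x) * ennreal (f2 (y x z)) * \<phi> z) \<partial>lborel)"
        unfolding y_eq by (subst nn_integral_cmult) (auto simp: y_def)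
    qed
    also have "\<dots> = (\<integral>\<^sup>+z. \<integral>\<^sup>+x. ennreal c * (ennreal (f1 x) * ennreal (f2 (y x z)) * \<phi> z) \<partial>lborel \<partial>lborel)"
      by (rule lborel_pair.Fubini'[symmetric]) (simp add: y_def case_prod_beta')
    also have "\<dots> = (\<integral>\<^sup>+z. ennreal (f z) * \<phi> z \<partial>lborel)"
      unfolding f_fe fe_def
      by (simp add: y_def nn_integral_cmult nn_integral_multc) (simp add: mult.assoc nn_integral_cmult)
    finally show "(\<integral>\<^sup>+x. \<integral>\<^sup>+y. ennreal (f1 x) * ennreal (f2 y) * \<phi> (a *\<^sub>R x + b *\<^sub>R y) \<partial>lborel \<partial>lborel) = (\<integral>\<^sup>+z. ennreal (f z) * \<phi> z \<partial>lborel)" .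
  qed
qed

text \<open>The entropy inequality is used with \<open>g = f + \<epsilon>\<close>, where \<open>f\<close> is the density of the combination and
  the constant \<open>\<epsilon>\<close> provides the required lower bound. It costs only
  \<open>ln (\<integral> g) = ln (1 + \<epsilon> V)\<close> with \<open>V\<close> the volume of the cube, which tends to \<open>0\<close> with \<open>\<epsilon>\<close>.\<close>

proposition nonneg_entropy_density_combination:
  fixes f1 f2 :: "'a::euclidean_space \<Rightarrow> real"
  assumes R: "R > 0" and f1: "nonneg_entropy_density R f1" and f2: "nonneg_entropy_density R f2"
    and ab: "a\<^sup>2 + b\<^sup>2 = 1" "b \<noteq> 0"
  obtains f where "nonneg_entropy_density (2 * R) f"
    "\<And>\<phi>. \<phi> \<in> borel_measurable borel \<Longrightarrow>
      (\<integral>\<^sup>+x. \<integral>\<^sup>+y. ennreal (f1 x) * ennreal (f2 y) * \<phi> (a *\<^sub>R x + b *\<^sub>R y) \<partial>lborel \<partial>lborel) = (\<integral>\<^sup>+z. ennreal (f z) * \<phi> z \<partial>lborel)"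
proof -
  have F1: "bounded_measurable borel f1" "\<And>x. 0 \<le> f1 x" "\<And>x. x \<notin> cube R \<Longrightarrow> f1 x = 0"
    "(\<integral>\<^sup>+x. ennreal (f1 x) \<partial>lborel) = 1" "(\<integral>x. f1 x * ln (f1 x) \<partial>lborel) \<le> 0"
    and F2: "bounded_measurable borel f2" "\<And>x. 0 \<le> f2 x" "\<And>x. x \<notin> cube R \<Longrightarrow> f2 x = 0"
    "(\<integral>\<^sup>+x. ennreal (f2 x) \<partial>lborel) = 1" "(\<integral>x. f2 x * ln (f2 x) \<partial>lborel) \<le> 0"
    using f1 f2 by (auto simp: nonneg_entropy_density_def)
  have [measurable]: "f1 \<in> borel_measurable borel" "f2 \<in> borel_measurable borel" using F1(1) F2(1) by auto
  have "a\<^sup>2 \<le> 1" "b\<^sup>2 \<le> 1" using ab(1) zero_le_power2[of a] zero_le_power2[of b] by linarith+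
  then have ab1: "\<bar>a\<bar> \<le> 1" "\<bar>b\<bar> \<le> 1" by (simp_all add: abs_square_le_1)
  obtain f where bf: "bounded_measurable borel f" and f_nn: "\<And>x. 0 \<le> f x" and f_supp: "\<And>x. x \<notin> cube (2 * R) \<Longrightarrow> f x = 0"
    and law: "\<And>\<phi>. \<phi> \<in> borel_measurable borel \<Longrightarrow>
      (\<integral>\<^sup>+x. \<integral>\<^sup>+y. ennreal (f1 x) * ennreal (f2 y) * \<phi> (a *\<^sub>R x + b *\<^sub>R y) \<partial>lborel \<partial>lborel) = (\<integral>\<^sup>+z. ennreal (f z) * \<phi> z \<partial>lborel)"
    using density_of_linear_combination[OF F1(1-4) F2(1-3) ab1 ab(2)] by blast
  have [measurable]: "f \<in> borel_measurable borel" using bf by auto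
  have mass: "(\<integral>\<^sup>+z. ennreal (f z) \<partial>lborel) = 1"
    using law[of "\<lambda>_. 1"] F1(4) F2(4) by (simp add: nn_integral_cmult)
  have int_f: "integrable lborel f" using integrable_lborel_of_cube[OF bf f_supp] .
  have mass': "(\<integral>z. f z \<partial>lborel) = 1"
    using nn_integral_eq_integral[OF int_f] f_nn mass by simp
  let ?Q = "cube_measure R :: 'a measure" and ?Q' = "cube_measure (2 * R) :: 'a measure"
  interpret Q: finite_measure ?Q by (rule finite_cube_measure)
  interpret Q': finite_measure ?Q' by (rule finite_cube_measure)
  note bm = bounded_measurable_cube_measure

  have law': "(\<integral>x. \<integral>y. f1 x * f2 y * \<psi> (a *\<^sub>R x + b *\<^sub>R y) \<partial>?Q \<partial>?Q) = (\<integral>z. f z * \<psi> z \<partial>lborel)"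
    if \<psi>: "bounded_measurable borel \<psi>" for \<psi>
  proof -
    have [measurable]: "\<psi> \<in> borel_measurable borel" using \<psi> by auto
    let ?L = "\<lambda>z. a *\<^sub>R fst z + b *\<^sub>R snd z :: 'a"
    let ?P = "density (?Q \<Otimes>\<^sub>M ?Q) (\<lambda>z. ennreal (f1 (fst z) * f2 (snd z)))"
    have L [measurable]: "?L \<in> ?Q \<Otimes>\<^sub>M ?Q \<rightarrow>\<^sub>M borel" by measurable
    have "distr ?P borel ?L = density lborel (\<lambda>z. ennreal (f z))"
    proof (rule measure_eqI)
      fix A assume "A \<in> sets (distr ?P borel ?L)"
      then have [measurable]: "A \<in> sets borel" by simp
      have "emeasure (distr ?P borel ?L) A = (\<integral>\<^sup>+x. indicator A x \<partial>distr ?P borel ?L)" by simp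
      also have "\<dots> = (\<integral>\<^sup>+z. ennreal (f1 (fst z) * f2 (snd z)) * indicator A (?L z) \<partial>(?Q \<Otimes>\<^sub>M ?Q))"
        by (subst nn_integral_distr) (auto simp: nn_integral_density)
      also have "\<dots> = (\<integral>\<^sup>+x. \<integral>\<^sup>+y. ennreal (f1 x * f2 y) * indicator A (a *\<^sub>R x + b *\<^sub>R y) \<partial>?Q \<partial>?Q)"
        by (subst Q.nn_integral_fst[symmetric]) auto
      also have "\<dots> = (\<integral>\<^sup>+x. \<integral>\<^sup>+y. ennreal (f1 x) * ennreal (f2 y) * indicator A (a *\<^sub>R x + b *\<^sub>R y) \<partial>lborel \<partial>lborel)"
      proof -
        have "(\<integral>\<^sup>+y. ennreal (f1 x * f2 y) * indicator A (a *\<^sub>R x + b *\<^sub>R y) \<partial>?Q)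
           = (\<integral>\<^sup>+y. ennreal (f1 x) * ennreal (f2 y) * indicator A (a *\<^sub>R x + b *\<^sub>R y) \<partial>lborel)" for x
          using F1(2) F2(2,3) by (subst nn_integral_cube_measure) (auto intro!: nn_integral_cong simp: ennreal_mult indicator_def)
        then show ?thesis
          using F1(3) by (subst nn_integral_cube_measure) (auto intro!: nn_integral_cong simp: indicator_def)
      qed
      also have "\<dots> = (\<integral>\<^sup>+z. ennreal (f z) * indicator A z \<partial>lborel)" by (rule law) simp
      finally show "emeasure (distr ?P borel ?L) A = emeasure (density lborel (\<lambda>z. ennreal (f z))) A"
        by (simp add: emeasure_density)
    qed simp
    then have "(\<integral>z. \<psi> z \<partial>distr ?P borel ?L) = (\<integral>z. f z * \<psi> z \<partial>lborel)"
      using f_nn by (simp add: integral_density)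
    moreover have "(\<integral>z. \<psi> z \<partial>distr ?P borel ?L) = (\<integral>z. f1 (fst z) * f2 (snd z) * \<psi> (?L z) \<partial>(?Q \<Otimes>\<^sub>M ?Q))"
      using F1(2) F2(2) by (subst integral_distr) (auto simp: integral_density)
    moreover have "\<dots> = (\<integral>x. \<integral>y. f1 x * f2 y * \<psi> (a *\<^sub>R x + b *\<^sub>R y) \<partial>?Q \<partial>?Q)"
    proof -
      have "bounded_measurable (?Q \<Otimes>\<^sub>M ?Q) (\<lambda>z. f1 (fst z) * f2 (snd z) * \<psi> (?L z))"
        using F1(1) F2(1) by (intro bounded_measurable_mult bounded_measurable_fst bounded_measurable_snd bounded_measurable_compose[OF \<psi> L]) (simp_all add: bm)
      from bounded_measurable_Fubini(1)[OF finite_cube_measure finite_cube_measure this] show ?thesis by simp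
    qed
    ultimately show ?thesis by simp
  qed

  have fi: "(\<integral>x. h x \<partial>?Q) = 1" "functional_entropy ?Q h \<le> 0"
    if "bounded_measurable borel h" "\<And>x. x \<notin> cube R \<Longrightarrow> h x = 0" "(\<integral>x. h x \<partial>lborel) = 1" "(\<integral>x. h x * ln (h x) \<partial>lborel) \<le> 0" for h :: "'a \<Rightarrow> real"
  proof -
    have [measurable]: "h \<in> borel_measurable borel" using that by auto
    show m: "(\<integral>x. h x \<partial>?Q) = 1" using that by (subst integral_cube_measure_eq_lborel) auto
    have "(\<integral>x. h x * ln (h x) \<partial>?Q) \<le> 0" using that by (subst integral_cube_measure_eq_lborel) auto
    then show "functional_entropy ?Q h \<le> 0" by (simp add: functional_entropy_def m)
  qed
  note fi1 = fi[OF F1(1,3) nonneg_entropy_density_integral(2)[OF f1] F1(5)]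
  note fi2 = fi[OF F2(1,3) nonneg_entropy_density_integral(2)[OF f2] F2(5)]
  define V where "V = measure ?Q' UNIV"
  have bxlf: "bounded_measurable borel (\<lambda>z. f z * ln (f z))" using bf f_nn by (intro bounded_measurable_x_ln_x)
  have "(\<integral>z. f z * ln (f z) \<partial>lborel) \<le> 0 + e" if e: "e > 0" for e
  proof -
    \<comment> \<open>Chosen so that \<open>ln (1 + \<epsilon> V) \<le> \<epsilon> V \<le> e\<close>.\<close>
    define \<epsilon> where "\<epsilon> = e / (V + 1)"
    have V: "V \<ge> 0" by (simp add: V_def)
    then have \<epsilon>: "\<epsilon> > 0" using e by (simp add: \<epsilon>_def)
    have "\<epsilon> * V \<le> \<epsilon> * (V + 1)" using \<epsilon> by simp
    also have "\<dots> = e" using V by (simp add: \<epsilon>_def)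
    finally have \<epsilon>V: "\<epsilon> * V \<le> e" .
    define g where "g z = f z + \<epsilon>" for z
    have g_ge: "\<epsilon> \<le> g z" for z using f_nn by (simp add: g_def)
    have bg: "bounded_measurable borel g" unfolding g_def[abs_def] by (intro bounded_measurable_add bf bounded_measurable_const)
    have bln: "bounded_measurable borel (\<lambda>z. ln (g z))" using \<epsilon> f_nn by (intro bounded_measurable_ln[OF bg \<epsilon>]) (simp add: g_def)
    have "(\<integral>z. f z * ln (f z) \<partial>lborel) \<le> (\<integral>z. f z * ln (g z) \<partial>lborel)"
    proof (rule integral_mono)
      show "integrable lborel (\<lambda>z. f z * ln (f z))"
        by (rule integrable_lborel_of_cube[OF bxlf, of "2 * R"]) (simp add: f_supp)
      show "integrable lborel (\<lambda>z. f z * ln (g z))"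
        by (rule integrable_lborel_of_cube[OF bounded_measurable_mult[OF bf bln], of "2 * R"]) (simp add: f_supp)
      show "f z * ln (f z) \<le> f z * ln (g z)" for z
        using f_nn[of z] \<epsilon> by (cases "f z = 0") (auto simp: g_def intro!: mult_left_mono)
    qed
    also have "\<dots> = (\<integral>x. \<integral>y. f1 x * f2 y * ln (g (a *\<^sub>R x + b *\<^sub>R y)) \<partial>?Q \<partial>?Q)"
      by (rule law'[OF bln, symmetric])
    also have "\<dots> \<le> (\<integral>x. f1 x \<partial>?Q) * (\<integral>x. f2 x \<partial>?Q) * ln (\<integral>z. g z \<partial>?Q')
         + a\<^sup>2 * (\<integral>x. f2 x \<partial>?Q) * functional_entropy ?Q f1 + b\<^sup>2 * (\<integral>x. f1 x \<partial>?Q) * functional_entropy ?Q f2"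
      by (rule entropy_inequalityD[OF entropy_inequality_euclidean[OF R ab] _ _ _ _ _ \<epsilon>])
         (use F1 F2 bg g_ge in \<open>auto simp: bm\<close>)
    also have "\<dots> \<le> ln (\<integral>z. g z \<partial>?Q')"
      using fi1 fi2 by (simp add: mult_nonneg_nonpos add_nonpos_nonpos)
    also have "(\<integral>z. g z \<partial>?Q') = 1 + \<epsilon> * V"
    proof -
      have "integrable ?Q' f" using bf by (intro bounded_measurable_integrable finite_cube_measure) (simp add: bm)
      moreover have "(\<integral>z. f z \<partial>?Q') = 1" using f_supp mass' by (subst integral_cube_measure_eq_lborel) auto
      moreover have "(\<integral>z. g z \<partial>?Q') = (\<integral>z. f z \<partial>?Q') + (\<integral>z. \<epsilon> \<partial>?Q')"
        unfolding g_def by (rule Bochner_Integration.integral_add) (fact, rule Q'.integrable_const)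
      ultimately show ?thesis by (simp add: V_def mult.commute)
    qed
    also have "ln (1 + \<epsilon> * V) \<le> \<epsilon> * V" using \<epsilon> V by (intro ln_add_one_self_le_self) simp
    finally show ?thesis using \<epsilon>V by simp
  qed
  then have "(\<integral>z. f z * ln (f z) \<partial>lborel) \<le> 0" by (rule field_le_epsilon)
  then have "nonneg_entropy_density (2 * R) f"
    using bf f_nn f_supp mass by (simp add: nonneg_entropy_density_def)
  then show thesis using that law by blast
qed

lemma nonneg_entropy_density_indicator:
  fixes C :: "'a::euclidean_space set"
  assumes [measurable]: "C \<in> sets borel" and "emeasure lborel C = 1" "C \<subseteq> cube R"
  shows "nonneg_entropy_density R (indicator C)"
proof -
  have zero: "(\<lambda>x. indicator C x * ln (indicator C x :: real)) = (\<lambda>_. 0)" by (auto simp: fun_eq_iff indicator_def)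
  have "(\<integral>x. indicator C x * ln (indicator C x :: real) \<partial>lborel) = 0" unfolding zero by simp
  moreover have "(\<integral>\<^sup>+x. ennreal (indicator C x) \<partial>lborel) = 1" using assms(2) by (simp add: ennreal_indicator)
  moreover have "bounded_measurable borel (indicator C :: 'a \<Rightarrow> real)"
    unfolding bounded_measurable_def by (auto intro!: exI[of _ 1] simp: indicator_def)
  ultimately show ?thesis
    using assms(2,3) unfolding nonneg_entropy_density_def
    by (auto simp: indicator_eq_0_iff)
qed

lemma bounded_subset_cube:
  fixes C :: "'a::euclidean_space set"
  assumes "bounded C"
  obtains R where "R > 0" "C \<subseteq> cube R"
proof -
  obtain B where B: "B > 0" "\<And>x. x \<in> C \<Longrightarrow> norm x \<le> B" using assms by (auto simp: bounded_pos)
  have "C \<subseteq> cube B" using B(2) by (auto simp: mem_cube) (meson Basis_le_norm order_trans)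
  then show thesis using B that by blast
qed

text \<open>The summands are added one at a time. If the partial sum is distributed as \<open>\<tau> Z\<close>, then adding
  \<open>t\<^sub>j U\<^sub>j\<close> gives \<open>\<sigma> (a U\<^sub>j + b Z)\<close> with \<open>\<sigma>\<^sup>2 = t\<^sub>j\<^sup>2 + \<tau>\<^sup>2\<close>, \<open>a = t\<^sub>j / \<sigma>\<close> and
  \<open>b = \<tau> / \<sigma>\<close>, so that \<open>a\<^sup>2 + b\<^sup>2 = 1\<close> and the bracket again has nonnegative entropy. As long as
  all coefficients vanish, the sum is constant and has no density, hence the first alternative. Only
  \<open>\<tau>\<^sup>2\<close> is prescribed: leaving the sign of \<open>\<tau>\<close> free lets the first nonzero coefficient serve as
  \<open>\<tau>\<close>.\<close>

proposition law_of_weighted_sum: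
  fixes C :: "'s \<Rightarrow> 'a::euclidean_space set" and t :: "'s \<Rightarrow> real"
  assumes S: "finite S" and C: "\<And>j. compact (C j)" "\<And>j. emeasure lborel (C j) = 1"
  shows "(\<forall>j\<in>S. t j = 0) \<or> (\<exists>\<tau> R f. \<tau>\<^sup>2 = (\<Sum>j\<in>S. (t j)\<^sup>2) \<and> \<tau> \<noteq> 0 \<and> R > 0 \<and> nonneg_entropy_density R f \<and>
    (\<forall>\<phi>\<in>borel_measurable borel. (\<integral>\<^sup>+x. (\<Prod>j\<in>S. indicator (C j) (x j)) * \<phi> (\<Sum>j\<in>S. t j *\<^sub>R x j) \<partial>PiM S (\<lambda>_. lborel))
       = (\<integral>\<^sup>+z. ennreal (f z) * \<phi> (\<tau> *\<^sub>R z) \<partial>lborel)))"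
  using S
proof induction
  case empty
  then show ?case by simp
next
  case (insert j S)
  have Cb [measurable]: "C i \<in> sets borel" for i using C(1) by (simp add: borel_compact)
  interpret P: product_sigma_finite "\<lambda>_::'s. lborel :: 'a measure" by standard
  have mass: "(\<integral>\<^sup>+x. (\<Prod>j\<in>S. indicator (C j) (x j)) \<partial>PiM S (\<lambda>_. lborel)) = 1"
    using insert.hyps(1) C(2) by (subst P.product_nn_integral_prod) auto
  have [measurable]: "(\<lambda>x. \<Sum>j\<in>S. t j *\<^sub>R x j) \<in> PiM S (\<lambda>_. lborel) \<rightarrow>\<^sub>M borel" by measurable
  have [measurable]: "(\<lambda>x. \<Prod>j\<in>S. indicator (C j) (x j) :: ennreal) \<in> borel_measurable (PiM S (\<lambda>_. lborel))"
    by measurable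
  have split: "(\<integral>\<^sup>+x. (\<Prod>i\<in>insert j S. indicator (C i) (x i)) * \<phi> (\<Sum>i\<in>insert j S. t i *\<^sub>R x i) \<partial>PiM (insert j S) (\<lambda>_. lborel))
      = (\<integral>\<^sup>+x. (\<Prod>i\<in>S. indicator (C i) (x i)) * (\<integral>\<^sup>+y. indicator (C j) y * \<phi> (t j *\<^sub>R y + (\<Sum>i\<in>S. t i *\<^sub>R x i)) \<partial>lborel) \<partial>PiM S (\<lambda>_. lborel))"
    if [measurable]: "\<phi> \<in> borel_measurable borel" for \<phi>
  proof -
    have "(\<integral>\<^sup>+x. (\<Prod>i\<in>insert j S. indicator (C i) (x i)) * \<phi> (\<Sum>i\<in>insert j S. t i *\<^sub>R x i) \<partial>PiM (insert j S) (\<lambda>_. lborel))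
      = (\<integral>\<^sup>+x. \<integral>\<^sup>+y. (\<Prod>i\<in>insert j S. indicator (C i) ((x(j := y)) i)) * \<phi> (\<Sum>i\<in>insert j S. t i *\<^sub>R (x(j := y)) i) \<partial>lborel \<partial>PiM S (\<lambda>_. lborel))"
      by (rule P.product_nn_integral_insert[OF insert.hyps]) measurable
    also have "\<dots> = (\<integral>\<^sup>+x. \<integral>\<^sup>+y. (\<Prod>i\<in>S. indicator (C i) (x i)) * (indicator (C j) y * \<phi> (t j *\<^sub>R y + (\<Sum>i\<in>S. t i *\<^sub>R x i))) \<partial>lborel \<partial>PiM S (\<lambda>_. lborel))"
    proof -
      have "(\<Prod>i\<in>insert j S. indicator (C i) ((x(j := y)) i)) = (indicator (C j) y * (\<Prod>i\<in>S. indicator (C i) (x i)) :: ennreal)"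
        "(\<Sum>i\<in>insert j S. t i *\<^sub>R (x(j := y)) i) = t j *\<^sub>R y + (\<Sum>i\<in>S. t i *\<^sub>R x i)" for x y
        using insert.hyps by (auto intro!: arg_cong2[where f="(*)"] prod.cong arg_cong2[where f="(+)"] sum.cong)
      then show ?thesis by (simp add: mult_ac)
    qed
    also have "\<dots> = (\<integral>\<^sup>+x. (\<Prod>i\<in>S. indicator (C i) (x i)) * (\<integral>\<^sup>+y. indicator (C j) y * \<phi> (t j *\<^sub>R y + (\<Sum>i\<in>S. t i *\<^sub>R x i)) \<partial>lborel) \<partial>PiM S (\<lambda>_. lborel))"
      by (intro nn_integral_cong nn_integral_cmult) measurable
    finally show ?thesis .
  qed
  obtain RC where RC: "RC > 0" "C j \<subseteq> cube RC" using bounded_subset_cube[of "C j"] C(1) compact_imp_bounded by blast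
  have ind: "nonneg_entropy_density RC (indicator (C j))"
    using C(2) RC(2) by (intro nonneg_entropy_density_indicator) auto
  from insert.IH show ?case
  proof
    assume zero: "\<forall>i\<in>S. t i = 0"
    show ?case
    proof (cases "t j = 0")
      case True
      then show ?thesis using zero by simp
    next
      case False
      have "(\<integral>\<^sup>+x. (\<Prod>i\<in>insert j S. indicator (C i) (x i)) * \<phi> (\<Sum>i\<in>insert j S. t i *\<^sub>R x i) \<partial>PiM (insert j S) (\<lambda>_. lborel))
         = (\<integral>\<^sup>+z. ennreal (indicator (C j) z) * \<phi> (t j *\<^sub>R z) \<partial>lborel)" if [measurable]: "\<phi> \<in> borel_measurable borel" for \<phi>
        unfolding split[OF that] using zero mass by (simp add: nn_integral_multc ennreal_indicator)
      moreover have "(t j)\<^sup>2 = (\<Sum>i\<in>insert j S. (t i)\<^sup>2)" using zero insert.hyps by simp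
      ultimately show ?thesis using False RC(1) ind by blast
    qed
  next
    assume "\<exists>\<tau> R f. \<tau>\<^sup>2 = (\<Sum>j\<in>S. (t j)\<^sup>2) \<and> \<tau> \<noteq> 0 \<and> R > 0 \<and> nonneg_entropy_density R f \<and>
    (\<forall>\<phi>\<in>borel_measurable borel. (\<integral>\<^sup>+x. (\<Prod>j\<in>S. indicator (C j) (x j)) * \<phi> (\<Sum>j\<in>S. t j *\<^sub>R x j) \<partial>PiM S (\<lambda>_. lborel))
       = (\<integral>\<^sup>+z. ennreal (f z) * \<phi> (\<tau> *\<^sub>R z) \<partial>lborel))"
    then obtain \<tau> R f where \<tau>: "\<tau>\<^sup>2 = (\<Sum>j\<in>S. (t j)\<^sup>2)" "\<tau> \<noteq> 0" and R: "R > 0" and f: "nonneg_entropy_density R f"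
      and law: "\<And>\<phi>. \<phi> \<in> borel_measurable borel \<Longrightarrow> (\<integral>\<^sup>+x. (\<Prod>j\<in>S. indicator (C j) (x j)) * \<phi> (\<Sum>j\<in>S. t j *\<^sub>R x j) \<partial>PiM S (\<lambda>_. lborel))
       = (\<integral>\<^sup>+z. ennreal (f z) * \<phi> (\<tau> *\<^sub>R z) \<partial>lborel)"
      by blast
    have [measurable]: "f \<in> borel_measurable borel" using f by (auto simp: nonneg_entropy_density_def)
    define \<sigma> where "\<sigma> = sqrt ((t j)\<^sup>2 + \<tau>\<^sup>2)"
    have \<sigma>2: "\<sigma>\<^sup>2 = (t j)\<^sup>2 + \<tau>\<^sup>2" by (simp add: \<sigma>_def)
    have \<sigma>: "\<sigma> \<noteq> 0" using \<tau>(2) \<sigma>2 by (metis add_nonneg_eq_0_iff power_zero_numeral zero_eq_power2 zero_le_power2)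
    define a where "a = t j / \<sigma>"
    define b where "b = \<tau> / \<sigma>"
    have ab: "a\<^sup>2 + b\<^sup>2 = 1" "b \<noteq> 0"
      using \<sigma> \<tau>(2) \<sigma>2 by (auto simp: a_def b_def power_divide add_divide_distrib[symmetric])
    define R' where "R' = max R RC"
    have "R' > 0" "nonneg_entropy_density R' (indicator (C j))" "nonneg_entropy_density R' f"
      using R by (auto simp: R'_def intro: nonneg_entropy_density_mono[OF ind] nonneg_entropy_density_mono[OF f])
    then obtain f' where f': "nonneg_entropy_density (2 * R') f'"
      and law': "\<And>\<phi>. \<phi> \<in> borel_measurable borel \<Longrightarrow>
      (\<integral>\<^sup>+x. \<integral>\<^sup>+y. ennreal (indicator (C j) x) * ennreal (f y) * \<phi> (a *\<^sub>R x + b *\<^sub>R y) \<partial>lborel \<partial>lborel) = (\<integral>\<^sup>+z. ennreal (f' z) * \<phi> z \<partial>lborel)"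
      using nonneg_entropy_density_combination[of R' "indicator (C j)" f a b] ab by blast
    have "(\<integral>\<^sup>+x. (\<Prod>i\<in>insert j S. indicator (C i) (x i)) * \<phi> (\<Sum>i\<in>insert j S. t i *\<^sub>R x i) \<partial>PiM (insert j S) (\<lambda>_. lborel))
         = (\<integral>\<^sup>+z. ennreal (f' z) * \<phi> (\<sigma> *\<^sub>R z) \<partial>lborel)" if [measurable]: "\<phi> \<in> borel_measurable borel" for \<phi>
    proof -
      have "(\<integral>\<^sup>+x. (\<Prod>i\<in>insert j S. indicator (C i) (x i)) * \<phi> (\<Sum>i\<in>insert j S. t i *\<^sub>R x i) \<partial>PiM (insert j S) (\<lambda>_. lborel))
         = (\<integral>\<^sup>+z. ennreal (f z) * (\<integral>\<^sup>+y. indicator (C j) y * \<phi> (t j *\<^sub>R y + \<tau> *\<^sub>R z) \<partial>lborel) \<partial>lborel)"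
        unfolding split[OF that] by (rule law[of "\<lambda>w. \<integral>\<^sup>+y. indicator (C j) y * \<phi> (t j *\<^sub>R y + w) \<partial>lborel"]) measurable
      also have "\<dots> = (\<integral>\<^sup>+z. \<integral>\<^sup>+y. ennreal (indicator (C j) y) * ennreal (f z) * \<phi> (\<sigma> *\<^sub>R (a *\<^sub>R y + b *\<^sub>R z)) \<partial>lborel \<partial>lborel)"
      proof (rule nn_integral_cong)
        fix z :: 'a
        have eq: "\<sigma> *\<^sub>R (a *\<^sub>R y + b *\<^sub>R z) = t j *\<^sub>R y + \<tau> *\<^sub>R z" for y
          using \<sigma> by (simp add: a_def b_def scaleR_add_right)
        show "ennreal (f z) * (\<integral>\<^sup>+y. indicator (C j) y * \<phi> (t j *\<^sub>R y + \<tau> *\<^sub>R z) \<partial>lborel)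
          = (\<integral>\<^sup>+y. ennreal (indicator (C j) y) * ennreal (f z) * \<phi> (\<sigma> *\<^sub>R (a *\<^sub>R y + b *\<^sub>R z)) \<partial>lborel)"
          unfolding eq by (subst nn_integral_cmult[symmetric]) (auto simp: ennreal_indicator mult_ac)
      qed
      also have "\<dots> = (\<integral>\<^sup>+y. \<integral>\<^sup>+z. ennreal (indicator (C j) y) * ennreal (f z) * \<phi> (\<sigma> *\<^sub>R (a *\<^sub>R y + b *\<^sub>R z)) \<partial>lborel \<partial>lborel)"
        by (rule lborel_pair.Fubini') simp
      also have "\<dots> = (\<integral>\<^sup>+z. ennreal (f' z) * \<phi> (\<sigma> *\<^sub>R z) \<partial>lborel)"
        by (rule law'[of "\<lambda>w. \<phi> (\<sigma> *\<^sub>R w)"]) measurable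
      finally show ?thesis .
    qed
    moreover have "\<sigma>\<^sup>2 = (\<Sum>i\<in>insert j S. (t i)\<^sup>2)" using insert.hyps \<sigma>2 \<tau>(1) by simp
    moreover have "2 * R' > 0" using \<open>R' > 0\<close> by simp
    ultimately show ?case using \<sigma> f' by blast
  qed
qed

section \<open>The norm of a symmetric convex body\<close>

text \<open>The origin is the midpoint of an interior point \<open>p\<close> and its reflection \<open>- p\<close>.\<close>

lemma convex_body_contains_ball:
  fixes K :: "'a::euclidean_space set"
  assumes K: "convex_body K" "centrally_symmetric K"
  obtains \<delta> where "\<delta> > 0" "cball 0 \<delta> \<subseteq> K"
proof -
  obtain p where p: "p \<in> interior K" using K(1) by (auto simp: convex_body_def)
  then have "- p \<in> K" using K(2) interior_subset by (force simp: centrally_symmetric_def)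
  then have "- p - (1/2) *\<^sub>R (- p - p) \<in> interior K"
    using K(1) p by (intro mem_interior_closure_convex_shrink) (auto simp: convex_body_def intro: subsetD[OF closure_subset])
  moreover have "- p - (1/2) *\<^sub>R (- p - p) = 0"
    using scaleR_half_double[of "- p"] by simp
  ultimately show thesis using that by (auto simp: mem_interior_cball)
qed

lemma body_norm_le: "r > 0 \<Longrightarrow> x \<in> (\<lambda>y. r *\<^sub>R y) ` K \<Longrightarrow> body_norm K x \<le> r"
  unfolding body_norm_def by (intro cInf_lower) (auto intro!: bdd_belowI[of _ 0])

context
  fixes K :: "'a::euclidean_space set"
  assumes K: "convex_body K" "centrally_symmetric K"
begin

lemma body_norm_absorbing: "\<exists>r>0. x \<in> (\<lambda>y. r *\<^sub>R y) ` K"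
proof -
  obtain \<delta> where \<delta>: "\<delta> > 0" "cball 0 \<delta> \<subseteq> K" using convex_body_contains_ball[OF K] .
  define r where "r = (norm x + 1) / \<delta>"
  have r: "r > 0" using \<delta>(1) by (simp add: r_def add_nonneg_pos)
  have "norm x / r \<le> \<delta>" using \<delta>(1) by (simp add: r_def divide_le_eq add_nonneg_pos)
  then have "(1 / r) *\<^sub>R x \<in> K" using \<delta>(2) r by (auto simp: divide_inverse mult.commute)
  then have "x \<in> (\<lambda>y. r *\<^sub>R y) ` K" using r by (intro image_eqI[of _ _ "(1 / r) *\<^sub>R x"]) auto
  then show ?thesis using r by blast
qed

lemma body_norm_nonneg: "0 \<le> body_norm K x"
  unfolding body_norm_def using body_norm_absorbing[of x] by (intro cInf_greatest) auto

lemma body_norm_less_iff: "body_norm K x < u \<longleftrightarrow> (\<exists>r. 0 < r \<and> r < u \<and> x \<in> (\<lambda>y. r *\<^sub>R y) ` K)"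
  unfolding body_norm_def using body_norm_absorbing[of x]
  by (subst cInf_less_iff) (auto intro!: bdd_belowI[of _ 0])

lemma dilate_mono:
  assumes "0 < r" "r \<le> q"
  shows "(\<lambda>y. r *\<^sub>R y) ` K \<subseteq> (\<lambda>y. q *\<^sub>R y) ` K"
proof
  fix x assume "x \<in> (\<lambda>y. r *\<^sub>R y) ` K"
  then obtain y where y: "y \<in> K" "x = r *\<^sub>R y" by blast
  have "0 \<in> K" using convex_body_contains_ball[OF K] by (metis centre_in_cball less_imp_le subsetD)
  moreover have "convex K" using K(1) by (simp add: convex_body_def)
  ultimately have "(1 - r / q) *\<^sub>R 0 + (r / q) *\<^sub>R y \<in> K"
    using y assms by (intro convexD) (auto simp: field_simps)
  moreover have "x = q *\<^sub>R ((1 - r / q) *\<^sub>R 0 + (r / q) *\<^sub>R y)" using assms y by simp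
  ultimately show "x \<in> (\<lambda>y. q *\<^sub>R y) ` K" by blast
qed

lemma borel_dilate [measurable]: "(\<lambda>y. r *\<^sub>R y) ` K \<in> sets borel"
  using K(1) by (intro borel_compact compact_scaling) (simp add: convex_body_def)

text \<open>The open sublevel sets of the norm are countable unions of rational dilates of \<open>K\<close>.\<close>

lemma borel_measurable_body_norm: "body_norm K \<in> borel_measurable borel"
proof (rule borel_measurableI_less)
  fix u :: real
  have "{x. body_norm K x < u} = (\<Union>q\<in>{q\<in>\<rat>. 0 < q \<and> q < u}. (\<lambda>y. q *\<^sub>R y) ` K)"
  proof safe
    fix x assume "body_norm K x < u"
    then obtain r where r: "0 < r" "r < u" "x \<in> (\<lambda>y. r *\<^sub>R y) ` K" by (auto simp: body_norm_less_iff)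
    obtain q where q: "q \<in> \<rat>" "r < q" "q < u" using Rats_dense_in_real[OF r(2)] by blast
    then have "x \<in> (\<lambda>y. q *\<^sub>R y) ` K" using dilate_mono[of r q] r by auto
    then show "x \<in> (\<Union>q\<in>{q\<in>\<rat>. 0 < q \<and> q < u}. (\<lambda>y. q *\<^sub>R y) ` K)" using q r by auto
  qed (auto simp: body_norm_less_iff)
  moreover have "countable {q\<in>\<rat>. 0 < q \<and> q < u}" by (rule countable_subset[OF _ countable_rat]) auto
  ultimately show "{x \<in> space borel. body_norm K x < u} \<in> sets borel"
    by (auto intro!: sets.countable_UN')
qed

lemma body_norm_scaleR_ge:
  assumes \<tau>: "\<tau> \<noteq> 0"
  shows "\<bar>\<tau>\<bar> * body_norm K x \<le> body_norm K (\<tau> *\<^sub>R x)"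
  unfolding body_norm_def[of K "\<tau> *\<^sub>R x"]
proof (rule cInf_greatest)
  show "{r. 0 < r \<and> \<tau> *\<^sub>R x \<in> (\<lambda>y. r *\<^sub>R y) ` K} \<noteq> {}" using body_norm_absorbing by blast
  fix r assume "r \<in> {r. 0 < r \<and> \<tau> *\<^sub>R x \<in> (\<lambda>y. r *\<^sub>R y) ` K}"
  then obtain y where r: "r > 0" and y: "y \<in> K" "\<tau> *\<^sub>R x = r *\<^sub>R y" by auto
  define y' where "y' = sgn \<tau> *\<^sub>R y"
  have "- y \<in> K" using K(2) y(1) by (auto simp: centrally_symmetric_def)
  then have y': "y' \<in> K" using y(1) \<tau> by (auto simp: y'_def sgn_if)
  have "x = (1 / \<tau>) *\<^sub>R (\<tau> *\<^sub>R x)" using \<tau> by simp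
  also have "\<dots> = (r / \<bar>\<tau>\<bar>) *\<^sub>R y'" unfolding y(2) y'_def using \<tau> by (auto simp: sgn_if abs_if)
  finally have "x \<in> (\<lambda>y. (r / \<bar>\<tau>\<bar>) *\<^sub>R y) ` K" using y' by blast
  then have "body_norm K x \<le> r / \<bar>\<tau>\<bar>" using r \<tau> by (intro body_norm_le) auto
  then show "\<bar>\<tau>\<bar> * body_norm K x \<le> r" using \<tau> by (simp add: field_simps)
qed

lemma body_norm_bounded_on_cube: "\<exists>M. \<forall>x\<in>cube R. body_norm K x \<le> M"
proof -
  obtain \<delta> where \<delta>: "\<delta> > 0" "cball 0 \<delta> \<subseteq> K" using convex_body_contains_ball[OF K] .
  have "bounded (cube R :: 'a set)" by (simp add: cube_def bounded_cbox)
  then obtain B where B: "B > 0" "\<And>x. x \<in> cube R \<Longrightarrow> norm (x :: 'a) \<le> B" by (auto simp: bounded_pos)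
  have "body_norm K x \<le> B / \<delta>" if "x \<in> cube R" for x
  proof (rule body_norm_le)
    show "0 < B / \<delta>" using B \<delta> by simp
    have "norm ((\<delta> / B) *\<^sub>R x) \<le> \<delta>" using B(1) B(2)[OF that] \<delta> by (simp add: field_simps)
    then have "(\<delta> / B) *\<^sub>R x \<in> K" using \<delta>(2) by auto
    then show "x \<in> (\<lambda>y. (B / \<delta>) *\<^sub>R y) ` K" using B \<delta> by (intro image_eqI[of _ _ "(\<delta> / B) *\<^sub>R x"]) auto
  qed
  then show ?thesis by blast
qed

text \<open>The open sublevel set \<open>{x. \<parallel>x\<parallel>\<^sub>K < r}\<close> lies in the dilate \<open>r K\<close>.\<close>

lemma emeasure_body_norm_less:
  assumes vol: "emeasure lborel K = 1" and r: "r > 0"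
  shows "emeasure lborel {x. body_norm K x < r} \<le> ennreal (r ^ DIM('a))"
proof -
  have "{x. body_norm K x < r} \<subseteq> (\<lambda>y. r *\<^sub>R y) ` K"
    using dilate_mono[of _ r] by (auto simp: body_norm_less_iff) (meson image_iff less_imp_le subsetD)
  then have "emeasure lborel {x. body_norm K x < r} \<le> emeasure lborel ((\<lambda>y. r *\<^sub>R y) ` K)"
    by (intro emeasure_mono) auto
  also have "\<dots> = (\<integral>\<^sup>+x. indicator ((\<lambda>y. r *\<^sub>R y) ` K) x \<partial>lborel)" by simp
  also have "\<dots> = ennreal (r ^ DIM('a)) * (\<integral>\<^sup>+x. indicator ((\<lambda>y. r *\<^sub>R y) ` K) (0 + r *\<^sub>R x) \<partial>lborel)"
    using r by (subst nn_integral_affine[of _ r 0]) auto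
  also have "(\<lambda>x. indicator ((\<lambda>y. r *\<^sub>R y) ` K) (0 + r *\<^sub>R x) :: ennreal) = indicator K"
    using r by (auto simp: fun_eq_iff indicator_def)
  also have "ennreal (r ^ DIM('a)) * integral\<^sup>N lborel (indicator K) = ennreal (r ^ DIM('a))"
    using vol K(1) by (simp add: convex_body_def borel_compact)
  finally show ?thesis .
qed

text \<open>Layer-cake formula: \<open>exp (- \<kappa> u) = \<integral>\<^bsub>r \<ge> u\<^esub> \<kappa> exp (- \<kappa> r) dr\<close>, so the integral is at most
  \<open>\<integral>\<^bsub>r \<ge> 0\<^esub> \<kappa> exp (- \<kappa> r) r\<^sup>n dr\<close>, a Gamma integral.\<close>

lemma nn_integral_exp_body_norm_le:
  assumes vol: "emeasure lborel K = 1" and \<kappa>: "\<kappa> > 0"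
  shows "(\<integral>\<^sup>+x. ennreal (exp (- \<kappa> * body_norm K x)) \<partial>lborel) \<le> ennreal (fact DIM('a) / \<kappa> ^ DIM('a))"
proof -
  let ?n = "DIM('a)"
  note [measurable] = borel_measurable_body_norm
  have tail: "ennreal (exp (- \<kappa> * u)) = (\<integral>\<^sup>+r. ennreal (\<kappa> * exp (- \<kappa> * r)) * indicator {u..} r \<partial>lborel)" if "u \<ge> 0" for u
  proof -
    have "(\<integral>\<^sup>+r. ennreal (\<kappa> * exp (- \<kappa> * r)) * indicator {u..} r \<partial>lborel) = ennreal (0 - (- exp (- \<kappa> * u)))"
    proof (rule nn_integral_FTC_atLeast)
      show "((\<lambda>r. - exp (- \<kappa> * r)) has_real_derivative \<kappa> * exp (- \<kappa> * r)) (at r)" for r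
        by (auto intro!: derivative_eq_intros)
      have "LIM r at_top. \<kappa> * r :> at_top" using \<kappa> by (intro filterlim_tendsto_pos_mult_at_top[OF tendsto_const]) (auto simp: filterlim_ident)
      then have "LIM r at_top. - \<kappa> * r :> at_bot" by (simp add: filterlim_uminus_at_bot)
      then show "((\<lambda>r. - exp (- \<kappa> * r)) \<longlongrightarrow> 0) at_top"
        using tendsto_minus[OF filterlim_compose[OF exp_at_bot]] by fastforce
    qed (use \<kappa> in auto)
    then show ?thesis by simp
  qed
  have "(\<integral>\<^sup>+x. ennreal (exp (- \<kappa> * body_norm K x)) \<partial>lborel)
     = (\<integral>\<^sup>+x. \<integral>\<^sup>+r. ennreal (\<kappa> * exp (- \<kappa> * r)) * indicator {body_norm K x..} r \<partial>lborel \<partial>lborel)"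
    by (intro nn_integral_cong tail body_norm_nonneg)
  also have "\<dots> = (\<integral>\<^sup>+x. \<integral>\<^sup>+r. ennreal (\<kappa> * exp (- \<kappa> * r)) * indicator {x. body_norm K x < r} x \<partial>lborel \<partial>lborel)"
  proof (rule nn_integral_cong, rule nn_integral_cong_AE)
    fix x
    show "AE r in lborel. ennreal (\<kappa> * exp (- \<kappa> * r)) * indicator {body_norm K x..} r = ennreal (\<kappa> * exp (- \<kappa> * r)) * indicator {x. body_norm K x < r} x"
      using AE_lborel_singleton[of "body_norm K x"] by eventually_elim (auto simp: indicator_def)
  qed
  also have "\<dots> = (\<integral>\<^sup>+r. \<integral>\<^sup>+x. ennreal (\<kappa> * exp (- \<kappa> * r)) * indicator {x. body_norm K x < r} x \<partial>lborel \<partial>lborel)"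
    by (rule lborel_pair.Fubini'[symmetric]) (simp add: indicator_def[abs_def])
  also have "\<dots> = (\<integral>\<^sup>+r. ennreal (\<kappa> * exp (- \<kappa> * r)) * emeasure lborel {x. body_norm K x < r} \<partial>lborel)"
    by (intro nn_integral_cong nn_integral_cmult_indicator) simp
  also have "\<dots> \<le> (\<integral>\<^sup>+r. ennreal (\<kappa> * exp (- \<kappa> * r) * r ^ ?n) * indicator {0..} r \<partial>lborel)"
  proof (rule nn_integral_mono)
    fix r :: real
    show "ennreal (\<kappa> * exp (- \<kappa> * r)) * emeasure lborel {x. body_norm K x < r} \<le> ennreal (\<kappa> * exp (- \<kappa> * r) * r ^ ?n) * indicator {0..} r"
    proof (cases "r > 0")
      case True
      then show ?thesis using \<kappa> emeasure_body_norm_less[OF vol True] by (simp add: ennreal_mult mult_left_mono)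
    next
      case False
      then have "{x. body_norm K x < r} = {}" using body_norm_nonneg by (auto simp: not_less intro: order_trans)
      then show ?thesis by simp
    qed
  qed
  also have "\<dots> = ennreal (1 / \<kappa>) * (\<integral>\<^sup>+s. ennreal (\<kappa> * exp (- \<kappa> * ((1/\<kappa>) * s)) * ((1/\<kappa>) * s) ^ ?n) * indicator {0..} ((1/\<kappa>) * s) \<partial>lborel)"
    using \<kappa> by (subst nn_integral_real_affine[of _ "1 / \<kappa>" 0]) auto
  also have "(\<lambda>s. ennreal (\<kappa> * exp (- \<kappa> * ((1/\<kappa>) * s)) * ((1/\<kappa>) * s) ^ ?n) * indicator {0..} ((1/\<kappa>) * s))
      = (\<lambda>s. ennreal (\<kappa> / \<kappa> ^ ?n) * (ennreal (s ^ ?n * exp (- s)) * indicator {0..} s))"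
  proof
    fix s
    have "\<kappa> * exp (- \<kappa> * ((1/\<kappa>) * s)) * ((1/\<kappa>) * s) ^ ?n = (\<kappa> / \<kappa> ^ ?n) * (s ^ ?n * exp (- s))"
      using \<kappa> by (simp add: power_divide)
    then show "ennreal (\<kappa> * exp (- \<kappa> * ((1/\<kappa>) * s)) * ((1/\<kappa>) * s) ^ ?n) * indicator {0..} ((1/\<kappa>) * s)
      = ennreal (\<kappa> / \<kappa> ^ ?n) * (ennreal (s ^ ?n * exp (- s)) * indicator {0..} s)"
      using \<kappa> by (auto simp: indicator_def ennreal_mult[symmetric] zero_le_divide_iff)
  qed
  also have "ennreal (1 / \<kappa>) * (\<integral>\<^sup>+s. ennreal (\<kappa> / \<kappa> ^ ?n) * (ennreal (s ^ ?n * exp (- s)) * indicator {0..} s) \<partial>lborel)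
     = ennreal (1 / \<kappa>) * (ennreal (\<kappa> / \<kappa> ^ ?n) * ennreal (fact ?n))"
    by (simp add: nn_integral_cmult nn_intergal_power_times_exp_Ici)
  also have "\<dots> = ennreal (fact ?n / \<kappa> ^ ?n)"
    using \<kappa> by (simp add: ennreal_mult[symmetric])
  finally show ?thesis .
qed

text \<open>Gibbs' inequality compares \<open>f\<close> with the density proportional to \<open>q = exp (- \<kappa> \<parallel>z\<parallel>\<^sub>K)\<close>, whose mass
  is at most \<open>Z = n! / \<kappa>\<^sup>n\<close>, and yields
  \<open>\<kappa> E \<parallel>z\<parallel>\<^sub>K \<ge> - ln Z - \<integral> f ln f \<ge> n ln \<kappa> - ln n!\<close>.\<close>

proposition expected_body_norm_ge:
  assumes vol: "emeasure lborel K = 1" and f: "nonneg_entropy_density R f"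
  shows "real DIM('a) / (exp 1 * (real DIM('a) + 1)) \<le> (\<integral>z. f z * body_norm K z \<partial>lborel)"
    and "integrable lborel (\<lambda>z. f z * body_norm K z)"
proof -
  let ?n = "real DIM('a)"
  note [measurable] = borel_measurable_body_norm
  have F: "bounded_measurable borel f" "\<And>x. 0 \<le> f x" "\<And>x. x \<notin> cube R \<Longrightarrow> f x = 0"
    "(\<integral>x. f x * ln (f x) \<partial>lborel) \<le> 0"
    using f by (auto simp: nonneg_entropy_density_def)
  have [measurable]: "f \<in> borel_measurable borel" using F(1) by auto
  note int_f = nonneg_entropy_density_integral[OF f]
  obtain M where M: "\<And>x. x \<in> cube R \<Longrightarrow> body_norm K x \<le> M" using body_norm_bounded_on_cube by blast
  have "bounded_measurable borel (\<lambda>z. indicator (cube R) z * body_norm K z)"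
    unfolding bounded_measurable_def
  proof (intro conjI exI ballI)
    show "\<bar>indicator (cube R) z * body_norm K z\<bar> \<le> \<bar>M\<bar>" for z
      using M[of z] body_norm_nonneg[of z] by (cases "z \<in> cube R") auto
  qed measurable
  from bounded_measurable_mult[OF F(1) this]
  have "integrable lborel (\<lambda>z. f z * (indicator (cube R) z * body_norm K z))"
    by (rule integrable_lborel_of_cube[of _ R]) (simp add: F(3))
  moreover have "(\<lambda>z. f z * (indicator (cube R) z * body_norm K z)) = (\<lambda>z. f z * body_norm K z)"
    using F(3) by (auto simp: fun_eq_iff indicator_def)
  ultimately show int_fK: "integrable lborel (\<lambda>z. f z * body_norm K z)" by simp
  have int_ent: "integrable lborel (\<lambda>z. f z * ln (f z))"
    using F by (intro integrable_lborel_of_cube[of _ R] bounded_measurable_x_ln_x) auto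
  define m where "m = (\<integral>z. f z * body_norm K z \<partial>lborel)"
  \<comment> \<open>The best value would be \<open>e (n!)\<^bsup>1/n\<^esup>\<close>; this one suffices because \<open>n! \<le> (n + 1)\<^sup>n\<close>.\<close>
  define \<kappa> where "\<kappa> = exp 1 * (?n + 1)"
  have \<kappa>: "\<kappa> > 0" by (simp add: \<kappa>_def add_nonneg_pos)
  define Z where "Z = fact DIM('a) / \<kappa> ^ DIM('a)"
  have Z: "Z > 0" using \<kappa> by (simp add: Z_def)
  define q where "q z = exp (- \<kappa> * body_norm K z)" for z
  have q_le: "(\<integral>\<^sup>+z. ennreal (q z) \<partial>lborel) \<le> ennreal Z"
    unfolding q_def Z_def by (rule nn_integral_exp_body_norm_le[OF vol \<kappa>])
  have q_nn: "0 \<le> q z" for z by (simp add: q_def)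
  have int_q: "integrable lborel q"
  proof (rule integrableI_nonneg)
    show "(\<integral>\<^sup>+z. ennreal (q z) \<partial>lborel) < \<infinity>" using le_less_trans[OF q_le ennreal_less_top] by simp
  qed (auto simp: q_def[abs_def])
  have q_le': "(\<integral>z. q z \<partial>lborel) \<le> Z"
    using nn_integral_eq_integral[OF int_q] q_le Z q_nn by simp
  have gibbs: "- \<kappa> * (f z * body_norm K z) - ln Z * f z - f z * ln (f z) \<le> q z / Z - f z" for z
  proof (cases "f z = 0")
    case True
    then show ?thesis using Z by (simp add: q_def)
  next
    case False
    then have fz: "f z > 0" using F(2)[of z] by simp
    have "ln (q z / (Z * f z)) \<le> q z / (Z * f z) - 1"
      using fz Z by (intro ln_le_minus_one) (simp add: q_def)
    then have "f z * ln (q z / (Z * f z)) \<le> f z * (q z / (Z * f z) - 1)" using fz by (intro mult_left_mono) auto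
    also have "\<dots> = q z / Z - f z" using fz Z by (simp add: field_simps)
    also have "ln (q z / (Z * f z)) = - \<kappa> * body_norm K z - ln Z - ln (f z)"
      using fz Z by (simp add: q_def ln_div ln_mult)
    finally show ?thesis by (simp add: algebra_simps)
  qed
  have "(\<integral>z. - \<kappa> * (f z * body_norm K z) - ln Z * f z - f z * ln (f z) \<partial>lborel) \<le> (\<integral>z. q z / Z - f z \<partial>lborel)"
    using int_fK int_ent int_f(1) int_q by (intro integral_mono gibbs) auto
  then have "- \<kappa> * m - ln Z - (\<integral>z. f z * ln (f z) \<partial>lborel) \<le> (\<integral>z. q z \<partial>lborel) / Z - 1"
    using int_fK int_ent int_f int_q by (simp add: m_def)
  moreover have "(\<integral>z. q z \<partial>lborel) / Z \<le> 1" using q_le' Z by simp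
  ultimately have "- ln Z \<le> \<kappa> * m" using F(4) by linarith
  moreover have "?n \<le> - ln Z"
  proof -
    have "(fact DIM('a) :: real) \<le> ?n ^ DIM('a)" using fact_le_power[of "DIM('a)", where 'a=real] by simp
    also have "\<dots> \<le> (?n + 1) ^ DIM('a)" by (intro power_mono) auto
    finally have "ln (fact DIM('a) :: real) \<le> ln ((?n + 1) ^ DIM('a))" by simp
    also have "\<dots> = ?n * ln (?n + 1)" by (simp add: ln_realpow add_nonneg_pos)
    finally have 1: "ln (fact DIM('a) :: real) \<le> ?n * ln (?n + 1)" .
    have "ln Z = ln (fact DIM('a)) - ?n * ln \<kappa>" using \<kappa> by (simp add: Z_def ln_div ln_realpow)
    moreover have "ln \<kappa> = 1 + ln (?n + 1)" by (simp add: \<kappa>_def ln_mult add_nonneg_pos)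
    ultimately show ?thesis using 1 by (simp add: algebra_simps)
  qed
  ultimately have "?n \<le> \<kappa> * m" by linarith
  then have "?n / \<kappa> \<le> m" using \<kappa> by (simp add: field_simps)
  then show "?n / (exp 1 * (?n + 1)) \<le> (\<integral>z. f z * body_norm K z \<partial>lborel)" by (simp add: \<kappa>_def m_def)
qed

end

section \<open>The lower bound\<close>

theorem theorem1p2:
  fixes C :: "'s::finite \<Rightarrow> (real ^ 'n) set"
    and K :: "(real ^ 'n) set"
    and t :: "real ^ 's"
  assumes "\<And>j. convex_body (C j)"
    and "\<And>j. centrally_symmetric (C j)"
    and "\<And>j. measure lborel (C j) = 1"
    and "convex_body K"
    and "centrally_symmetric K"
    and "measure lborel K = 1"
  shows "multi_integral_norm C K t
           \<ge> real CARD('n) / (exp 1 * (real CARD('n) + 1)) * norm t"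
proof -
  note K = assms(4,5)
  note [measurable] = borel_measurable_body_norm[OF K]
  have vol: "emeasure lborel A = 1" if "measure lborel A = 1" for A :: "(real ^ 'n) set"
  proof -
    have "emeasure lborel A \<noteq> \<top>" using that by (auto simp: measure_def)
    then show ?thesis by (simp add: emeasure_eq_ennreal_measure that)
  qed
  have compact: "compact (C j)" for j using assms(1) by (simp add: convex_body_def)
  then have [measurable]: "C j \<in> sets borel" for j by (simp add: borel_compact)
  define P where "P = PiM (UNIV :: 's set) (\<lambda>_. lborel :: (real ^ 'n) measure)"
  define I where "I = (\<integral>\<^sup>+x. (\<Prod>j\<in>UNIV. indicator (C j) (x j)) * ennreal (body_norm K (\<Sum>j\<in>UNIV. (t $ j) *\<^sub>R x j)) \<partial>P)"
  have M: "multi_integral_norm C K t = enn2real I"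
  proof -
    have ind: "indicator (\<Pi>\<^sub>E j\<in>UNIV. C j) x = (if \<forall>j. x j \<in> C j then 1 else 0 :: real)" for x
      by (auto simp: indicator_def PiE_UNIV_domain)
    have "multi_integral_norm C K t = (\<integral>x. indicator (\<Pi>\<^sub>E j\<in>UNIV. C j) x * body_norm K (\<Sum>j\<in>UNIV. (t $ j) *\<^sub>R x j) \<partial>P)"
      by (simp add: multi_integral_norm_def assms(3) set_lebesgue_integral_def P_def)
    also have "\<dots> = enn2real (\<integral>\<^sup>+x. ennreal (indicator (\<Pi>\<^sub>E j\<in>UNIV. C j) x * body_norm K (\<Sum>j\<in>UNIV. (t $ j) *\<^sub>R x j)) \<partial>P)"
    proof (rule integral_eq_nn_integral)
      have "(\<Pi>\<^sub>E j\<in>UNIV. C j) \<in> sets P" unfolding P_def by (intro sets_PiM_I_finite) auto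
      then have [measurable]: "indicator (\<Pi>\<^sub>E j\<in>UNIV. C j) \<in> borel_measurable P" by simp
      have [measurable]: "(\<lambda>x. \<Sum>j\<in>UNIV. (t $ j) *\<^sub>R x j) \<in> P \<rightarrow>\<^sub>M borel" unfolding P_def by measurable
      show "(\<lambda>x. indicator (\<Pi>\<^sub>E j\<in>UNIV. C j) x * body_norm K (\<Sum>j\<in>UNIV. (t $ j) *\<^sub>R x j)) \<in> borel_measurable P"
        by measurable
    qed (simp add: body_norm_nonneg[OF K])
    also have "(\<integral>\<^sup>+x. ennreal (indicator (\<Pi>\<^sub>E j\<in>UNIV. C j) x * body_norm K (\<Sum>j\<in>UNIV. (t $ j) *\<^sub>R x j)) \<partial>P) = I"
      unfolding I_def by (intro nn_integral_cong) (simp add: ind prod_indicator)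
    finally show ?thesis .
  qed
  show ?thesis
  proof (cases "t = 0")
    case True
    then show ?thesis using M enn2real_nonneg[of I] by simp
  next
    case False
    then have "\<not> (\<forall>j\<in>UNIV. t $ j = 0)" by (auto simp: vec_eq_iff)
    then obtain \<tau> R f where \<tau>: "\<tau>\<^sup>2 = (\<Sum>j\<in>UNIV. (t $ j)\<^sup>2)" "\<tau> \<noteq> 0" and f: "nonneg_entropy_density R f"
      and law: "\<And>\<phi>. \<phi> \<in> borel_measurable borel \<Longrightarrow> (\<integral>\<^sup>+x. (\<Prod>j\<in>UNIV. indicator (C j) (x j)) * \<phi> (\<Sum>j\<in>UNIV. (t $ j) *\<^sub>R x j) \<partial>P)
       = (\<integral>\<^sup>+z. ennreal (f z) * \<phi> (\<tau> *\<^sub>R z) \<partial>lborel)"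
      unfolding P_def using law_of_weighted_sum[of UNIV C "\<lambda>j. t $ j", OF finite compact vol[OF assms(3)]] by blast
    have norm_t: "\<bar>\<tau>\<bar> = norm t"
      using \<tau>(1) by (simp add: norm_vec_def L2_set_def flip: real_sqrt_abs)
    have f_nn: "0 \<le> f z" for z using f by (simp add: nonneg_entropy_density_def)
    have [measurable]: "f \<in> borel_measurable borel" using f by (auto simp: nonneg_entropy_density_def)
    note E = expected_body_norm_ge[OF K vol[OF assms(6)] f]
    have I_eq: "I = (\<integral>\<^sup>+z. ennreal (f z) * ennreal (body_norm K (\<tau> *\<^sub>R z)) \<partial>lborel)"
      unfolding I_def by (rule law) simp
    have "ennreal (norm t * (\<integral>z. f z * body_norm K z \<partial>lborel)) = (\<integral>\<^sup>+z. ennreal (norm t * (f z * body_norm K z)) \<partial>lborel)"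
      using E(2) f_nn body_norm_nonneg[OF K] by (subst nn_integral_eq_integral) auto
    also have "\<dots> \<le> I"
      unfolding I_eq
    proof (rule nn_integral_mono)
      fix z
      have "norm t * (f z * body_norm K z) \<le> f z * body_norm K (\<tau> *\<^sub>R z)"
        using mult_left_mono[OF body_norm_scaleR_ge[OF K \<tau>(2), of z] f_nn[of z]] by (simp add: norm_t mult_ac)
      then show "ennreal (norm t * (f z * body_norm K z)) \<le> ennreal (f z) * ennreal (body_norm K (\<tau> *\<^sub>R z))"
        using f_nn body_norm_nonneg[OF K] by (simp add: ennreal_mult[symmetric] ennreal_leI)
    qed
    finally have le: "ennreal (norm t * (\<integral>z. f z * body_norm K z \<partial>lborel)) \<le> I" .
    have "I < \<top>"
    proof -
      have "\<exists>M. \<forall>z\<in>cube R. body_norm K (\<tau> *\<^sub>R z) \<le> M"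
      proof -
        obtain M where M: "\<forall>w\<in>cube (\<bar>\<tau>\<bar> * R). body_norm K w \<le> M" using body_norm_bounded_on_cube[OF K] by blast
        have "\<tau> *\<^sub>R z \<in> cube (\<bar>\<tau>\<bar> * R)" if "z \<in> cube R" for z :: "real ^ 'n"
          using that by (auto simp: mem_cube abs_mult intro: mult_left_mono)
        then show ?thesis using M by blast
      qed
      then obtain M where M: "\<And>z. z \<in> cube R \<Longrightarrow> body_norm K (\<tau> *\<^sub>R z) \<le> M" by blast
      have "I \<le> (\<integral>\<^sup>+z. ennreal (f z) * ennreal M \<partial>lborel)"
        unfolding I_eq
      proof (rule nn_integral_mono)
        fix z
        show "ennreal (f z) * ennreal (body_norm K (\<tau> *\<^sub>R z)) \<le> ennreal (f z) * ennreal M"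
        proof (cases "z \<in> cube R")
          case True
          then show ?thesis by (intro mult_left_mono ennreal_leI M) auto
        next
          case False
          then have "f z = 0" using f by (simp add: nonneg_entropy_density_def)
          then show ?thesis by simp
        qed
      qed
      also have "\<dots> = ennreal M" using f by (simp add: nn_integral_multc nonneg_entropy_density_def)
      finally show ?thesis using le_less_trans[OF _ ennreal_less_top] by blast
    qed
    then have "norm t * (\<integral>z. f z * body_norm K z \<partial>lborel) \<le> multi_integral_norm C K t"
      unfolding M using enn2real_mono[OF le] f_nn body_norm_nonneg[OF K] by simp
    moreover have "norm t * (real CARD('n) / (exp 1 * (real CARD('n) + 1))) \<le> norm t * (\<integral>z. f z * body_norm K z \<partial>lborel)"
      using E(1) by (intro mult_left_mono) auto
    ultimately show ?thesis by (simp add: mult.commute)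
  qed
qed

end
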